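(* For every $r\ge0$ let $\psi_{\mathcal X}(r)\colon\mathcal W(r)\to\mathcal X(r)$ be the $\mathbb Z[\mathrm C_r]$-linear map, from the minimal complex $\mathcal W(r)$ to the arity $r$ part of the surjection operad $\mathcal X$, defined recursively on basis elements by $$\psi_{\mathcal X}(r)(e_0)=(1,\dots,r),\qquad \psi_{\mathcal X}(r)(e_{2m+1})=h\,T\,\psi_{\mathcal X}(r)(e_{2m}),\qquad \psi_{\mathcal X}(r)(e_{2m})=h\,N\,\psi_{\mathcal X}(r)(e_{2m-1}),$$ where $h$ is the homotopy on $\mathcal X(r)$ described in the context. Then the collection $\psi_{\mathcal X}=\{\psi_{\mathcal X}(r)\}_{r\ge0}$ is a morphism of $\mathrm C$-modules $\mathcal W\to\mathcal X$ (in particular each $\psi_{\mathcal X}(r)$ is a chain map) and it defines a May--Steenrod structure on the operad $\mathcal X$.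
   Context: All chain complexes are homologically graded complexes of $\mathbb Z$-modules. **Groups.** $\mathrm S_r$ is the symmetric group on $r$ elements ($\mathrm S_0$ is trivial) and $\mathrm C_r\subset \mathrm S_r$ is the cyclic subgroup of order $r$ generated by the cycle $\rho$ with $\rho(1)=2,\dots,\rho(r-1)=r,\rho(r)=1$ (for $r=0$, $\mathrm C_0$ is the trivial group and $\rho=1$). In $\mathbb Z[\mathrm C_r]$ put $T=\rho-1$ and $N=1+\rho+\cdots+\rho^{r-1}$ (the sum of all group elements; for $r=0$, $N=1$). **$\Gamma$-modules.** An $\mathrm S$-module (resp. $\mathrm C$-module) is a collection, indexed by $r\ge 0$, of chain complexes of left $\mathbb Z[\mathrm S_r]$-modules (resp. $\mathbb Z[\mathrm C_r]$-modules); morphisms are collections of equivariant chain maps. Right actions are turned into left ones using inverses. Every $\mathrm S$-module is a $\mathrm C$-module by restriction. A morphism is a quasi-isomorphism if it is one in each arity $r$. **The $\mathrm C$-module $\mathcal W$.** $\mathcal W(r)$ is concentrated in non-negative degrees, with $\mathcal W(r)_d$ the free $\mathbb Z[\mathrm C_r]$-module on one generator $e_d$ for each $d\ge0$, and differential determined by $\partial e_d=Te_{d-1}$ for $d$ odd and $\partial e_d=Ne_{d-1}$ for $d>0$ even. **$E_\infty$-operads.** An operad is an $\mathrm S$-module with the usual associative, equivariant, unital operadic compositions. An operad $\mathcal R$ is an $E_\infty$-operad if $\mathcal R(0)=\mathbb Z$ and there is a morphism of $\mathrm S$-modules $\mathcal R\to\underline{\mathbb Z}$, where $\underline{\mathbb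 Z}(r)=\mathbb Z$ with trivial action in degree $0$, such that for each $r$ the map $\mathcal R(r)\to\mathbb Z$ is a quasi-isomorphism and $\mathcal R(r)$ is a free $\mathbb Z[\mathrm S_r]$-module in each degree. **May--Steenrod structures.** A May--Steenrod structure on an operad $\mathcal O$ is a morphism of $\mathrm C$-modules $\psi\colon\mathcal W\to\mathcal O$ for which there exist an $E_\infty$-operad $\mathcal R$, a quasi-isomorphism of $\mathrm C$-modules $\iota\colon\mathcal W\to\mathcal R$ and a morphism of operads $\phi\colon\mathcal R\to\mathcal O$ with $\psi=\phi\circ\iota$. **The surjection operad $\mathcal X$ (McClure--Smith sign convention).** $\mathcal X(r)_n$ is the free abelian group on all functions $s\colon\{1,\dots,n+r\}\to\{1,\dots,r\}$, written as sequences $(s(1),\dots,s(n+r))$, modulo the subgroup generated by the degenerate ones, i.e. those which are non-surjective or satisfy $s(j)=s(j+1)$ for some $j$. Signs follow the Koszul convention, regarding a surjection $s$ as the top-dimensional generator of $\bigotimes_{i=1}^rN_\bullet(\triangle^{s^{-1}(i)};\mathbb Z)$, the tensor product of the normalized chains of the simplices with (ordered) vertex sets $s^{-1}(i)$. Explicitly, if $m_i=|s^{-1}(i)|-1$, then $\partial s$ is the sum over $i\in\{1,\dots,r\}$ and $0\le j\le m_i$ of $(-1)^{m_1+\cdots+m_{i-1}+j}$ times the sequence obtained by removing the $(j+1)$-st occurrence of $i$ (zero if the result is degenerate). A permutation $\sigma\in \mathrm S_r$ acts by $\sigma\cdot s=\pm\,\sigma\circ s$ with sign $\prod(-1)^{m_im_j}$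 over the pairs $i<j$ with $\sigma(i)>\sigma(j)$. The operadic composition is the standard one of McClure--Smith ("Multivariable cochain operations and little $n$-cubes"), with which $\mathcal X$ is known to be an $E_\infty$-operad. **The homotopy $h$.** Define linear maps on basis sequences: $i\colon\mathcal X(r-1)\to\mathcal X(r)$ increases every entry by $1$ and places a $1$ at the beginning; $p\colon\mathcal X(r)\to\mathcal X(r-1)$ sends a sequence to $0$ unless it contains exactly one occurrence of $1$, in which case it removes this $1$ and decreases all remaining entries by $1$; $s\colon\mathcal X(r)\to\mathcal X(r)$ (of degree $1$) places a $1$ at the beginning of the sequence (giving $0$ if the sequence already begins with $1$). On $\mathcal X(r)$, $r\ge 1$, set $h=s+i\,s\,p+\cdots+i^{r-1}\,s\,p^{r-1}$, where in the term $i^ksp^k$ the map $s$ is that of $\mathcal X(r-k)$. For $r=0$, $\mathcal X(0)=\mathbb Z$ is concentrated in degree $0$, generated by the empty sequence, and $h=0$. *)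

theory Defs
  imports "HOL-Algebra.Sym_Groups" "HOL-Algebra.Free_Abelian_Groups"
begin

section \<open>\<open>\<Gamma>\<close>-modules\<close>

text \<open>
  A family of groups \<open>G r\<close> of permutations is given (\<open>sym_group\<close>, or the cyclic subgroups
  \<open>cyc_group\<close> below).  A left \<open>\<int>[G r]\<close>-module is encoded as a commutative group in the sense of
  HOL-Algebra (written multiplicatively there) on which \<open>G r\<close> acts by group homomorphisms.
  \<open>chain M r n\<close> is the degree \<open>n\<close> part in arity \<open>r\<close>, and \<open>bdry M r n\<close> maps degree \<open>n\<close> to \<open>n - 1\<close>.
  All maps are only meaningful on the carriers.
\<close>

record 'a gamma =
  chain :: "nat \<Rightarrow> int \<Rightarrow> 'a monoid"
  bdry :: "nat \<Rightarrow> int \<Rightarrow> 'a \<Rightarrow> 'a"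
  act :: "nat \<Rightarrow> int \<Rightarrow> (nat \<Rightarrow> nat) \<Rightarrow> 'a \<Rightarrow> 'a"

locale gamma_module =
  fixes G :: "nat \<Rightarrow> (nat \<Rightarrow> nat) monoid" and M :: "('a, 'm) gamma_scheme"
  assumes chain_comm_group: "comm_group (chain M r n)"
    and bdry_hom: "bdry M r n \<in> hom (chain M r n) (chain M r (n - 1))"
    and bdry_bdry: "x \<in> carrier (chain M r n) \<Longrightarrow>
          bdry M r (n - 1) (bdry M r n x) = \<one>\<^bsub>chain M r (n - 1 - 1)\<^esub>"
    and act_hom: "g \<in> carrier (G r) \<Longrightarrow> act M r n g \<in> hom (chain M r n) (chain M r n)"
    and act_one: "x \<in> carrier (chain M r n) \<Longrightarrow> act M r n \<one>\<^bsub>G r\<^esub> x = x"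
    and act_mult: "\<lbrakk>g \<in> carrier (G r); k \<in> carrier (G r); x \<in> carrier (chain M r n)\<rbrakk> \<Longrightarrow>
          act M r n (g \<otimes>\<^bsub>G r\<^esub> k) x = act M r n g (act M r n k x)"
    and bdry_act: "\<lbrakk>g \<in> carrier (G r); x \<in> carrier (chain M r n)\<rbrakk> \<Longrightarrow>
          bdry M r n (act M r n g x) = act M r (n - 1) g (bdry M r n x)"

text \<open>The bounds are such that \<open>rho 0 = id\<close>.\<close>

definition rho :: "nat \<Rightarrow> nat \<Rightarrow> nat" where
  "rho r i = (if 1 \<le> i \<and> i < r then Suc i else if 1 \<le> i \<and> i = r then 1 else i)"

definition cyc_group :: "nat \<Rightarrow> (nat \<Rightarrow> nat) monoid" where
  "cyc_group r = subgroup_generated (sym_group r) {rho r}"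

locale gamma_morphism = src: gamma_module G M + tgt: gamma_module G M'
  for G and M :: "('a, 'm) gamma_scheme" and M' :: "('b, 'n) gamma_scheme" +
  fixes f :: "nat \<Rightarrow> int \<Rightarrow> 'a \<Rightarrow> 'b"
  assumes map_hom: "f r n \<in> hom (chain M r n) (chain M' r n)"
    and map_bdry: "x \<in> carrier (chain M r n) \<Longrightarrow>
          bdry M' r n (f r n x) = f r (n - 1) (bdry M r n x)"
    and map_act: "\<lbrakk>g \<in> carrier (G r); x \<in> carrier (chain M r n)\<rbrakk> \<Longrightarrow>
          f r n (act M r n g x) = act M' r n g (f r n x)"

abbreviation "S_morphism \<equiv> gamma_morphism sym_group"
abbreviation "C_morphism \<equiv> gamma_morphism cyc_group"

definition cycles :: "('a, 'm) gamma_scheme \<Rightarrow> nat \<Rightarrow> int \<Rightarrow> 'a set" where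
  "cycles M r n = kernel (chain M r n) (chain M r (n - 1)) (bdry M r n)"

definition boundaries :: "('a, 'm) gamma_scheme \<Rightarrow> nat \<Rightarrow> int \<Rightarrow> 'a set" where
  "boundaries M r n = bdry M r (n + 1) ` carrier (chain M r (n + 1))"

definition homology :: "('a, 'm) gamma_scheme \<Rightarrow> nat \<Rightarrow> int \<Rightarrow> 'a set monoid" where
  "homology M r n = (chain M r n)\<lparr>carrier := cycles M r n\<rparr> Mod boundaries M r n"

text \<open>The induced map sends the class of \<open>x\<close> to the class of \<open>f x\<close>.\<close>

definition homology_map ::
    "('b, 'n) gamma_scheme \<Rightarrow> (nat \<Rightarrow> int \<Rightarrow> 'a \<Rightarrow> 'b) \<Rightarrow> nat \<Rightarrow> int \<Rightarrow> 'a set \<Rightarrow> 'b set" where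
  "homology_map M' f r n c = (\<Union>x\<in>c. boundaries M' r n #>\<^bsub>chain M' r n\<^esub> f r n x)"

definition quasi_iso ::
    "('a, 'm) gamma_scheme \<Rightarrow> ('b, 'n) gamma_scheme \<Rightarrow> (nat \<Rightarrow> int \<Rightarrow> 'a \<Rightarrow> 'b) \<Rightarrow> bool" where
  "quasi_iso M M' f \<longleftrightarrow>
     (\<forall>r n. homology_map M' f r n \<in> iso (homology M r n) (homology M' r n))"

text \<open>
  A \<open>\<int>[G]\<close>-module is free if for some subset \<open>B\<close> the canonical map from \<open>\<int>[G]\<^bsup>(B)\<^esup>\<close>, whose
  underlying group is free abelian on \<open>G \<times> B\<close>, is an isomorphism.
\<close>

definition free_module ::
    "(nat \<Rightarrow> nat) monoid \<Rightarrow> 'a monoid \<Rightarrow> ((nat \<Rightarrow> nat) \<Rightarrow> 'a \<Rightarrow> 'a) \<Rightarrow> bool" where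
  "free_module G A a \<longleftrightarrow> (\<exists>B \<subseteq> carrier A.
     (\<lambda>c. \<Otimes>\<^bsub>A\<^esub>p\<in>Poly_Mapping.keys c. a (fst p) (snd p) [^]\<^bsub>A\<^esub> Poly_Mapping.lookup c p)
       \<in> iso (free_Abelian_group (carrier G \<times> B)) A)"


section \<open>Operads\<close>

text \<open>
  Operads are given by partial compositions: \<open>pcomp P r m i s n x y\<close> is \<open>x \<circ>\<^sub>i y\<close> for \<open>x\<close> of arity
  \<open>r\<close> and degree \<open>m\<close>, and \<open>y\<close> of arity \<open>s\<close> and degree \<open>n\<close>.
\<close>

record 'a operad = "'a gamma" +
  pcomp :: "nat \<Rightarrow> int \<Rightarrow> nat \<Rightarrow> nat \<Rightarrow> int \<Rightarrow> 'a \<Rightarrow> 'a \<Rightarrow> 'a"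
  opunit :: 'a

text \<open>
  Inputs of \<open>x \<circ>\<^sub>i y\<close> numbered below \<open>i\<close> come from \<open>x\<close>, the next \<open>s\<close> ones come from \<open>y\<close>, the others
  from \<open>x\<close>.  If \<open>x\<close> is relabelled by \<open>\<sigma>\<close> and \<open>y\<close> by \<open>\<tau>\<close>, then the composite at \<open>\<sigma> i\<close> is relabelled
  by \<open>block_perm s i \<sigma> \<tau>\<close>.
\<close>

definition block_perm :: "nat \<Rightarrow> nat \<Rightarrow> (nat \<Rightarrow> nat) \<Rightarrow> (nat \<Rightarrow> nat) \<Rightarrow> nat \<Rightarrow> nat" where
  "block_perm s i \<sigma> \<tau> a =
     (let shift = (\<lambda>v. if v < \<sigma> i then v else v + s - 1) in
      if a < i then shift (\<sigma> a)
      else if a < i + s then \<sigma> i - 1 + \<tau> (a + 1 - i)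
      else shift (\<sigma> (a + 1 - s)))"

definition sign_pow :: "('a, 'm) monoid_scheme \<Rightarrow> int \<Rightarrow> 'a \<Rightarrow> 'a" where
  "sign_pow A k x = (if even k then x else inv\<^bsub>A\<^esub> x)"

locale operad = gamma_module sym_group P for P :: "('a, 'm) operad_scheme" +
  assumes pcomp_hom_left: "\<lbrakk>i \<in> {1..r}; y \<in> carrier (chain P s n)\<rbrakk> \<Longrightarrow>
          (\<lambda>x. pcomp P r m i s n x y) \<in> hom (chain P r m) (chain P (r + s - 1) (m + n))"
    and pcomp_hom_right: "\<lbrakk>i \<in> {1..r}; x \<in> carrier (chain P r m)\<rbrakk> \<Longrightarrow>
          (\<lambda>y. pcomp P r m i s n x y) \<in> hom (chain P s n) (chain P (r + s - 1) (m + n))"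
    and pcomp_bdry: "\<lbrakk>i \<in> {1..r}; x \<in> carrier (chain P r m); y \<in> carrier (chain P s n)\<rbrakk> \<Longrightarrow>
          bdry P (r + s - 1) (m + n) (pcomp P r m i s n x y) =
            pcomp P r (m - 1) i s n (bdry P r m x) y \<otimes>\<^bsub>chain P (r + s - 1) (m + n - 1)\<^esub>
            sign_pow (chain P (r + s - 1) (m + n - 1)) m
              (pcomp P r m i s (n - 1) x (bdry P s n y))"
    and pcomp_act: "\<lbrakk>i \<in> {1..r}; \<sigma> \<in> carrier (sym_group r); \<tau> \<in> carrier (sym_group s);
            x \<in> carrier (chain P r m); y \<in> carrier (chain P s n)\<rbrakk> \<Longrightarrow>
          pcomp P r m (\<sigma> i) s n (act P r m \<sigma> x) (act P s n \<tau> y) =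
            act P (r + s - 1) (m + n) (block_perm s i \<sigma> \<tau>) (pcomp P r m i s n x y)"
    and pcomp_assoc_seq: "\<lbrakk>i \<in> {1..r}; j \<in> {1..s}; x \<in> carrier (chain P r m);
            y \<in> carrier (chain P s n); z \<in> carrier (chain P t l)\<rbrakk> \<Longrightarrow>
          pcomp P (r + s - 1) (m + n) (i - 1 + j) t l (pcomp P r m i s n x y) z =
            pcomp P r m i (s + t - 1) (n + l) x (pcomp P s n j t l y z)"
    and pcomp_assoc_par: "\<lbrakk>i \<in> {1..r}; k \<in> {1..r}; i < k; x \<in> carrier (chain P r m);
            y \<in> carrier (chain P s n); z \<in> carrier (chain P t l)\<rbrakk> \<Longrightarrow>
          pcomp P (r + s - 1) (m + n) (k + s - 1) t l (pcomp P r m i s n x y) z =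
            sign_pow (chain P (r + s - 1 + t - 1) (m + n + l)) (n * l)
              (pcomp P (r + t - 1) (m + l) i s n (pcomp P r m k t l x z) y)"
    and opunit_closed: "opunit P \<in> carrier (chain P 1 0)"
    and opunit_cycle: "bdry P 1 0 (opunit P) = \<one>\<^bsub>chain P 1 (- 1)\<^esub>"
    and opunit_left: "y \<in> carrier (chain P s n) \<Longrightarrow> pcomp P 1 0 1 s n (opunit P) y = y"
    and opunit_right: "\<lbrakk>i \<in> {1..r}; x \<in> carrier (chain P r m)\<rbrakk> \<Longrightarrow>
          pcomp P r m i 1 0 x (opunit P) = x"

locale operad_morphism = src_op: operad P + tgt_op: operad Q + gamma_morphism sym_group P Q f
  for P :: "('a, 'm) operad_scheme" and Q :: "('b, 'n) operad_scheme" and f +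
  assumes map_pcomp: "\<lbrakk>i \<in> {1..r}; x \<in> carrier (chain P r m); y \<in> carrier (chain P s n)\<rbrakk> \<Longrightarrow>
          f (r + s - 1) (m + n) (pcomp P r m i s n x y) =
            pcomp Q r m i s n (f r m x) (f s n y)"
    and map_opunit: "f 1 0 (opunit P) = opunit Q"

definition const_Z :: "int gamma" where
  "const_Z = \<lparr>chain = (\<lambda>r n. if n = 0 then integer_group else singleton_group 0),
              bdry = (\<lambda>r n x. 0), act = (\<lambda>r n g x. x)\<rparr>"

definition E_infinity :: "('a, 'm) operad_scheme \<Rightarrow> bool" where
  "E_infinity R \<longleftrightarrow> operad R \<and>
     chain R 0 0 \<cong> integer_group \<and> (\<forall>n. n \<noteq> 0 \<longrightarrow> trivial_group (chain R 0 n)) \<and>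
     (\<exists>\<epsilon>. S_morphism R const_Z \<epsilon> \<and> quasi_iso R const_Z \<epsilon>) \<and>
     (\<forall>r n. free_module (sym_group r) (chain R r n) (act R r n))"


section \<open>The minimal complex and May--Steenrod structures\<close>

text \<open>
  The group ring \<open>\<int>[C\<^sub>r]\<close> is the free abelian group on the elements of \<open>cyc_group r\<close>; \<open>ring_act a\<close>
  is the additive extension to the group ring of an action \<open>a\<close> on some \<open>'b \<Rightarrow>\<^sub>0 int\<close>.
\<close>

definition ring_act ::
    "((nat \<Rightarrow> nat) \<Rightarrow> ('b \<Rightarrow>\<^sub>0 int) \<Rightarrow> ('b \<Rightarrow>\<^sub>0 int)) \<Rightarrow> ((nat \<Rightarrow> nat) \<Rightarrow>\<^sub>0 int) \<Rightarrow> ('b \<Rightarrow>\<^sub>0 int) \<Rightarrow> ('b \<Rightarrow>\<^sub>0 int)"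
  where "ring_act a c x = frag_extend (\<lambda>g. a g x) c"

definition T_elem :: "nat \<Rightarrow> (nat \<Rightarrow> nat) \<Rightarrow>\<^sub>0 int" where
  "T_elem r = frag_of (rho r) - frag_of id"

definition N_elem :: "nat \<Rightarrow> (nat \<Rightarrow> nat) \<Rightarrow>\<^sub>0 int" where
  "N_elem r = (\<Sum>g\<in>carrier (cyc_group r). frag_of g)"

text \<open>The basis element \<open>(g, d)\<close> stands for \<open>g\<cdot>e\<^sub>d\<close>, so \<open>e\<^sub>d\<close> is \<open>frag_of (id, d)\<close>.\<close>

type_synonym minimal_elem = "((nat \<Rightarrow> nat) \<times> nat) \<Rightarrow>\<^sub>0 int"

definition minimal_act :: "(nat \<Rightarrow> nat) \<Rightarrow> minimal_elem \<Rightarrow> minimal_elem" where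
  "minimal_act g = frag_extend (\<lambda>(k, d). frag_of (g \<circ> k, d))"

fun minimal_bdry_gen :: "nat \<Rightarrow> nat \<Rightarrow> minimal_elem" where
  "minimal_bdry_gen r 0 = 0"
| "minimal_bdry_gen r (Suc d) =
     ring_act minimal_act (if odd (Suc d) then T_elem r else N_elem r) (frag_of (id, d))"

definition minimal :: "minimal_elem gamma" where
  "minimal =
     \<lparr>chain = (\<lambda>r n. free_Abelian_group {(g, d). g \<in> carrier (cyc_group r) \<and> int d = n}),
      bdry = (\<lambda>r n. frag_extend (\<lambda>(g, d). minimal_act g (minimal_bdry_gen r d))),
      act = (\<lambda>r n. minimal_act)\<rparr>"

text \<open>
  HOL cannot quantify over types inside a formula, so the type of the elements of the
  \<open>E\<^sub>\<infinity>\<close>-operad \<open>R\<close> is a parameter.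
\<close>

definition May_Steenrod ::
    "'r itself \<Rightarrow> ('a, 'm) operad_scheme \<Rightarrow> (nat \<Rightarrow> int \<Rightarrow> minimal_elem \<Rightarrow> 'a) \<Rightarrow> bool" where
  "May_Steenrod _ P \<psi> \<longleftrightarrow> operad P \<and> C_morphism minimal P \<psi> \<and>
     (\<exists>(R :: 'r operad) \<iota> \<phi>.
        E_infinity R \<and> C_morphism minimal R \<iota> \<and> quasi_iso minimal R \<iota> \<and> operad_morphism R P \<phi> \<and>
        (\<forall>r n. \<forall>x\<in>carrier (chain minimal r n). \<psi> r n x = \<phi> r n (\<iota> r n x)))"


section \<open>The surjection operad\<close>

text \<open>
  The free abelian group on all sequences modulo the span of the degenerate ones is represented by
  the free abelian group on the nondegenerate sequences; \<open>seq_class r\<close> is the class of a sequence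
  in arity \<open>r\<close>.  Lemma \<open>surj_chain_quotient\<close> below identifies the two.
\<close>

definition nondegenerate :: "nat \<Rightarrow> nat list \<Rightarrow> bool" where
  "nondegenerate r s \<longleftrightarrow> set s = {1..r} \<and> distinct_adj s"

definition surj_chain :: "nat \<Rightarrow> int \<Rightarrow> (nat list \<Rightarrow>\<^sub>0 int) monoid" where
  "surj_chain r n = free_Abelian_group {s. nondegenerate r s \<and> int (length s) = n + int r}"

definition seq_class :: "nat \<Rightarrow> nat list \<Rightarrow> (nat list \<Rightarrow>\<^sub>0 int)" where
  "seq_class r s = (if nondegenerate r s then frag_of s else 0)"

lemma lookup_seq_class_extend:
  "Poly_Mapping.lookup (frag_extend (seq_class r) x) s =
     (if nondegenerate r s then Poly_Mapping.lookup x s else 0)"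
proof (rule frag_induction [where S = UNIV and c = x])
  show "Poly_Mapping.keys x \<subseteq> UNIV" by simp
qed (auto simp: seq_class_def frag_extend_diff lookup_minus)

lemma surj_chain_quotient:
  fixes r :: nat and n :: int
  defines "A \<equiv> {s. set s \<subseteq> {1..r} \<and> int (length s) = n + int r}"
  shows "(\<lambda>c. the_elem (frag_extend (seq_class r) ` c))
           \<in> iso (free_Abelian_group A Mod {x. Poly_Mapping.keys x \<subseteq> {s \<in> A. \<not> nondegenerate r s}})
                 (surj_chain r n)"
proof -
  let ?h = "frag_extend (seq_class r)"
  let ?B = "{s. nondegenerate r s \<and> int (length s) = n + int r}"
  have sub: "?B \<subseteq> A" by (auto simp: A_def nondegenerate_def)
  have keys: "Poly_Mapping.keys (?h x) = {s \<in> Poly_Mapping.keys x. nondegenerate r s}" for x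
    by (auto simp: in_keys_iff lookup_seq_class_extend split: if_splits)
  have fix_B: "?h x = x" if "Poly_Mapping.keys x \<subseteq> ?B" for x
  proof (rule poly_mapping_eqI)
    fix s show "Poly_Mapping.lookup (?h x) s = Poly_Mapping.lookup x s"
      using that by (auto simp: lookup_seq_class_extend in_keys_iff)
  qed
  interpret group_hom "free_Abelian_group A" "surj_chain r n" ?h
  proof (unfold group_hom_def group_hom_axioms_def, intro conjI)
    show "?h \<in> hom (free_Abelian_group A) (surj_chain r n)"
      by (auto simp: hom_def surj_chain_def free_Abelian_group_def frag_extend_add keys A_def)
  qed (auto simp: surj_chain_def)
  have ker: "kernel (free_Abelian_group A) (surj_chain r n) ?h
      = {x. Poly_Mapping.keys x \<subseteq> {s \<in> A. \<not> nondegenerate r s}}"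
  proof -
    have "?h x = 0 \<longleftrightarrow> (\<forall>s\<in>Poly_Mapping.keys x. \<not> nondegenerate r s)" for x
      using keys [of x] by (auto simp flip: keys_eq_empty)
    then show ?thesis
      by (auto simp: kernel_def surj_chain_def free_Abelian_group_def)
  qed
  have img: "?h ` carrier (free_Abelian_group A) = carrier (surj_chain r n)"
  proof
    show "?h ` carrier (free_Abelian_group A) \<subseteq> carrier (surj_chain r n)"
      using hom_closed by auto
    show "carrier (surj_chain r n) \<subseteq> ?h ` carrier (free_Abelian_group A)"
    proof
      fix x assume "x \<in> carrier (surj_chain r n)"
      then have "Poly_Mapping.keys x \<subseteq> ?B" by (simp add: surj_chain_def free_Abelian_group_def)
      then show "x \<in> ?h ` carrier (free_Abelian_group A)"
        using sub fix_B [of x] by (intro image_eqI [of _ _ x]) (auto simp: free_Abelian_group_def)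
    qed
  qed
  show ?thesis
    using FactGroup_iso_set [OF img] unfolding ker .
qed

text \<open>\<open>mdeg s i\<close> is the dimension of the simplex with vertex set \<open>s\<^sup>-\<^sup>1(i)\<close>.\<close>

definition mdeg :: "nat list \<Rightarrow> nat \<Rightarrow> nat" where
  "mdeg s i = count_list s i - 1"

definition occurrences :: "nat list \<Rightarrow> nat \<Rightarrow> nat list" where
  "occurrences s i = filter (\<lambda>p. s ! p = i) [0..<length s]"

definition surj_bdry :: "nat \<Rightarrow> (nat list \<Rightarrow>\<^sub>0 int) \<Rightarrow> (nat list \<Rightarrow>\<^sub>0 int)" where
  "surj_bdry r = frag_extend (\<lambda>s. \<Sum>i = 1..r. \<Sum>j = 0..mdeg s i.
     let p = occurrences s i ! j in
     frag_cmul ((-1) ^ ((\<Sum>v = 1..<i. mdeg s v) + j)) (seq_class r (take p s @ drop (Suc p) s)))"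

definition surj_act :: "nat \<Rightarrow> (nat \<Rightarrow> nat) \<Rightarrow> (nat list \<Rightarrow>\<^sub>0 int) \<Rightarrow> (nat list \<Rightarrow>\<^sub>0 int)" where
  "surj_act r \<sigma> = frag_extend (\<lambda>s.
     frag_cmul (\<Prod>(i, j)\<in>{(i, j). 1 \<le> i \<and> i < j \<and> j \<le> r \<and> \<sigma> i > \<sigma> j}. (-1) ^ (mdeg s i * mdeg s j))
       (frag_of (map \<sigma> s)))"

text \<open>
  For sequences \<open>f\<close> and \<open>g\<close>, \<open>f \<circ>\<^sub>i g\<close> is the signed sum over all ways of cutting \<open>g\<close> at positions
  \<open>p\<^sub>1 \<le> \<dots> \<le> p\<^sub>m\<close> (counted from \<open>0\<close>, with \<open>m = mdeg f i\<close>) into \<open>m + 1\<close> pieces, neighbouring pieces sharing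
  the entry at the cut, and of replacing the occurrences of \<open>i\<close> in \<open>f\<close> by the successive pieces; the
  entries are renumbered.  If \<open>g\<close> is empty (arity \<open>0\<close>), there are no cut positions; so the sum is
  \<open>0\<close> if \<open>m > 0\<close>, and if \<open>m = 0\<close> the only piece is empty and the entry \<open>i\<close> is deleted.
\<close>

definition cuts :: "nat \<Rightarrow> nat list \<Rightarrow> nat list set" where
  "cuts m g = {ps. length ps = m \<and> sorted ps \<and> set ps \<subseteq> {..<length g}}"

definition pieces :: "nat list \<Rightarrow> nat list \<Rightarrow> nat list list" where
  "pieces g ps = map2 (\<lambda>a b. drop a (take (Suc b) g)) (0 # ps) (ps @ [length g - 1])"

fun substitute :: "nat \<Rightarrow> nat \<Rightarrow> nat list \<Rightarrow> nat list list \<Rightarrow> nat list" where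
  "substitute i s [] gs = []"
| "substitute i s (v # f) gs =
     (if v = i then map (\<lambda>l. i - 1 + l) (hd gs) @ substitute i s f (tl gs)
      else (if v < i then v else v + s - 1) # substitute i s f gs)"

text \<open>
  The sign is the Koszul sign.  The orientation of the simplex on \<open>s\<^sup>-\<^sup>1(v)\<close> is the ordered product of
  its \<open>mdeg s v\<close> edges between consecutive vertices, and that of \<open>s\<close> is the product of these over
  \<open>v = 1, \<dots>, r\<close>.  The edges of \<open>f \<circ>\<^sub>i g\<close> are those of \<open>f\<close> and those of \<open>g\<close>, where the \<open>a\<close>-th edge
  of \<open>f\<^sup>-\<^sup>1(i)\<close> becomes the edge joining the two copies of the entry of \<open>g\<close> at \<open>p\<^sub>a\<close>.  The exponent
  counts the inversions when the edges of \<open>f\<close> followed by those of \<open>g\<close> are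
  rearranged into the order of the edges of \<open>f \<circ>\<^sub>i g\<close>: the edges of \<open>f\<close> of values \<open>> i\<close> with all the
  edges of \<open>g\<close>; the edges of \<open>f\<^sup>-\<^sup>1(i)\<close> among themselves; and for each of the latter the edges of \<open>g\<close>
  preceding it.
\<close>

definition cut_exponent :: "nat \<Rightarrow> nat \<Rightarrow> nat \<Rightarrow> nat list \<Rightarrow> nat list \<Rightarrow> nat list \<Rightarrow> nat" where
  "cut_exponent r i s f g ps =
     (\<Sum>v = i + 1..r. mdeg f v) * (\<Sum>v = 1..s. mdeg g v)
     + card {(a, b). a < b \<and> b < length ps \<and> g ! (ps ! a) > g ! (ps ! b)}
     + (\<Sum>p\<leftarrow>ps. (\<Sum>v = 1..<g ! p. mdeg g v) + count_list (take p g) (g ! p))"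

definition surj_pcomp ::
    "nat \<Rightarrow> nat \<Rightarrow> nat \<Rightarrow> (nat list \<Rightarrow>\<^sub>0 int) \<Rightarrow> (nat list \<Rightarrow>\<^sub>0 int) \<Rightarrow> (nat list \<Rightarrow>\<^sub>0 int)" where
  "surj_pcomp r i s x y = frag_extend (\<lambda>f. frag_extend (\<lambda>g.
     \<Sum>ps\<in>cuts (mdeg f i) g. frag_cmul ((-1) ^ cut_exponent r i s f g ps)
       (seq_class (r + s - 1) (substitute i s f (pieces g ps)))) y) x"

definition surj_operad :: "(nat list \<Rightarrow>\<^sub>0 int) operad" where
  "surj_operad =
    \<lparr>chain = surj_chain,
     bdry = (\<lambda>r n. surj_bdry r),
     act = (\<lambda>r n. surj_act r),
     pcomp = (\<lambda>r m i s n. surj_pcomp r i s),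
     opunit = frag_of [1]\<rparr>"


section \<open>The homotopy and the map\<close>

definition h_i :: "(nat list \<Rightarrow>\<^sub>0 int) \<Rightarrow> (nat list \<Rightarrow>\<^sub>0 int)" where
  "h_i = frag_extend (\<lambda>s. frag_of (1 # map Suc s))"

text \<open>Removing the only \<open>1\<close> can create a repetition, in which case the result is degenerate.\<close>

definition h_p :: "(nat list \<Rightarrow>\<^sub>0 int) \<Rightarrow> (nat list \<Rightarrow>\<^sub>0 int)" where
  "h_p = frag_extend (\<lambda>s. let t = map (\<lambda>v. v - 1) (removeAll 1 s) in
     if count_list s 1 = 1 \<and> distinct_adj t then frag_of t else 0)"

definition h_s :: "(nat list \<Rightarrow>\<^sub>0 int) \<Rightarrow> (nat list \<Rightarrow>\<^sub>0 int)" where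
  "h_s = frag_extend (\<lambda>s. if s \<noteq> [] \<and> hd s = 1 then 0 else frag_of (1 # s))"

definition homotopy :: "nat \<Rightarrow> (nat list \<Rightarrow>\<^sub>0 int) \<Rightarrow> (nat list \<Rightarrow>\<^sub>0 int)" where
  "homotopy r x = (\<Sum>k<r. (h_i ^^ k) (h_s ((h_p ^^ k) x)))"

fun psi_gen :: "nat \<Rightarrow> nat \<Rightarrow> (nat list \<Rightarrow>\<^sub>0 int)" where
  "psi_gen r 0 = frag_of [1..<Suc r]"
| "psi_gen r (Suc d) =
     homotopy r (ring_act (surj_act r) (if odd (Suc d) then T_elem r else N_elem r) (psi_gen r d))"

definition psi_surj :: "nat \<Rightarrow> int \<Rightarrow> minimal_elem \<Rightarrow> (nat list \<Rightarrow>\<^sub>0 int)" where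
  "psi_surj r n = frag_extend (\<lambda>(g, d). surj_act r g (psi_gen r d))"

end

theory Submission
  imports Defs
begin

text \<open>
  The signs of the surjection operad come from regarding a sequence as the top generator of a
  tensor product of simplices. They become transparent after a change of generators: every
  letter of a sequence is given degree one, and a sequence is the product of its letters, in the
  order in which it is written. The boundary is then the derivation which sends every letter to
  \<open>1\<close> (\<open>word_bdry\<close>), and the signed generators \<open>oriented r w\<close> are an isomorphism, up to a shift
  by the arity, from words modulo degenerate words to \<open>\<X>(r)\<close>. Under it the boundary becomes
  \<open>word_bdry\<close> (\<open>bdry_oriented\<close>), a permutation just renames the letters (\<open>act_oriented\<close>), and
  \<open>\<circ>\<^sub>i\<close> becomes the operation \<open>ins\<close>, which reads a word \<open>f\<close> from left to right and at each
  occurrence of a marked letter runs through a further piece of a word \<open>g\<close> (\<open>pcomp_oriented\<close>).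
  The signs that are left depend only on arities and degrees, and on the permutation; they are
  the usual signs of an operadic suspension.

  For \<open>ins\<close> the Leibniz rule and both associativity laws are proved by recursion on the letters
  (\<open>ins_leibniz\<close>, \<open>ins_assoc_seq\<close>, \<open>ins_assoc_par\<close>), and words with equal neighbours form an
  ideal (\<open>ins_degenerate_left\<close>, \<open>ins_degenerate_right\<close>, \<open>word_bdry_degenerate\<close>). All the
  combinatorics of signs is concentrated in \<open>inversions_glue\<close>, which counts the inversions of a
  word composed from \<open>f\<close> and the pieces of \<open>g\<close>. Together this shows that \<open>\<X>\<close> is an operad
  (\<open>operad_surj\<close>).

  The map \<open>p\<close> is composition at the input \<open>1\<close> with the generator of \<open>\<X>(0)\<close>, hence a chain map.
  Writing a \<open>1\<close> in front of a word, \<open>s\<close>, is a homotopy from the identity to \<open>i p\<close>, since the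
  boundary of \<open>1 w\<close> is \<open>w\<close> minus \<open>1\<close> times the boundary of \<open>w\<close>. Iterating this gives
  \<open>\<partial>h + h\<partial> = 1 - i\<^sup>r p\<^sup>r\<close> (\<open>homotopy\<close>), where \<open>i\<^sup>r p\<^sup>r x\<close> is the multiple \<open>aug r x\<close> of
  \<open>(1, \<dots>, r)\<close>. So \<open>aug\<close> is a quasi-isomorphism to the constant module. The symmetric group
  permutes the basis of sequences freely up to sign, a set of representatives being the
  sequences whose values have their last occurrences in increasing order. So \<open>\<X>\<close> is an
  \<open>E\<^sub>\<infinity>\<close>-operad (\<open>E_infinity_surj\<close>).

  That \<open>\<psi>\<close> is a chain map is the usual comparison argument: if \<open>U\<close> is the element \<open>T\<close> or \<open>N\<close>
  with \<open>\<psi> e\<^sub>d\<^sub>+\<^sub>1 = h U \<psi> e\<^sub>d\<close>, then \<open>U \<psi> e\<^sub>d\<close> is a cycle with augmentation zero because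
  \<open>T N = N T = 0\<close>, so that \<open>\<partial> h U \<psi> e\<^sub>d = U \<psi> e\<^sub>d\<close> (\<open>bdry_psi_gen_Suc\<close>). Both \<open>\<W>(r)\<close> and \<open>\<X>(r)\<close>
  contract onto the span of their generators \<open>e\<^sub>0\<close> and \<open>(1, \<dots>, r)\<close>, which \<open>\<psi>\<close> identifies, so \<open>\<psi>\<close>
  is a quasi-isomorphism (\<open>psi_quasi_iso\<close>). Hence \<open>\<R> = \<X>\<close>, \<open>\<iota> = \<psi>\<close> and \<open>\<phi> = id\<close> exhibit \<open>\<psi>\<close> as a
  May--Steenrod structure.
\<close>

section \<open>Linear extension\<close>

abbreviation supp :: "('a \<Rightarrow>\<^sub>0 int) \<Rightarrow> 'a set" where
  "supp \<equiv> Poly_Mapping.keys"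

lemma frag_cmul_diff: "frag_cmul c (x - y) = frag_cmul c x - frag_cmul c y"
  by (rule poly_mapping_eqI) (simp add: lookup_minus right_diff_distrib)

lemma frag_cmul_uminus: "frag_cmul c (- x) = - frag_cmul c x"
  by (rule poly_mapping_eqI) simp

lemmas frag_linear = frag_extend_add frag_extend_diff frag_extend_minus frag_extend_cmul
  frag_cmul_distrib2 frag_cmul_diff frag_cmul_uminus

lemma frag_extend_linear_comp:
  assumes "F 0 = 0" "\<And>x y. F (x - y) = F x - F y"
  shows "F (frag_extend G x) = frag_extend (\<lambda>s. F (G s)) x"
  by (rule frag_induction [where S = UNIV and c = x]) (auto simp: assms frag_extend_diff)

lemma frag_extend_frag_extend:
  "frag_extend F (frag_extend G x) = frag_extend (\<lambda>s. frag_extend F (G s)) x"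
  by (rule frag_extend_linear_comp) (auto simp: frag_extend_diff)

lemma frag_extend_fun_diff: "frag_extend (\<lambda>s. F s - G s) x = frag_extend F x - frag_extend G x"
  by (rule frag_induction [where S = UNIV and c = x]) (auto simp: frag_extend_diff)

lemma frag_extend_fun_add: "frag_extend (\<lambda>s. F s + G s) x = frag_extend F x + frag_extend G x"
  by (rule frag_induction [where S = UNIV and c = x]) (auto simp: frag_extend_diff)

lemma frag_extend_fun_cmul: "frag_extend (\<lambda>s. frag_cmul c (F s)) x = frag_cmul c (frag_extend F x)"
  by (rule frag_induction [where S = UNIV and c = x]) (auto simp: frag_extend_diff frag_cmul_diff)

lemma frag_extend_fun_0: "frag_extend (\<lambda>s. 0) x = 0"
  by (rule frag_induction [where S = UNIV and c = x]) (auto simp: frag_extend_diff)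

section \<open>Words with letters of degree one\<close>

definition prepend :: "'a \<Rightarrow> ('a list \<Rightarrow>\<^sub>0 int) \<Rightarrow> ('a list \<Rightarrow>\<^sub>0 int)" where
  "prepend x = frag_extend (\<lambda>w. frag_of (x # w))"

lemma prepend_linear [simp]:
  "prepend x 0 = 0" "prepend x (u + v) = prepend x u + prepend x v" "prepend x (u - v) = prepend x u - prepend x v"
  "prepend x (- u) = - prepend x u" "prepend x (frag_cmul c u) = frag_cmul c (prepend x u)"
  "prepend x (frag_of w) = frag_of (x # w)"
  by (simp_all add: prepend_def frag_linear)

lemma prepend_extend: "prepend x (frag_extend G y) = frag_extend (\<lambda>s. prepend x (G s)) y"
  unfolding prepend_def by (rule frag_extend_frag_extend)

lemma extend_prepend: "frag_extend G (prepend x y) = frag_extend (\<lambda>s. G (x # s)) y"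
  unfolding prepend_def by (simp add: frag_extend_frag_extend)

text \<open>
  The words in a set of letters are the monomials of the free associative ring on them. If the
  letters have degree one and boundary \<open>1\<close>, then the Leibniz rule forces this recursion.
\<close>

fun word_bdry :: "'a list \<Rightarrow> ('a list \<Rightarrow>\<^sub>0 int)" where
  "word_bdry [] = 0"
| "word_bdry (x # w) = frag_of w - prepend x (word_bdry w)"

lemma extend_word_bdry_prepend: "frag_extend word_bdry (prepend x y) = y - prepend x (frag_extend word_bdry y)"
  by (simp add: extend_prepend frag_extend_fun_diff prepend_extend flip: frag_expansion)

lemma word_bdry_word_bdry: "frag_extend word_bdry (word_bdry w) = 0"
  by (induction w) (simp_all add: frag_extend_diff extend_word_bdry_prepend)

text \<open>
  This is what remains of \<open>f\<close> once the last piece of the inserted word has been written: no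
  further occurrence of the marker may be left without a piece.
\<close>

definition keep :: "'a \<Rightarrow> ('a \<Rightarrow> 'c) \<Rightarrow> 'a list \<Rightarrow> ('c list \<Rightarrow>\<^sub>0 int)" where
  "keep z \<alpha> f = (if z \<in> set f then 0 else frag_of (map \<alpha> f))"

lemma keep_simps [simp]:
  "keep z \<alpha> [] = frag_of []"
  "keep z \<alpha> (v # f) = (if v = z then 0 else prepend (\<alpha> v) (keep z \<alpha> f))"
  by (auto simp: keep_def)

text \<open>
  The recursion inside the inserted word, with the part of the outer word that follows the
  current marker given by its length \<open>n\<close>, by the relabelled word \<open>k\<close> for the case that no piece
  follows, and by the continuation \<open>c\<close> at the next marker. After writing \<open>x\<close> there are two
  possibilities: \<open>x\<close> is the last letter of the piece and, being shared, also the first letter of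
  the next piece; or the piece goes on. Not letters but steps between neighbouring letters of
  \<open>g\<close> carry a degree, so going on costs the sign for moving a step past \<open>n\<close> letters. At the end
  of \<open>g\<close> there is one step too many, which the sign of the first equation compensates.
\<close>

primrec run :: "('b \<Rightarrow> 'c) \<Rightarrow> nat \<Rightarrow> ('c list \<Rightarrow>\<^sub>0 int) \<Rightarrow> ('b list \<Rightarrow> ('c list \<Rightarrow>\<^sub>0 int)) \<Rightarrow>
    'b list \<Rightarrow> ('c list \<Rightarrow>\<^sub>0 int)" where
  "run \<beta> n k c [] = frag_cmul ((-1) ^ n) k"
| "run \<beta> n k c (x # g) = prepend (\<beta> x) (c (x # g) + frag_cmul ((-1) ^ n) (run \<beta> n k c g))"

text \<open>
  \<open>ins z \<alpha> \<beta> f g\<close> is the sum over all ways of cutting \<open>g\<close> into pieces, neighbouring pieces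
  sharing a letter, and of replacing the occurrences of the marker \<open>z\<close> in \<open>f\<close> by the successive
  pieces. Letters of \<open>f\<close> are renamed by \<open>\<alpha>\<close> and letters of \<open>g\<close> by \<open>\<beta>\<close>. A word in which the
  marker does not occur has nowhere to put \<open>g\<close> and gives \<open>0\<close>.
\<close>

fun ins :: "'a \<Rightarrow> ('a \<Rightarrow> 'c) \<Rightarrow> ('b \<Rightarrow> 'c) \<Rightarrow> 'a list \<Rightarrow> 'b list \<Rightarrow> ('c list \<Rightarrow>\<^sub>0 int)" where
  "ins z \<alpha> \<beta> [] g = 0"
| "ins z \<alpha> \<beta> (v # f) g =
     (if v = z then run \<beta> (length f) (keep z \<alpha> f) (ins z \<alpha> \<beta> f) g else prepend (\<alpha> v) (ins z \<alpha> \<beta> f g))"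

text \<open>
  The value at a marker that is followed by \<open>f\<close>: the first letter to be written comes from \<open>g\<close>.
\<close>

definition ins_at :: "'a \<Rightarrow> ('a \<Rightarrow> 'c) \<Rightarrow> ('b \<Rightarrow> 'c) \<Rightarrow> 'a list \<Rightarrow> 'b list \<Rightarrow> ('c list \<Rightarrow>\<^sub>0 int)" where
  "ins_at z \<alpha> \<beta> f = run \<beta> (length f) (keep z \<alpha> f) (ins z \<alpha> \<beta> f)"

lemma ins_at_simps [simp]:
  "ins_at z \<alpha> \<beta> f [] = frag_cmul ((-1) ^ length f) (keep z \<alpha> f)"
  "ins_at z \<alpha> \<beta> f (x # g) =
     prepend (\<beta> x) (ins z \<alpha> \<beta> f (x # g) + frag_cmul ((-1) ^ length f) (ins_at z \<alpha> \<beta> f g))"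
  by (simp_all add: ins_at_def)

declare ins.simps(2) [simp del]
lemma ins_Cons [simp]:
  "ins z \<alpha> \<beta> (v # f) g = (if v = z then ins_at z \<alpha> \<beta> f g else prepend (\<alpha> v) (ins z \<alpha> \<beta> f g))"
  by (simp add: ins_at_def ins.simps(2))

lemma extend_keep_prepend:
  "frag_extend (keep z \<alpha>) (prepend v x) = (if v = z then 0 else prepend (\<alpha> v) (frag_extend (keep z \<alpha>) x))"
  by (simp add: extend_prepend frag_extend_fun_0 prepend_extend)

lemma extend_ins_prepend_left:
  "frag_extend (\<lambda>f. ins z \<alpha> \<beta> f g) (prepend v x) =
    (if v = z then frag_extend (\<lambda>f. ins_at z \<alpha> \<beta> f g) x else prepend (\<alpha> v) (frag_extend (\<lambda>f. ins z \<alpha> \<beta> f g) x))"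
  by (simp add: extend_prepend prepend_extend)

text \<open>
  Removing a letter from \<open>f\<close> can make the marker disappear, namely when \<open>f\<close> contains it exactly
  once; this term is the composite of \<open>f\<close> with the empty word.
\<close>

lemma keep_word_bdry:
  "frag_extend (keep z \<alpha>) (word_bdry f) =
     frag_extend word_bdry (keep z \<alpha> f) - frag_cmul ((-1) ^ length f) (ins z \<alpha> \<beta> f [])"
  by (induction f) (auto simp: frag_linear extend_keep_prepend extend_word_bdry_prepend)

lemma keys_word_bdry: "u \<in> supp (word_bdry w) \<Longrightarrow> set u \<subseteq> set w \<and> Suc (length u) = length w"
proof (induction w arbitrary: u)
  case (Cons x w)
  then consider "u = w" | "u \<in> supp (prepend x (word_bdry w))"
    using keys_diff by fastforce
  then show ?case
  proof cases
    case 2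
    then obtain v where "v \<in> supp (word_bdry w)" "u = x # v"
      using keys_frag_extend unfolding prepend_def by fastforce
    then show ?thesis using Cons.IH by fastforce
  qed auto
qed simp

lemma keys_word_bdry_sign: "u \<in> supp (word_bdry w) \<Longrightarrow> (-1 :: int) ^ length u = - ((-1) ^ length w)"
  by (drule keys_word_bdry) (metis minus_minus mult_minus1 power_Suc)

lemma ins_at_word_bdry_left_Nil:
  "frag_extend (\<lambda>u. ins_at z \<alpha> \<beta> u []) (word_bdry f) = - frag_cmul ((-1) ^ length f) (frag_extend (keep z \<alpha>) (word_bdry f))"
proof -
  have "frag_extend (\<lambda>u. ins_at z \<alpha> \<beta> u []) (word_bdry f) = frag_extend (\<lambda>u. frag_cmul (- ((-1) ^ length f)) (keep z \<alpha> u)) (word_bdry f)"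
    by (rule frag_extend_eq) (simp add: keys_word_bdry_sign)
  then show ?thesis by (simp add: frag_extend_fun_cmul)
qed

lemma ins_at_word_bdry_left_Cons:
  "frag_extend (\<lambda>u. ins_at z \<alpha> \<beta> u (x # g)) (word_bdry f) =
     prepend (\<beta> x) (frag_extend (\<lambda>u. ins z \<alpha> \<beta> u (x # g)) (word_bdry f)
       - frag_cmul ((-1) ^ length f) (frag_extend (\<lambda>u. ins_at z \<alpha> \<beta> u g) (word_bdry f)))"
proof -
  have "frag_extend (\<lambda>u. ins_at z \<alpha> \<beta> u (x # g)) (word_bdry f) =
    frag_extend (\<lambda>u. prepend (\<beta> x) (ins z \<alpha> \<beta> u (x # g) - frag_cmul ((-1) ^ length f) (ins_at z \<alpha> \<beta> u g))) (word_bdry f)"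
    by (rule frag_extend_eq) (simp add: keys_word_bdry_sign)
  then show ?thesis by (simp add: frag_extend_fun_cmul frag_extend_fun_diff flip: prepend_extend)
qed

lemma extend_ins_at_prepend_right:
  "frag_extend (ins_at z \<alpha> \<beta> f) (prepend x y) =
     prepend (\<beta> x) (frag_extend (ins z \<alpha> \<beta> f) (prepend x y) + frag_cmul ((-1) ^ length f) (frag_extend (ins_at z \<alpha> \<beta> f) y))"
  by (simp add: extend_prepend frag_extend_fun_add frag_extend_fun_cmul prepend_extend)

lemma frag_extend_ins_Cons:
  "frag_extend (ins z \<alpha> \<beta> (v # f)) y =
    (if v = z then frag_extend (ins_at z \<alpha> \<beta> f) y else prepend (\<alpha> v) (frag_extend (ins z \<alpha> \<beta> f) y))"
  using frag_extend_eq [where c = y and g = "ins z \<alpha> \<beta> (v # f)"] by (simp add: prepend_extend)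

lemma frag_extend_ins_Nil [simp]: "frag_extend (ins z \<alpha> \<beta> []) y = 0"
  using frag_extend_eq_0 [where c = y and f = "ins z \<alpha> \<beta> []"] by simp

text \<open>
  The induction step of \<open>ins_leibniz\<close> at a marker. The first term on the right comes from
  removing the first letter that is written in the case that its piece ends there.
\<close>

lemma ins_at_leibniz_if:
  assumes "\<And>g. frag_extend word_bdry (ins z \<alpha> \<beta> f g) =
      frag_extend (\<lambda>u. ins z \<alpha> \<beta> u g) (word_bdry f) - frag_cmul ((-1) ^ length f) (frag_extend (ins z \<alpha> \<beta> f) (word_bdry g))"
  shows "frag_extend word_bdry (ins_at z \<alpha> \<beta> f g) =
      ins z \<alpha> \<beta> f g - frag_extend (\<lambda>u. ins_at z \<alpha> \<beta> u g) (word_bdry f)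
        + frag_cmul ((-1) ^ length f) (frag_extend (ins_at z \<alpha> \<beta> f) (word_bdry g))"
proof (induction g)
  case Nil
  show ?case
    by (simp only: ins_at_word_bdry_left_Nil keep_word_bdry [where \<beta> = \<beta>])
       (simp add: frag_linear flip: power_add mult_2)
next
  case (Cons x g)
  show ?case
    unfolding ins_at_word_bdry_left_Cons
    by (cases "even (length f)")
       (simp_all add: extend_word_bdry_prepend frag_linear assms Cons ins_at_word_bdry_left_Cons extend_ins_at_prepend_right)
qed

text \<open>
  The operation has degree \<open>-1\<close> in the degrees given by length, which explains the sign of the
  second term. A composed word contains each shared letter twice. Cutting \<open>g\<close> at some letter and
  removing its second copy gives the same word as cutting \<open>g\<close> at the next letter and removing
  the first copy, and these terms cancel. The terms in which a piece becomes empty come from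
  removing a marker of \<open>f\<close>.
\<close>

lemma ins_leibniz:
  "frag_extend word_bdry (ins z \<alpha> \<beta> f g) =
     frag_extend (\<lambda>u. ins z \<alpha> \<beta> u g) (word_bdry f) - frag_cmul ((-1) ^ length f) (frag_extend (ins z \<alpha> \<beta> f) (word_bdry g))"
proof (induction f arbitrary: g)
  case (Cons v f)
  show ?case
    using ins_at_leibniz_if [where z = z and \<alpha> = \<alpha> and \<beta> = \<beta> and f = f and g = g, OF Cons]
    by (cases "even (length f)")
       (auto simp: frag_linear extend_word_bdry_prepend extend_ins_prepend_left Cons frag_extend_ins_Cons prepend_extend)
qed (simp add: frag_extend_fun_0)

lemma keys_prepend: "supp (prepend x y) \<subseteq> (\<lambda>w. x # w) ` supp y"
  unfolding prepend_def by (rule order.trans [OF keys_frag_extend]) auto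

lemma keys_preE:
  assumes "u \<in> supp (prepend x y)"
  obtains w where "u = x # w" "w \<in> supp y"
proof -
  have "u \<in> (\<lambda>w. x # w) ` supp y"
    by (rule subsetD [OF keys_prepend assms])
  then show thesis using that by auto
qed

lemma keys_ins_at_if:
  assumes "\<And>g u. u \<in> supp (ins z \<alpha> \<beta> f g) \<Longrightarrow>
     z \<in> set f \<and> Suc (length u) = length f + length g \<and> set u = \<alpha> ` (set f - {z}) \<union> \<beta> ` set g"
    and "u \<in> supp (ins_at z \<alpha> \<beta> f g)"
  shows "length u = length f + length g \<and> set u = \<alpha> ` (set f - {z}) \<union> \<beta> ` set g"
  using assms(2)
proof (induction g arbitrary: u)
  case Nil
  then have "u \<in> supp (keep z \<alpha> f)"
    by simp
  then have "z \<notin> set f" "u = map \<alpha> f"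
    by (simp_all add: keep_def split: if_split_asm)
  then show ?case by simp
next
  case (Cons x g)
  obtain w where u: "u = \<beta> x # w" and
    "w \<in> supp (ins z \<alpha> \<beta> f (x # g) + frag_cmul ((-1) ^ length f) (ins_at z \<alpha> \<beta> f g))"
    by (rule keys_preE [OF Cons.prems [unfolded ins_at_simps]])
  then consider "w \<in> supp (ins z \<alpha> \<beta> f (x # g))" | "w \<in> supp (ins_at z \<alpha> \<beta> f g)"
    by (auto dest!: subsetD [OF keys_add])
  then show ?case
  proof cases
    case 1
    then show ?thesis using assms(1) [of w "x # g"] u by simp
  next
    case 2
    then show ?thesis using Cons.IH [of w] u by simp
  qed
qed

lemma keys_ins:
  "u \<in> supp (ins z \<alpha> \<beta> f g) \<Longrightarrow>
     z \<in> set f \<and> Suc (length u) = length f + length g \<and> set u = \<alpha> ` (set f - {z}) \<union> \<beta> ` set g"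
proof (induction f arbitrary: u g)
  case (Cons v f)
  show ?case
  proof (cases "v = z")
    case True
    then have "u \<in> supp (ins_at z \<alpha> \<beta> f g)"
      using Cons.prems by simp
    have "length u = length f + length g \<and> set u = \<alpha> ` (set f - {z}) \<union> \<beta> ` set g"
      by (rule keys_ins_at_if [OF _ \<open>u \<in> supp (ins_at z \<alpha> \<beta> f g)\<close>]) (rule Cons.IH)
    then show ?thesis
      using True by simp
  next
    case False
    then have "u \<in> supp (prepend (\<alpha> v) (ins z \<alpha> \<beta> f g))"
      using Cons.prems by (simp only: ins_Cons if_False)
    then obtain w where "u = \<alpha> v # w" "w \<in> supp (ins z \<alpha> \<beta> f g)"
      by (rule keys_preE)
    then show ?thesis using Cons.IH [of w g] False by (simp add: insert_Diff_if)
  qed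
qed simp

lemma keys_ins_at:
  "u \<in> supp (ins_at z \<alpha> \<beta> f g) \<Longrightarrow>
     length u = length f + length g \<and> set u = \<alpha> ` (set f - {z}) \<union> \<beta> ` set g"
  by (rule keys_ins_at_if) (rule keys_ins)

lemma extend_ins_at_Nil_left:
  assumes "\<forall>u\<in>supp W. (-1) ^ length u = e"
  shows "frag_extend (\<lambda>u. ins_at z \<alpha> \<beta> u []) W = frag_cmul e (frag_extend (keep z \<alpha>) W)"
  using assms frag_extend_eq [of W "\<lambda>u. ins_at z \<alpha> \<beta> u []" "\<lambda>u. frag_cmul e (keep z \<alpha> u)"]
  by (simp add: frag_extend_fun_cmul)

lemma extend_ins_at_Cons_left:
  assumes "\<forall>u\<in>supp W. (-1) ^ length u = e"
  shows "frag_extend (\<lambda>u. ins_at z \<alpha> \<beta> u (x # g)) W =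
    prepend (\<beta> x) (frag_extend (\<lambda>u. ins z \<alpha> \<beta> u (x # g)) W + frag_cmul e (frag_extend (\<lambda>u. ins_at z \<alpha> \<beta> u g) W))"
  using assms frag_extend_eq [of W "\<lambda>u. ins_at z \<alpha> \<beta> u (x # g)"
      "\<lambda>u. prepend (\<beta> x) (ins z \<alpha> \<beta> u (x # g) + frag_cmul e (ins_at z \<alpha> \<beta> u g))"]
  by (simp add: frag_extend_fun_cmul frag_extend_fun_add flip: prepend_extend)

section \<open>Associativity of insertion\<close>

text \<open>
  In the nested composition the letter \<open>y\<close> marks the places of the word \<open>f\<close> with \<open>g\<close> inserted at
  which \<open>h\<close> is to be inserted; these are the copies of the letter \<open>j\<close> of \<open>g\<close>. The assumptions
  say that the two ways of renaming a letter of \<open>f\<close>, \<open>g\<close> or \<open>h\<close> agree and that no other letter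
  is renamed to \<open>y\<close>.
\<close>

context
  fixes z :: 'a and \<alpha> :: "'a \<Rightarrow> 'd" and \<beta> :: "'b \<Rightarrow> 'd"
    and y :: 'd and \<alpha>' :: "'d \<Rightarrow> 'e" and \<gamma>' :: "'c \<Rightarrow> 'e"
    and j :: 'b and \<alpha>3 :: "'b \<Rightarrow> 'k" and \<gamma>3 :: "'c \<Rightarrow> 'k"
    and \<alpha>'' :: "'a \<Rightarrow> 'e" and \<beta>'' :: "'k \<Rightarrow> 'e"
  assumes \<alpha>: "\<And>v. v \<noteq> z \<Longrightarrow> \<alpha> v \<noteq> y \<and> \<alpha>' (\<alpha> v) = \<alpha>'' v"
    and \<beta>j: "\<beta> j = y"
    and \<beta>: "\<And>x. x \<noteq> j \<Longrightarrow> \<beta> x \<noteq> y \<and> \<alpha>' (\<beta> x) = \<beta>'' (\<alpha>3 x)"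
    and \<gamma>: "\<And>u. \<gamma>' u = \<beta>'' (\<gamma>3 u)"
begin

text \<open>
  A rest of \<open>f\<close> without markers cannot receive any letter of \<open>g\<close>, hence none of \<open>h\<close>.
\<close>

lemma keep_map_z:
  "frag_extend (keep y \<alpha>') (keep z \<alpha> f) = keep z \<alpha>'' f"
  "frag_extend (\<lambda>u. ins y \<alpha>' \<gamma>' u h) (keep z \<alpha> f) = 0"
  by (induction f) (auto simp: extend_keep_prepend extend_ins_prepend_left \<alpha>)

lemma keep_ins_at_if:
  assumes IH: "\<And>g. frag_extend (keep y \<alpha>') (ins z \<alpha> \<beta> f g) = frag_extend (ins z \<alpha>'' \<beta>'' f) (keep j \<alpha>3 g)"
  shows "frag_extend (keep y \<alpha>') (ins_at z \<alpha> \<beta> f g) = frag_extend (ins_at z \<alpha>'' \<beta>'' f) (keep j \<alpha>3 g)"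
proof (induction g)
  case (Cons x g)
  then show ?case
    by (auto simp: extend_keep_prepend frag_linear IH \<beta>j \<beta> extend_ins_at_prepend_right)
qed (auto simp: frag_linear keep_map_z)

lemma keep_ins:
  "frag_extend (keep y \<alpha>') (ins z \<alpha> \<beta> f g) = frag_extend (ins z \<alpha>'' \<beta>'' f) (keep j \<alpha>3 g)"
proof (induction f arbitrary: g)
  case (Cons v f)
  show ?case
    unfolding frag_extend_ins_Cons
    by (auto simp: Cons keep_ins_at_if extend_keep_prepend \<alpha>)
qed (auto simp: frag_extend_fun_0)

lemmas keep_ins_at = keep_ins_at_if [OF keep_ins]

context
  fixes f :: "'a list"
  assumes IH: "\<And>g h. frag_extend (\<lambda>u. ins y \<alpha>' \<gamma>' u h) (ins z \<alpha> \<beta> f g) = frag_extend (ins z \<alpha>'' \<beta>'' f) (ins j \<alpha>3 \<gamma>3 g h)"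
begin

text \<open>
  The induction step in which all three words are being read: \<open>f\<close> stands behind a marker, \<open>g\<close>
  behind the letter \<open>j\<close>, and the next letter comes from \<open>h\<close>. The combination on the left is what
  follows the letter \<open>j\<close> in the recursion for \<open>g\<close>, where \<open>j\<close> may be shared by two pieces.
\<close>

lemma ins_at_ins_at_if:
  assumes IH2: "\<And>h. frag_extend (\<lambda>u. ins y \<alpha>' \<gamma>' u h) (ins_at z \<alpha> \<beta> f g) = frag_extend (ins_at z \<alpha>'' \<beta>'' f) (ins j \<alpha>3 \<gamma>3 g h)"
  shows "frag_extend (\<lambda>u. ins_at y \<alpha>' \<gamma>' u h) (ins z \<alpha> \<beta> f (j # g) + frag_cmul ((-1) ^ length f) (ins_at z \<alpha> \<beta> f g)) =
    frag_extend (ins_at z \<alpha>'' \<beta>'' f) (ins_at j \<alpha>3 \<gamma>3 g h)" (is "frag_extend _ ?W = _")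
proof (induction h)
  have len: "\<forall>u\<in>supp ?W. (-1) ^ length u = (-1 :: int) ^ (length f + length g)"
  proof
    fix u assume that: "u \<in> supp ?W"
    have "u \<in> supp (ins z \<alpha> \<beta> f (j # g)) \<or> u \<in> supp (ins_at z \<alpha> \<beta> f g)"
      using subsetD [OF keys_add that] by simp
    then show "(-1) ^ length u = (-1 :: int) ^ (length f + length g)"
      by (auto dest!: keys_ins keys_ins_at)
  qed
  {
    case Nil
    show ?case
      unfolding extend_ins_at_Nil_left [OF len]
      by (cases "even (length f)"; cases "even (length g)"; simp add: frag_linear keep_ins keep_ins_at)
  next
    case (Cons u h)
    have 1: "frag_extend (\<lambda>u. ins y \<alpha>' \<gamma>' u (v # h)) ?W =
      frag_extend (ins z \<alpha>'' \<beta>'' f) (ins_at j \<alpha>3 \<gamma>3 g (v # h)) +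
        frag_cmul ((-1) ^ length f) (frag_extend (ins_at z \<alpha>'' \<beta>'' f) (ins j \<alpha>3 \<gamma>3 g (v # h)))" for v
      by (simp only: frag_linear IH IH2 ins_Cons if_True simp_thms)
    show ?case
      unfolding extend_ins_at_Cons_left [OF len] Cons 1
      by (cases "even (length f)"; cases "even (length g)";
          simp add: frag_linear extend_ins_at_prepend_right \<gamma>)
  }
qed

lemma ins_ins_at_if:
  "frag_extend (\<lambda>u. ins y \<alpha>' \<gamma>' u h) (ins_at z \<alpha> \<beta> f g) = frag_extend (ins_at z \<alpha>'' \<beta>'' f) (ins j \<alpha>3 \<gamma>3 g h)"
proof (induction g arbitrary: h)
  case Nil
  then show ?case by (simp add: frag_linear keep_map_z)
next
  case (Cons x g)
  show ?case
  proof (cases "x = j")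
    case True
    then show ?thesis
      using ins_at_ins_at_if [OF Cons, of h] unfolding ins_at_simps extend_ins_prepend_left by (simp add: \<beta>j)
  next
    case False
    then show ?thesis
      using IH [of h "x # g"]
      by (simp add: extend_ins_prepend_left \<beta> frag_linear Cons extend_ins_at_prepend_right)
  qed
qed

end

text \<open>
  Both sides run over the same nested cuttings of \<open>g\<close> and \<open>h\<close>. The three words are composed in
  the same order on both sides, so that no sign arises.
\<close>

lemma ins_assoc_seq:
  "frag_extend (\<lambda>u. ins y \<alpha>' \<gamma>' u h) (ins z \<alpha> \<beta> f g) = frag_extend (ins z \<alpha>'' \<beta>'' f) (ins j \<alpha>3 \<gamma>3 g h)"
proof (induction f arbitrary: g h)
  case (Cons v f)
  show ?case
    unfolding frag_extend_ins_Cons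
    using ins_ins_at_if [OF Cons] Cons by (simp add: extend_ins_prepend_left \<alpha>)
qed (simp add: frag_extend_fun_0)

end

text \<open>
  Two different letters \<open>z\<close> and \<open>y\<close> of \<open>f\<close> are replaced by pieces of \<open>g\<close> and of \<open>h\<close>, in either
  order.
\<close>

context
  fixes z y :: 'a and \<alpha> :: "'a \<Rightarrow> 'd" and \<beta> :: "'b \<Rightarrow> 'd" and \<alpha>' :: "'d \<Rightarrow> 'e" and \<gamma>' :: "'c \<Rightarrow> 'e"
    and \<alpha>2 :: "'a \<Rightarrow> 'k" and \<gamma>2 :: "'c \<Rightarrow> 'k" and \<alpha>3 :: "'k \<Rightarrow> 'e" and \<beta>3 :: "'b \<Rightarrow> 'e"
  assumes zy: "z \<noteq> y"
    and \<alpha>: "\<And>v. v \<noteq> z \<Longrightarrow> v \<noteq> y \<Longrightarrow> \<alpha> v \<noteq> \<alpha> y \<and> \<alpha>2 v \<noteq> \<alpha>2 z \<and> \<alpha>' (\<alpha> v) = \<alpha>3 (\<alpha>2 v)"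
    and \<beta>: "\<And>x. \<beta> x \<noteq> \<alpha> y \<and> \<alpha>' (\<beta> x) = \<beta>3 x"
    and \<gamma>: "\<And>x. \<gamma>2 x \<noteq> \<alpha>2 z \<and> \<alpha>3 (\<gamma>2 x) = \<gamma>' x"
begin

lemma keep_keep:
  "frag_extend (keep (\<alpha> y) \<alpha>') (keep z \<alpha> f) = frag_extend (keep (\<alpha>2 z) \<alpha>3) (keep y \<alpha>2 f)"
proof (induction f)
  case (Cons v f)
  then show ?case using zy by (cases "v = z"; cases "v = y") (simp_all add: extend_keep_prepend \<alpha>)
qed simp

lemma keep_sign: "\<forall>u\<in>supp (keep z \<alpha> f). (-1 :: int) ^ length u = (-1) ^ length f"
  by (simp add: keep_def split: if_split_asm)

text \<open>
  The letters of \<open>h\<close> are written while no marker \<open>z\<close> is left, so that they do not interfere with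
  \<open>g\<close>.
\<close>

lemma ins_at_keep_if:
  assumes "\<And>h. frag_extend (\<lambda>u. ins (\<alpha> y) \<alpha>' \<gamma>' u h) (keep z \<alpha> f) = frag_extend (keep (\<alpha>2 z) \<alpha>3) (ins y \<alpha>2 \<gamma>2 f h)"
  shows "frag_extend (\<lambda>u. ins_at (\<alpha> y) \<alpha>' \<gamma>' u h) (keep z \<alpha> f) = frag_extend (keep (\<alpha>2 z) \<alpha>3) (ins_at y \<alpha>2 \<gamma>2 f h)"
proof (induction h)
  case Nil
  then show ?case
    unfolding extend_ins_at_Nil_left [OF keep_sign] by (simp add: keep_keep frag_linear)
next
  case (Cons x h)
  then show ?case
    unfolding extend_ins_at_Cons_left [OF keep_sign]
    by (simp add: assms \<gamma> frag_linear extend_keep_prepend)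
qed

lemma ins_keep:
  "frag_extend (\<lambda>u. ins (\<alpha> y) \<alpha>' \<gamma>' u h) (keep z \<alpha> f) = frag_extend (keep (\<alpha>2 z) \<alpha>3) (ins y \<alpha>2 \<gamma>2 f h)"
proof (induction f arbitrary: h)
  case (Cons v f)
  then show ?case
    using ins_at_keep_if [OF Cons] zy
    by (cases "v = z"; cases "v = y") (simp_all add: extend_keep_prepend extend_ins_prepend_left \<alpha>)
qed simp

lemma ins_ins_at_par_if:
  assumes "\<And>g h. frag_extend (\<lambda>u. ins (\<alpha> y) \<alpha>' \<gamma>' u h) (ins z \<alpha> \<beta> f g) =
    frag_cmul ((-1) ^ ((length g + 1) * (length h + 1))) (frag_extend (\<lambda>u. ins (\<alpha>2 z) \<alpha>3 \<beta>3 u g) (ins y \<alpha>2 \<gamma>2 f h))"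
  shows "frag_extend (\<lambda>u. ins (\<alpha> y) \<alpha>' \<gamma>' u h) (ins_at z \<alpha> \<beta> f g) =
    frag_cmul ((-1) ^ ((length g + 1) * (length h + 1))) (frag_extend (\<lambda>u. ins_at (\<alpha>2 z) \<alpha>3 \<beta>3 u g) (ins y \<alpha>2 \<gamma>2 f h))"
proof (induction g)
  have sgn: "\<forall>u\<in>supp (ins y \<alpha>2 \<gamma>2 f h). (-1) ^ length u = (-1 :: int) ^ (length f + length h + 1)"
  proof
    fix u assume "u \<in> supp (ins y \<alpha>2 \<gamma>2 f h)"
    from keys_ins [OF this] have "Suc (length u) = length f + length h" by blast
    then show "(-1) ^ length u = (-1 :: int) ^ (length f + length h + 1)" by (metis Suc_eq_plus1 minus_minus mult_minus1 power_Suc)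
  qed
  {
    case Nil
    show ?case
      unfolding extend_ins_at_Nil_left [OF sgn]
      by (cases "even (length f)"; cases "even (length h)"; simp add: frag_linear ins_keep)
  next
    case (Cons x g)
    show ?case
      unfolding extend_ins_at_Cons_left [OF sgn]
      by (cases "even (length f)"; cases "even (length h)"; cases "even (length g)";
        simp add: extend_ins_prepend_left \<beta> frag_linear Cons assms)
  }
qed

end

text \<open>
  The insertions of \<open>g\<close> and of \<open>h\<close> have degrees \<open>length g - 1\<close> and \<open>length h - 1\<close>, and
  exchanging them costs the corresponding Koszul sign. By the symmetry of the statement a marker
  \<open>y\<close> is treated like a marker \<open>z\<close>.
\<close>

lemma ins_assoc_par:
  assumes zy: "z \<noteq> y"
    and \<alpha>: "\<And>v. v \<noteq> z \<Longrightarrow> v \<noteq> y \<Longrightarrow> \<alpha> v \<noteq> \<alpha> y \<and> \<alpha>2 v \<noteq> \<alpha>2 z \<and> \<alpha>' (\<alpha> v) = \<alpha>3 (\<alpha>2 v)"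
    and \<beta>: "\<And>x. \<beta> x \<noteq> \<alpha> y \<and> \<alpha>' (\<beta> x) = \<beta>3 x"
    and \<gamma>: "\<And>x. \<gamma>2 x \<noteq> \<alpha>2 z \<and> \<alpha>3 (\<gamma>2 x) = \<gamma>' x"
  shows "frag_extend (\<lambda>u. ins (\<alpha> y) \<alpha>' \<gamma>' u h) (ins z \<alpha> \<beta> f g) =
    frag_cmul ((-1) ^ ((length g + 1) * (length h + 1))) (frag_extend (\<lambda>u. ins (\<alpha>2 z) \<alpha>3 \<beta>3 u g) (ins y \<alpha>2 \<gamma>2 f h))"
proof (induction f arbitrary: g h)
  case (Cons v f)
  have sq: "(-1 :: int) ^ ((length g + 1) * (length h + 1)) * (-1 :: int) ^ ((length g + 1) * (length h + 1)) = 1"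
    by (simp flip: power_add mult_2)
  have z: ?case if "v = z"
    using ins_ins_at_par_if [OF zy \<alpha> \<beta> \<gamma> Cons, where g = g and h = h] zy that by (simp add: extend_ins_prepend_left)
  have "frag_extend (\<lambda>u. ins (\<alpha>2 z) \<alpha>3 \<beta>3 u g) (ins y \<alpha>2 \<gamma>2 f h) =
    frag_cmul ((-1) ^ ((length h + 1) * (length g + 1))) (frag_extend (\<lambda>u. ins (\<alpha> y) \<alpha>' \<gamma>' u h) (ins z \<alpha> \<beta> f g))" for g h
    unfolding Cons by (cases "even (length g)"; cases "even (length h)") auto
  from ins_ins_at_par_if [OF _ _ \<gamma> \<beta> this, where g = h and h = g] \<alpha> zy
  have y: ?case if "v = y"
    using sq that by (simp add: extend_ins_prepend_left mult.commute)
  from z y show ?case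
    by (cases "v = z"; cases "v = y") (simp_all add: extend_ins_prepend_left \<alpha> Cons)
qed simp

section \<open>Degenerate words and renaming of letters\<close>

lemma keys_ins_ConsE:
  assumes "u \<in> supp (ins z \<alpha> \<beta> (v # f) g)" "v \<noteq> z"
  obtains w where "u = \<alpha> v # w" "w \<in> supp (ins z \<alpha> \<beta> f g)"
proof -
  have "u \<in> supp (prepend (\<alpha> v) (ins z \<alpha> \<beta> f g))"
    using assms by (simp only: ins_Cons if_False)
  then show thesis by (rule keys_preE) (rule that)
qed

lemma keys_ins_at_ConsE:
  assumes "u \<in> supp (ins_at z \<alpha> \<beta> f (x # g))"
  obtains (stay) w where "u = \<beta> x # w" "w \<in> supp (ins_at z \<alpha> \<beta> f g)"
    | (leave) w where "u = \<beta> x # w" "w \<in> supp (ins z \<alpha> \<beta> f (x # g))"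
proof -
  obtain w where u: "u = \<beta> x # w" and
    "w \<in> supp (ins z \<alpha> \<beta> f (x # g) + frag_cmul ((-1) ^ length f) (ins_at z \<alpha> \<beta> f g))"
    by (rule keys_preE [OF assms [unfolded ins_at_simps]])
  then consider "w \<in> supp (ins z \<alpha> \<beta> f (x # g))" | "w \<in> supp (ins_at z \<alpha> \<beta> f g)"
    by (auto dest!: subsetD [OF keys_add])
  then show thesis
  proof cases
    case 1
    with u show thesis by (rule leave)
  next
    case 2
    with u show thesis by (rule stay)
  qed
qed

lemma keys_ins_at_NilE:
  assumes "u \<in> supp (ins_at z \<alpha> \<beta> f [])"
  shows "z \<notin> set f" "u = map \<alpha> f"
  using assms by (simp_all add: keep_def split: if_split_asm)

lemma not_distinct_adj_ConsE:
  assumes "\<not> distinct_adj (v # f)"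
  obtains "\<not> distinct_adj f" | f' where "f = v # f'"
  using assms by (cases f) auto

lemma not_distinct_adj_Cons: "\<not> distinct_adj w \<Longrightarrow> \<not> distinct_adj (v # w)"
  by (auto dest: distinct_adj_ConsD)

text \<open>
  Between two neighbouring markers the last letter of one piece is repeated as the first letter
  of the next.
\<close>

lemma ins_repeat_left:
  assumes "u \<in> supp (ins_at z \<alpha> \<beta> (z # f) g)"
  shows "\<not> distinct_adj u"
  using assms
proof (induction g arbitrary: u)
  case (Cons x g)
  from Cons.prems show ?case
  proof (cases rule: keys_ins_at_ConsE)
    case (stay w)
    then show ?thesis using Cons.IH not_distinct_adj_Cons by metis
  next
    case (leave w)
    then have "w \<in> supp (ins_at z \<alpha> \<beta> f (x # g))"
      unfolding ins_Cons by simp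
    then show ?thesis using leave by (cases rule: keys_ins_at_ConsE) auto
  qed
qed (auto dest: keys_ins_at_NilE(1))

lemma ins_at_degenerate_left_if:
  assumes "\<And>u g. u \<in> supp (ins z \<alpha> \<beta> f g) \<Longrightarrow> \<not> distinct_adj u" "\<not> distinct_adj f"
    and "u \<in> supp (ins_at z \<alpha> \<beta> f g)"
  shows "\<not> distinct_adj u"
  using assms(3)
proof (induction g arbitrary: u)
  case Nil
  then show ?case using keys_ins_at_NilE(2) assms(2) distinct_adj_mapD by metis
next
  case (Cons x g)
  from Cons.prems show ?case
    by (cases rule: keys_ins_at_ConsE) (metis Cons.IH assms(1) not_distinct_adj_Cons)+
qed

text \<open>
  A repetition in \<open>f\<close> of a letter other than the marker survives, and one of the marker makes
  two neighbouring pieces share a letter.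
\<close>

lemma ins_degenerate_left:
  assumes "\<not> distinct_adj f" "u \<in> supp (ins z \<alpha> \<beta> f g)"
  shows "\<not> distinct_adj u"
  using assms
proof (induction f arbitrary: u g)
  case (Cons v f)
  show ?case
  proof (cases "v = z")
    case True
    then have u: "u \<in> supp (ins_at z \<alpha> \<beta> f g)"
      using Cons.prems(2) unfolding ins_Cons by simp
    from Cons.prems(1) show ?thesis
    proof (cases rule: not_distinct_adj_ConsE)
      case 1
      show ?thesis by (rule ins_at_degenerate_left_if [OF _ 1 u]) (rule Cons.IH [OF 1])
    next
      case (2 f')
      show ?thesis
        by (rule ins_repeat_left) (use u in \<open>simp only: 2 True\<close>)
    qed
  next
    case False
    obtain w where w: "u = \<alpha> v # w" "w \<in> supp (ins z \<alpha> \<beta> f g)"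
      by (rule keys_ins_ConsE [OF Cons.prems(2) False])
    from Cons.prems(1) show ?thesis
    proof (cases rule: not_distinct_adj_ConsE)
      case 1
      then show ?thesis using Cons.IH [OF 1 w(2)] w(1) not_distinct_adj_Cons by metis
    next
      case (2 f')
      with w(2) obtain w' where "w = \<alpha> v # w'"
        using False by (auto elim: keys_ins_ConsE simp del: ins_Cons)
      then show ?thesis using w(1) by simp
    qed
  qed
qed simp

lemma ins_at_degenerate_right_if:
  assumes "\<And>u. u \<in> supp (ins z \<alpha> \<beta> f g) \<Longrightarrow> \<not> distinct_adj u" "\<not> distinct_adj g"
    and "\<And>g u. u \<in> supp (ins z \<alpha> \<beta> f g) \<Longrightarrow> \<not> distinct_adj g \<Longrightarrow> \<not> distinct_adj u"
    and "u \<in> supp (ins_at z \<alpha> \<beta> f g)"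
  shows "\<not> distinct_adj u"
  using assms(2,4)
proof (induction g arbitrary: u)
  case (Cons x g)
  from Cons.prems(2) show ?case
  proof (cases rule: keys_ins_at_ConsE)
    case (stay w)
    from Cons.prems(1) show ?thesis
    proof (cases rule: not_distinct_adj_ConsE)
      case 1
      then show ?thesis using Cons.IH [OF 1 stay(2)] stay(1) not_distinct_adj_Cons by metis
    next
      case (2 g')
      from stay(2) obtain w' where "w = \<beta> x # w'"
        unfolding 2 by (cases rule: keys_ins_at_ConsE) blast+
      then show ?thesis using stay(1) by simp
    qed
  next
    case (leave w)
    then show ?thesis using assms(3) Cons.prems(1) not_distinct_adj_Cons by metis
  qed
qed simp

text \<open>
  A repetition in \<open>g\<close> survives within a piece. If \<open>g\<close> is cut between the two equal letters, one
  of them is shared, so that it and the other letter still lie next to each other in one of the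
  two pieces.
\<close>

lemma ins_degenerate_right:
  assumes "\<not> distinct_adj g" "u \<in> supp (ins z \<alpha> \<beta> f g)"
  shows "\<not> distinct_adj u"
  using assms
proof (induction f arbitrary: u g)
  case (Cons v f)
  show ?case
  proof (cases "v = z")
    case True
    then have u: "u \<in> supp (ins_at z \<alpha> \<beta> f g)"
      using Cons.prems(2) unfolding ins_Cons by simp
    show ?thesis
      by (rule ins_at_degenerate_right_if [OF _ Cons.prems(1) _ u])
         (erule Cons.IH [OF Cons.prems(1)], erule (1) Cons.IH)
  next
    case False
    obtain w where w: "u = \<alpha> v # w" "w \<in> supp (ins z \<alpha> \<beta> f g)"
      by (rule keys_ins_ConsE [OF Cons.prems(2) False])
    then show ?thesis using Cons.IH [OF Cons.prems(1)] not_distinct_adj_Cons by metis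
  qed
qed simp

text \<open>
  The two words that arise by removing one of the equal neighbours coincide and have opposite
  signs. In all others the equal neighbours are still there.
\<close>

lemma word_bdry_degenerate:
  "w = u @ x # x # v \<Longrightarrow> t \<in> supp (word_bdry w) \<Longrightarrow> \<not> distinct_adj t"
proof (induction u arbitrary: w t)
  case Nil
  then have "t \<in> supp (prepend x (prepend x (word_bdry v)))" by simp
  then obtain t' where "t = x # x # t'"
    by (auto elim!: keys_preE)
  then show ?case by simp
next
  case (Cons y u)
  then have "t \<in> supp (frag_of (u @ x # x # v) - prepend y (word_bdry (u @ x # x # v)))" by simp
  then consider "t = u @ x # x # v" | t' where "t = y # t'" "t' \<in> supp (word_bdry (u @ x # x # v))"
    by (auto dest!: subsetD [OF keys_diff] elim!: keys_preE)
  then show ?case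
  proof cases
    case 1
    then show ?thesis by (simp add: distinct_adj_append_iff)
  next
    case 2
    then show ?thesis using Cons.IH [OF refl] not_distinct_adj_Cons by metis
  qed
qed

lemma ins_at_cong_if:
  assumes "\<And>g. \<forall>x\<in>set g. \<beta> (\<tau> x) = \<beta>' x \<Longrightarrow> ins (\<sigma> z) \<alpha> \<beta> (map \<sigma> f) (map \<tau> g) = ins z \<alpha>' \<beta>' f g"
    and "\<forall>v\<in>set f. v \<noteq> z \<longrightarrow> \<sigma> v \<noteq> \<sigma> z \<and> \<alpha> (\<sigma> v) = \<alpha>' v"  and "\<forall>x\<in>set g. \<beta> (\<tau> x) = \<beta>' x"
  shows "ins_at (\<sigma> z) \<alpha> \<beta> (map \<sigma> f) (map \<tau> g) = ins_at z \<alpha>' \<beta>' f g"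
  using assms(3)
proof (induction g)
  case Nil
  have "\<sigma> z \<in> \<sigma> ` set f \<longleftrightarrow> z \<in> set f" using assms(2) by auto
  moreover have "map (\<alpha> \<circ> \<sigma>) f = map \<alpha>' f" if "z \<notin> set f"
    using assms(2) that by auto
  ultimately show ?case by (simp add: keep_def del: map_eq_conv)
next
  case (Cons x g)
  then show ?case using assms(1) [of "x # g"] by simp
qed

lemma ins_map_cong:
  assumes "\<forall>v\<in>set f. v \<noteq> z \<longrightarrow> \<sigma> v \<noteq> \<sigma> z \<and> \<alpha> (\<sigma> v) = \<alpha>' v" and "\<forall>x\<in>set g. \<beta> (\<tau> x) = \<beta>' x"
  shows "ins (\<sigma> z) \<alpha> \<beta> (map \<sigma> f) (map \<tau> g) = ins z \<alpha>' \<beta>' f g"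
  using assms
proof (induction f arbitrary: g)
  case (Cons v f)
  then have IH: "ins (\<sigma> z) \<alpha> \<beta> (map \<sigma> f) (map \<tau> g) = ins z \<alpha>' \<beta>' f g" if "\<forall>x\<in>set g. \<beta> (\<tau> x) = \<beta>' x" for g
    using that by simp
  have "ins_at (\<sigma> z) \<alpha> \<beta> (map \<sigma> f) (map \<tau> g) = ins_at z \<alpha>' \<beta>' f g"
    by (rule ins_at_cong_if) (use Cons.prems IH in auto)
  then show ?case
    using Cons.prems IH by (cases "v = z") simp_all
qed simp

lemma map_prepend: "frag_extend (\<lambda>u. frag_of (map \<phi> u)) (prepend v x) = prepend (\<phi> v) (frag_extend (\<lambda>u. frag_of (map \<phi> u)) x)"
  by (simp add: extend_prepend prepend_extend)

lemma map_ins_at_if: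
  assumes "\<And>g. frag_extend (\<lambda>u. frag_of (map \<phi> u)) (ins z \<alpha> \<beta> f g) = ins z (\<lambda>v. \<phi> (\<alpha> v)) (\<lambda>x. \<phi> (\<beta> x)) f g"
  shows "frag_extend (\<lambda>u. frag_of (map \<phi> u)) (ins_at z \<alpha> \<beta> f g) = ins_at z (\<lambda>v. \<phi> (\<alpha> v)) (\<lambda>x. \<phi> (\<beta> x)) f g"
  by (induction g) (simp_all add: map_prepend frag_linear assms keep_def comp_def)

lemma map_ins:
  "frag_extend (\<lambda>u. frag_of (map \<phi> u)) (ins z \<alpha> \<beta> f g) = ins z (\<lambda>v. \<phi> (\<alpha> v)) (\<lambda>x. \<phi> (\<beta> x)) f g"
proof (induction f arbitrary: g)
  case (Cons v f)
  then show ?case using map_ins_at_if [OF Cons] by (simp add: map_prepend)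
qed simp

text \<open>
  Every piece consists of the letter \<open>x\<close>, so no piece has a step, and no signs arise.
\<close>

lemma ins_single_right:
  "ins z \<alpha> \<beta> f [x] = (if z \<in> set f then frag_of (map (\<lambda>v. if v = z then \<beta> x else \<alpha> v) f) else 0)"
proof (induction f)
  case (Cons v f)
  have "ins z \<alpha> \<beta> f [x] + keep z \<alpha> f = frag_of (map (\<lambda>v. if v = z then \<beta> x else \<alpha> v) f)"
    unfolding Cons keep_def
    by (auto intro!: arg_cong [where f = frag_of] map_cong)
  then have "prepend (\<beta> x) (ins z \<alpha> \<beta> f [x] + keep z \<alpha> f) = frag_of (\<beta> x # map (\<lambda>v. if v = z then \<beta> x else \<alpha> v) f)"
    by simp
  then show ?case using Cons by (cases "even (length f)") auto
qed simp

lemma ins_single_left: "ins z \<alpha> \<beta> [z] g = frag_of (map \<beta> g)"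
proof -
  have "ins_at z \<alpha> \<beta> [] g = frag_of (map \<beta> g)" by (induction g) auto
  then show ?thesis by simp
qed

section \<open>Inversions of a composed word\<close>

abbreviation count_if :: "('a \<Rightarrow> bool) \<Rightarrow> 'a list \<Rightarrow> nat" where
  "count_if P xs \<equiv> length (filter P xs)"

fun inversions :: "nat list \<Rightarrow> nat" where
  "inversions [] = 0"
| "inversions (x # xs) = count_if (\<lambda>y. y < x) xs + inversions xs"

text \<open>
  The inversions of \<open>xs @ ys\<close> between the two parts.
\<close>

definition cross :: "nat list \<Rightarrow> nat list \<Rightarrow> nat" where
  "cross xs ys = (\<Sum>x\<leftarrow>xs. count_if (\<lambda>y. y < x) ys)"

lemma cross_simps [simp]:
  "cross [] ys = 0" "cross (x # xs) ys = count_if (\<lambda>y. y < x) ys + cross xs ys"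
  "cross (xs @ xs') ys = cross xs ys + cross xs' ys"
  by (simp_all add: cross_def)

lemma inversions_append: "inversions (xs @ ys) = inversions xs + inversions ys + cross xs ys"
  by (induction xs) auto

lemma sum_list_count_if_swap: "(\<Sum>x\<leftarrow>xs. count_if (\<lambda>q. R q x) qs) = (\<Sum>q\<leftarrow>qs. count_if (R q) xs)"
proof (induction xs)
  case (Cons x xs)
  have "(\<Sum>q\<leftarrow>qs. count_if (R q) (x # xs)) = count_if (\<lambda>q. R q x) qs + (\<Sum>q\<leftarrow>qs. count_if (R q) xs)"
    by (induction qs) auto
  then show ?case using Cons by simp
qed (induction qs; simp)

lemma inversions_card: "inversions xs = card {(a, b). a < b \<and> b < length xs \<and> xs ! a > xs ! b}"
proof (induction xs)
  case (Cons x xs)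
  let ?A = "{(a, b). a < b \<and> b < length xs \<and> xs ! a > xs ! b}"
  let ?B = "{b. b < length xs \<and> xs ! b < x}"
  have eq: "{(a, b). a < b \<and> b < length (x # xs) \<and> (x # xs) ! a > (x # xs) ! b} =
      (\<lambda>(a, b). (Suc a, Suc b)) ` ?A \<union> (\<lambda>b. (0, Suc b)) ` ?B" (is "?L = ?R1 \<union> ?R2")
  proof (intro subset_antisym subsetI)
    fix y assume "y \<in> ?L"
    then obtain a b where y: "y = (a, b)" "a < b" "b < length (x # xs)" "(x # xs) ! a > (x # xs) ! b" by auto
    then obtain b' where b: "b = Suc b'" by (cases b) auto
    show "y \<in> ?R1 \<union> ?R2"
      using y b by (cases a) auto
  qed auto
  have fin: "finite ?A"
    by (rule finite_subset [of _ "{..<length xs} \<times> {..<length xs}"]) auto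
  have "card ?L = card ?A + card ?B"
    unfolding eq by (subst card_Un_disjoint) (auto simp: fin inj_on_def card_image)
  then show ?case
    using Cons by (simp add: length_filter_conv_card)
qed simp

text \<open>
  \<open>val_shift i s\<close> and \<open>val_block i\<close> renumber the values of \<open>f\<close> and of \<open>g\<close> in a composite at \<open>i\<close>.
\<close>

definition val_shift :: "nat \<Rightarrow> nat \<Rightarrow> nat \<Rightarrow> nat" where
  "val_shift i s v = (if v < i then v else v + s - 1)"

definition val_block :: "nat \<Rightarrow> nat \<Rightarrow> nat" where
  "val_block i l = i - 1 + l"

lemma val_block_less [simp]: "val_block i x < val_block i y \<longleftrightarrow> x < y"
  by (simp add: val_block_def)

lemma val_block_fun: "(\<lambda>l. i - 1 + l) = val_block i" "(+) (i - Suc 0) = val_block i"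
  by (auto simp: val_block_def)

text \<open>
  The word composed from \<open>f\<close> and the pieces of \<open>g\<close> for given cut positions. In contrast to the
  separate constructions of the pieces and of the substitution it consumes \<open>g\<close> letter by letter;
  cut positions are counted from the start of the remaining part of \<open>g\<close>.
\<close>

fun glue :: "nat \<Rightarrow> nat \<Rightarrow> nat list \<Rightarrow> nat list \<Rightarrow> nat list \<Rightarrow> nat list" where
  "glue i s [] g ps = []"
| "glue i s (v # f) g ps =
     (if v = i then
        (case ps of [] \<Rightarrow> map (val_block i) g @ glue i s f [] []
         | p # qs \<Rightarrow> map (val_block i) (take (Suc p) g) @ glue i s f (drop p g) (map (\<lambda>q. q - p) qs))
      else val_shift i s v # glue i s f g ps)"

text \<open>
  The exponent of the sign with which \<open>ins\<close> produces the word \<open>glue i s f g ps\<close>, where \<open>n\<close> is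
  the length of \<open>g\<close>: a piece that ends at the cut position \<open>p\<close> has \<open>p\<close> steps, each of which is
  moved past the rest of \<open>f\<close>. The last piece of a word of length \<open>n\<close> has \<open>n - 1\<close> steps; \<open>n + 1\<close>
  has the same parity and avoids a subtraction, in particular for \<open>n = 0\<close>.
\<close>

fun step_exponent :: "nat \<Rightarrow> nat list \<Rightarrow> nat \<Rightarrow> nat list \<Rightarrow> nat" where
  "step_exponent i [] n ps = 0"
| "step_exponent i (v # f) n ps =
     (if v = i then
        (case ps of [] \<Rightarrow> (n + 1) * length f
         | p # qs \<Rightarrow> p * length f + step_exponent i f (n - p) (map (\<lambda>q. q - p) qs))
      else step_exponent i f n ps)"

lemma cuts_0 [simp]: "cuts 0 g = {[]}"
  by (auto simp: cuts_def)

lemma cuts_Suc_iff: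
  "p # qs \<in> cuts (Suc m) g \<longleftrightarrow>
     p < length g \<and> (\<forall>q\<in>set qs. p \<le> q) \<and> map (\<lambda>q. q - p) qs \<in> cuts m (drop p g)"
proof -
  have "sorted (map (\<lambda>q. q - p) qs) \<longleftrightarrow> sorted qs" if "\<forall>q\<in>set qs. p \<le> q"
    using that
  proof (induction qs)
    case (Cons a qs)
    have "a - p \<le> x - p \<longleftrightarrow> a \<le> x" if "x \<in> set qs" for x
      using Cons.prems that by (simp add: le_diff_iff)
    then show ?case using Cons by auto
  qed simp
  then show ?thesis by (auto simp: cuts_def)
qed

lemma finite_cuts [simp]: "finite (cuts m g)"
proof -
  have "cuts m g \<subseteq> {ps. set ps \<subseteq> {..<length g} \<and> length ps = m}" by (auto simp: cuts_def)
  then show ?thesis using finite_lists_length_eq [of "{..<length g}" m] finite_subset by blast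
qed

text \<open>
  The first cut position splits \<open>g\<close>, and the others cut the part behind it.
\<close>

lemma sum_cuts_Suc:
  "(\<Sum>ps\<in>cuts (Suc m) g. F ps) = (\<Sum>p<length g. \<Sum>ps\<in>cuts m (drop p g). F (p # map (\<lambda>q. p + q) ps))"
proof -
  have "(\<Sum>p<length g. \<Sum>ps\<in>cuts m (drop p g). F (p # map (\<lambda>q. p + q) ps)) =
    (\<Sum>(p, ps)\<in>(SIGMA p:{..<length g}. cuts m (drop p g)). F (p # map (\<lambda>q. p + q) ps))"
    by (rule sum.Sigma) auto
  also have "\<dots> = (\<Sum>ps\<in>cuts (Suc m) g. F ps)"
  proof (rule sum.reindex_bij_witness [where i = "\<lambda>ps. (hd ps, map (\<lambda>q. q - hd ps) (tl ps))"
        and j = "\<lambda>(p, ps). p # map (\<lambda>q. p + q) ps"])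
    fix ps assume ps: "ps \<in> cuts (Suc m) g"
    then obtain p qs where "ps = p # qs" by (cases ps) (auto simp: cuts_def)
    then show "(\<lambda>(p, ps). p # map (\<lambda>q. p + q) ps) (hd ps, map (\<lambda>q. q - hd ps) (tl ps)) = ps"
      "(hd ps, map (\<lambda>q. q - hd ps) (tl ps)) \<in> (SIGMA p:{..<length g}. cuts m (drop p g))"
      using ps by (auto simp: cuts_Suc_iff intro!: map_idI)
  qed (auto simp: cuts_Suc_iff comp_def)
  finally show ?thesis ..
qed

lemma pieces_Cons:
  assumes "p # qs \<in> cuts (Suc m) g"
  shows "pieces g (p # qs) = take (Suc p) g # pieces (drop p g) (map (\<lambda>q. q - p) qs)"
proof -
  have *: "map2 (\<lambda>a b. drop a (take (Suc b) g)) (p # qs) (qs @ [length g - 1]) =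
      map2 (\<lambda>a b. drop a (take (Suc b) (drop p g))) (0 # map (\<lambda>q. q - p) qs)
        (map (\<lambda>q. q - p) qs @ [length (drop p g) - 1])"
  proof (rule nth_equalityI, goal_cases)
    case 1
    show ?case by simp
  next
    case (2 k)
    then have k: "k < Suc (length qs)" by simp
    have le: "p \<le> q" if "q \<in> set qs" for q using that assms by (auto simp: cuts_Suc_iff)
    have a: "(p # qs) ! k = p + (0 # map (\<lambda>q. q - p) qs) ! k"
      using k le by (cases k) auto
    have b: "(qs @ [length g - 1]) ! k = p + (map (\<lambda>q. q - p) qs @ [length (drop p g) - 1]) ! k"
      using k le assms by (auto simp: nth_append cuts_Suc_iff)
    from k show ?case
      by (simp only: nth_map nth_zip length_zip length_map length_append length_Cons list.size prod.case a b)
         (simp add: take_drop add.commute)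
  qed
  show ?thesis
    unfolding pieces_def using * by simp
qed

lemma pieces_Nil: "pieces g [] = [g]"
  by (cases g) (simp_all add: pieces_def)

lemma substitute_absent: "i \<notin> set f \<Longrightarrow> substitute i s f gs = map (val_shift i s) f"
  by (induction f) (auto simp: val_shift_def val_block_def)

lemma glue_absent: "i \<notin> set f \<Longrightarrow> glue i s f g ps = map (val_shift i s) f"
  by (induction f) auto

lemma Suc_count_list_minus_1: "i \<in> set f \<Longrightarrow> Suc (count_list f i - Suc 0) = count_list f i"
  by (metis Suc_pred count_list_0_iff gr0I)

lemma substitute_pieces:
  assumes "i \<in> set f" "ps \<in> cuts (count_list f i - 1) g"
  shows "substitute i s f (pieces g ps) = glue i s f g ps"
  using assms
proof (induction f arbitrary: g ps)
  case (Cons v f)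
  show ?case
  proof (cases "v = i")
    case False
    then show ?thesis using Cons by (simp add: val_shift_def)
  next
    case True
    show ?thesis
    proof (cases "i \<in> set f")
      case False
      then have "ps = []" using Cons.prems True by (simp add: count_list_0_iff)
      then show ?thesis using True False by (simp add: pieces_Nil substitute_absent glue_absent val_block_fun)
    next
      case in_f: True
      then have m: "count_list f i = Suc (count_list f i - 1)" 
        by (metis Suc_pred' count_list_0_iff gr0I)
      then obtain p qs where ps: "ps = p # qs"
        using Cons.prems True by (cases ps) (auto simp: cuts_def)
      have c: "p # qs \<in> cuts (Suc (count_list f i - 1)) g"
        using Cons.prems True ps m by simp
      then show ?thesis
        using Cons.IH [OF in_f, of "map (\<lambda>q. q - p) qs" "drop p g"] True ps
        by (simp add: pieces_Cons [OF c] cuts_Suc_iff val_block_fun)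
    qed
  qed
qed simp

text \<open>
  The case distinctions in the equations of \<open>glue\<close>, for inductions on the word \<open>f\<close>.
\<close>

lemma cuts_cases [consumes 2, case_names other last cut]:
  assumes "i \<in> set (v # f)" "ps \<in> cuts (count_list (v # f) i - 1) g"
  obtains "v \<noteq> i" "i \<in> set f" "ps \<in> cuts (count_list f i - 1) g"
  | "v = i" "i \<notin> set f" "ps = []"
  | p qs where "v = i" "i \<in> set f" "ps = p # qs" "p < length g" "\<forall>q\<in>set qs. p \<le> q"
      "\<forall>q\<in>set qs. q < length g"
      "map (\<lambda>q. q - p) qs \<in> cuts (count_list f i - 1) (drop p g)" "length qs = count_list f i - 1"
proof (cases "v = i")
  case False
  then show thesis using assms that(1) by simp
next
  case True
  show thesis
  proof (cases "i \<in> set f")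
    case False
    then show thesis using True assms that(2) by (simp add: count_list_0_iff)
  next
    case in_f: True
    then have m: "count_list f i = Suc (count_list f i - 1)" 
      by (metis Suc_pred' count_list_0_iff gr0I)
    then obtain p qs where ps: "ps = p # qs"
      using assms True by (cases ps) (auto simp: cuts_def)
    have *: "p # qs \<in> cuts (Suc (count_list f i - 1)) g"
      using assms True ps m by simp
    then have "length qs = count_list f i - 1" "\<forall>q\<in>set qs. q < length g" by (auto simp: cuts_def)
    then show thesis
      using that(3) True in_f ps * by (simp add: cuts_Suc_iff)
  qed
qed

text \<open>
  The letters of the composed word are those of \<open>f\<close> other than \<open>i\<close>, those of \<open>g\<close>, and for each
  cut position a second copy of the letter of \<open>g\<close> there.
\<close>

lemma count_if_glue:
  assumes "i \<in> set f" "ps \<in> cuts (count_list f i - 1) g"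
  shows "count_if P (glue i s f g ps) =
    count_if (\<lambda>v. v \<noteq> i \<and> P (val_shift i s v)) f + count_if (\<lambda>x. P (val_block i x)) g
      + count_if (\<lambda>q. P (val_block i (g ! q))) ps"
  using assms
proof (induction f arbitrary: g ps)
  case (Cons v f)
  from Cons.prems show ?case
  proof (cases rule: cuts_cases)
    case other
    then show ?thesis using Cons.IH by simp
  next
    case last
    then have "count_if (\<lambda>v. v \<noteq> i \<and> P (val_shift i s v)) f = count_if P (map (val_shift i s) f)"
      by (induction f) auto
    then show ?thesis using last by (simp add: glue_absent filter_map comp_def)
  next
    case (cut p qs)
    have "count_if (\<lambda>q. P (val_block i (drop p g ! q))) (map (\<lambda>q. q - p) qs) = count_if (\<lambda>q. P (val_block i (g ! q))) qs"
      using cut(5,6) by (induction qs) auto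
    moreover have "count_if (\<lambda>x. P (val_block i x)) g =
        count_if (\<lambda>x. P (val_block i x)) (take p g) + count_if (\<lambda>x. P (val_block i x)) (drop p g)"
      by (metis append_take_drop_id filter_append length_append)
    ultimately show ?thesis
      using Cons.IH [OF cut(2,7)] cut
      by (simp add: filter_map comp_def take_Suc_conv_app_nth)
  qed
qed simp

lemma count_list_count_if: "count_list xs x = count_if (\<lambda>y. y = x) xs"
  by (induction xs) auto

lemma count_if_lt_eq_gt: "length xs = count_if (\<lambda>y. y < x) xs + count_if (\<lambda>y. y = x) xs + count_if (\<lambda>y. x < y) xs" for x :: nat
  by (induction xs) auto

lemma sum_list_count_if_const: "(\<Sum>x\<leftarrow>xs. c) = c * length xs" for c :: nat
  by (induction xs) auto

lemma cross_take_Suc: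
  "p < length g \<Longrightarrow> cross (take (Suc p) g) ys = cross (take p g) ys + count_if (\<lambda>y. y < g ! p) ys"
  by (simp add: take_Suc_conv_app_nth)

lemma cross_map_glue:
  assumes "i \<in> set f" "ps \<in> cuts (count_list f i - 1) g'" "set g \<subseteq> {1..s}" "i \<ge> 1"
  shows "cross (map (val_block i) g) (glue i s f g' ps) =
    length g * count_if (\<lambda>v. v < i) f + cross g g' + (\<Sum>q\<leftarrow>ps. count_if (\<lambda>x. g' ! q < x) g)"
proof -
  have "count_if (\<lambda>y. y < val_block i x) (glue i s f g' ps) =
      count_if (\<lambda>v. v < i) f + count_if (\<lambda>y. y < x) g' + count_if (\<lambda>q. g' ! q < x) ps" if "x \<in> set g" for x
  proof -
    have "v \<noteq> i \<and> val_shift i s v < val_block i x \<longleftrightarrow> v < i" for v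
    proof -
      have "1 \<le> x" "x \<le> s" using that assms(3) by auto
      then show ?thesis using assms(4) by (auto simp: val_shift_def val_block_def)
    qed
    then show ?thesis by (simp add: count_if_glue [OF assms(1,2)])
  qed
  note c = this
  have "cross (map (val_block i) g) (glue i s f g' ps) =
      (\<Sum>x\<leftarrow>g. count_if (\<lambda>v. v < i) f + (count_if (\<lambda>y. y < x) g' + count_if (\<lambda>q. g' ! q < x) ps))"
    unfolding cross_def map_map by (intro arg_cong [where f = sum_list] map_cong refl) (simp only: comp_def c add.assoc)
  then show ?thesis
    using sum_list_count_if_swap [of "\<lambda>q x. g' ! q < x" ps g]
    by (simp add: sum_list_addf sum_list_count_if_const cross_def mult.commute)
qed

text \<open>
  The inversions caused by the second copies of the letters at the cut positions, up to parity:
  among themselves, and between them and the letters of \<open>g\<close>. It differs from the part of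
  \<open>cut_exponent\<close> that depends on the cuts in counting letters instead of edges.
\<close>

definition cut_inversions :: "nat list \<Rightarrow> nat list \<Rightarrow> nat" where
  "cut_inversions g ps = inversions (map ((!) g) ps) +
     (\<Sum>p\<leftarrow>ps. count_if (\<lambda>x. x < g ! p) g + count_list (take p g) (g ! p))"

lemma inversions_map_block: "inversions (map (val_block i) g) = inversions g"
  by (induction g) (simp_all add: filter_map comp_def val_block_def)

lemma inversions_map_shift: "i \<notin> set f \<Longrightarrow> i \<ge> 1 \<Longrightarrow> inversions (map (val_shift i s) f) = inversions f"
proof (induction f)
  case (Cons v f)
  have "count_if (\<lambda>y. val_shift i s y < val_shift i s v) f = count_if (\<lambda>y. y < v) f"
    using Cons.prems by (intro arg_cong [where f = length] filter_cong) (auto simp: val_shift_def val_block_def)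
  then show ?case using Cons by (simp add: filter_map comp_def)
qed simp

text \<open>
  This splits off the part of \<open>g\<close> in front of the first cut position. For a later cut position
  \<open>q\<close> the \<open>p\<close> letters in front of the first cut are smaller than, equal to or larger than the
  letter at \<open>q\<close>. The first two kinds are counted by \<open>cut_inversions g\<close> and the third by the sum
  on the left.
\<close>

lemma cut_inversions_Cons:
  assumes "p < length g" "\<forall>q\<in>set qs. p \<le> q" "\<forall>q\<in>set qs. q < length g"
  shows "cut_inversions g (p # qs) + (\<Sum>q\<leftarrow>qs. count_if (\<lambda>x. g ! q < x) (take p g)) =
    cut_inversions (drop p g) (map (\<lambda>q. q - p) qs) + count_if (\<lambda>q. g ! q < g ! p) qs + p * length qs
     + count_if (\<lambda>x. x < g ! p) g + count_list (take p g) (g ! p)"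
proof -
  have m: "map (\<lambda>q. drop p g ! (q - p)) qs = map ((!) g) qs"
    using assms by auto
  have split: "count_if P g = count_if P (take p g) + count_if P (drop p g)" for P
    by (metis append_take_drop_id filter_append length_append)
  have "count_if (\<lambda>x. x < g ! q) g + count_list (take q g) (g ! q) + count_if (\<lambda>x. g ! q < x) (take p g) =
      count_if (\<lambda>x. x < drop p g ! (q - p)) (drop p g) + count_list (take (q - p) (drop p g)) (drop p g ! (q - p)) + p"
    if "q \<in> set qs" for q
  proof -
    have q: "p \<le> q" "q < length g" using assms that by auto
    have "take q g = take p g @ take (q - p) (drop p g)"
      using q by (metis le_add_diff_inverse take_add)
    then have "count_list (take q g) (g ! q) = count_if (\<lambda>y. y = g ! q) (take p g) + count_list (take (q - p) (drop p g)) (g ! q)"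
      by (simp add: count_list_count_if)
    then show ?thesis
      using q count_if_lt_eq_gt [of "take p g" "g ! q"] split [of "\<lambda>x. x < g ! q"] by simp
  qed
  note * = this
  have "(\<Sum>q\<leftarrow>qs. count_if (\<lambda>x. x < g ! q) g + count_list (take q g) (g ! q)) + (\<Sum>q\<leftarrow>qs. count_if (\<lambda>x. g ! q < x) (take p g)) =
      (\<Sum>q\<leftarrow>qs. count_if (\<lambda>x. x < g ! q) g + count_list (take q g) (g ! q) + count_if (\<lambda>x. g ! q < x) (take p g))"
    by (simp add: sum_list_addf)
  also have "\<dots> = (\<Sum>q\<leftarrow>qs. count_if (\<lambda>x. x < drop p g ! (q - p)) (drop p g) + count_list (take (q - p) (drop p g)) (drop p g ! (q - p)) + p)"
    by (intro arg_cong [where f = sum_list] map_cong refl) (rule *)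
  also have "\<dots> = (\<Sum>q\<leftarrow>qs. count_if (\<lambda>x. x < drop p g ! (q - p)) (drop p g) + count_list (take (q - p) (drop p g)) (drop p g ! (q - p))) + p * length qs"
    by (simp add: sum_list_addf sum_list_count_if_const)
  finally show ?thesis
    by (simp add: cut_inversions_def m comp_def filter_map)
qed

text \<open>
  The bookkeeping in the induction step of \<open>inversions_glue\<close>, with all counts replaced by
  variables so that it is a linear statement: after elimination the total is that of the
  induction hypothesis plus an even number.
\<close>

lemma glue_parity_step:
  fixes r :: nat
  assumes IH: "even (r' + s' + vf + (L + 1) * N + i' + c')"
    and "r = it1 + r' + Suc p * a + cr1 + X1" "it1 = it + gt" "cr1 = cr + ltd" "X1 = X + c"
      "ig = it + i' + cr" "lt = ltt + ltd" "p = ltt + ct + gt" "F = a + Suc q + N"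
      "cg + X = c' + c + p * q + lt + ct" "G = p + L" "st = p * F + s'" "vf' = a + vf"
  shows "even (r + st + vf' + (G + 1) * N + ig + cg)"
proof -
  have *: "r + st + vf' + (G + 1) * N + ig + cg =
    (r' + s' + vf + (L + 1) * N + i' + c') + 2 * (it + cr + c + ltd + p + (p + 1) * a + p * N + p * q)"
    using assms(2-) by (simp add: algebra_simps)
  show ?thesis
    unfolding * by (rule dvd_add [OF IH dvd_triv_left])
qed

text \<open>
  This is the source of the signs of the composition. The inversions of the composed word are
  those within \<open>f\<close> and within \<open>g\<close>, those caused by the copied letters, and those between letters
  of \<open>f\<close> and of \<open>g\<close>. With \<open>m\<close> cuts, \<open>m + 1\<close> letters \<open>i\<close> are replaced by \<open>length g + m\<close> letters,
  so the number of inversions of a letter of \<open>f\<close> above \<open>i\<close> changes by \<open>length g - 1\<close> if the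
  order of the word does not matter. That the steps of \<open>g\<close> stand between the letters of \<open>f\<close>, and
  not behind all of them, is accounted for by \<open>step_exponent\<close>.
\<close>

lemma inversions_glue:
  assumes "i \<in> set f" "ps \<in> cuts (count_list f i - 1) g" "set g \<subseteq> {1..s}" "i \<ge> 1"
  shows "even (inversions (glue i s f g ps) + step_exponent i f (length g) ps + inversions f
    + (length g + 1) * count_if (\<lambda>v. i < v) f + inversions g + cut_inversions g ps)"
  using assms(1-3)
proof (induction f arbitrary: g ps)
  case (Cons v f)
  from Cons.prems(1,2) show ?case
  proof (cases rule: cuts_cases)
    case other
    note IH = Cons.IH [OF other(2,3) Cons.prems(3)]
    note count_if = count_if_glue [OF other(2,3), of "\<lambda>y. y < val_shift i s v" s]
    have pos: "\<forall>x\<in>set g. 1 \<le> x" "\<forall>q\<in>set ps. 1 \<le> g ! q \<and> g ! q \<le> s"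
      using Cons.prems(3) other(3) by (auto simp: cuts_def dest!: nth_mem)
    show ?thesis
    proof (cases "v < i")
      case True
      have 1: "w \<noteq> i \<and> val_shift i s w < val_shift i s v \<longleftrightarrow> w < v" for w
        using True by (auto simp: val_shift_def val_block_def)
      have 2: "filter (\<lambda>x. val_block i x < val_shift i s v) g = []"
        "filter (\<lambda>q. val_block i (g ! q) < val_shift i s v) ps = []"
        using True pos by (auto simp: val_shift_def val_block_def filter_empty_conv)
      have "count_if (\<lambda>y. y < val_shift i s v) (glue i s f g ps) = count_if (\<lambda>w. w < v) f"
        unfolding count_if 1 2 by simp
      then show ?thesis using IH True other by simp argo
    next
      case False
      then have v: "i < v" using other by simp
      have "count_if (\<lambda>w. w \<noteq> i \<and> val_shift i s w < val_shift i s v) f = count_if (\<lambda>w. w < v \<and> w \<noteq> i) f"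
        using v assms(4) by (intro arg_cong [where f = length] filter_cong) (auto simp: val_shift_def val_block_def)
      moreover have "count_if (\<lambda>w. w < v) f = count_if (\<lambda>w. w < v \<and> w \<noteq> i) f + count_list f i"
        using v by (induction f) auto
      moreover have "filter (\<lambda>x. val_block i x < val_shift i s v) g = g"
        "filter (\<lambda>q. val_block i (g ! q) < val_shift i s v) ps = ps"
        using v Cons.prems(3) pos assms(4) by (auto simp: val_shift_def val_block_def filter_id_conv)
      moreover have "Suc (length ps) = count_list f i"
        using other(2,3) by (simp add: cuts_def Suc_count_list_minus_1)
      ultimately have "count_if (\<lambda>y. y < val_shift i s v) (glue i s f g ps) + 1 = count_if (\<lambda>w. w < v) f + length g"
        unfolding count_if by simp
      then have "even (count_if (\<lambda>y. y < val_shift i s v) (glue i s f g ps) + count_if (\<lambda>w. w < v) f + (length g + 1))"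
        by presburger
      then show ?thesis using IH v other by (simp add: algebra_simps) presburger
    qed
  next
    case last
    have *: "cross (map (val_block i) g) (map (val_shift i s) f) = length g * count_if (\<lambda>v. v < i) f"
    proof -
      have "count_if (\<lambda>y. y < val_block i x) (map (val_shift i s) f) = count_if (\<lambda>v. v < i) f" if "x \<in> set g" for x
      proof -
        have x: "1 \<le> x" "x \<le> s" using that Cons.prems(3) by auto
        have "(val_shift i s v < val_block i x) = (v < i)" if "v \<in> set f" for v
        proof -
          have "v \<noteq> i" using that last(2) by metis
          then show ?thesis using x assms(4) by (auto simp: val_shift_def val_block_def)
        qed
        then show ?thesis
          unfolding filter_map length_map by (intro arg_cong [where f = length] filter_cong) simp_all
      qed
      note c = this
      have "cross (map (val_block i) g) (map (val_shift i s) f) = (\<Sum>x\<leftarrow>g. count_if (\<lambda>v. v < i) f)"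
        unfolding cross_def map_map [of _ "val_block i"]
        by (intro arg_cong [where f = sum_list] map_cong refl) (simp only: comp_def c)
      then show ?thesis by (simp add: sum_list_count_if_const mult.commute)
    qed
    have "count_list f i = 0" using last by (simp add: count_list_0_iff)
    then have "length f = count_if (\<lambda>v. v < i) f + count_if (\<lambda>v. i < v) f"
      using count_if_lt_eq_gt [of f i] by (simp add: count_list_count_if)
    then show ?thesis
      using last assms(4) by (simp add: glue_absent inversions_append inversions_map_block inversions_map_shift *
          cut_inversions_def) argo
  next
    case (cut p qs)
    have sub: "set (drop p g) \<subseteq> {1..s}" "set (take (Suc p) g) \<subseteq> {1..s}"
      using Cons.prems(3) set_drop_subset set_take_subset by fastforce+
    \<comment> \<open>The composed word is the first piece followed by a word composed from the rest of
        \<open>f\<close> and the part of \<open>g\<close> behind the cut; the letter at the cut belongs to both. The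
        equations split every count accordingly.\<close>
    note IH = Cons.IH [OF cut(2,7) sub(1)]
    let ?f' = "glue i s f (drop p g) (map (\<lambda>q. q - p) qs)"
    have E1: "inversions (glue i s (v # f) g ps) = inversions (take (Suc p) g) + inversions ?f'
        + Suc p * count_if (\<lambda>v. v < i) f + cross (take (Suc p) g) (drop p g) +
        (\<Sum>q\<leftarrow>qs. count_if (\<lambda>x. g ! q < x) (take (Suc p) g))"
    proof -
      have sumq: "(\<Sum>q\<leftarrow>map (\<lambda>q. q - p) qs. count_if (\<lambda>x. drop p g ! q < x) (take (Suc p) g)) =
          (\<Sum>q\<leftarrow>qs. count_if (\<lambda>x. g ! q < x) (take (Suc p) g))"
        unfolding map_map comp_def by (intro arg_cong [where f = sum_list] map_cong refl) (use cut in simp)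
      show ?thesis
        using cut(1,3,4) cross_map_glue [OF cut(2,7) sub(2) assms(4)]
        unfolding sumq by (simp add: inversions_append inversions_map_block)
    qed
    have E2: "inversions g = inversions (take p g) + inversions (drop p g) + cross (take p g) (drop p g)"
      by (metis append_take_drop_id inversions_append)
    have E3: "inversions (take (Suc p) g) = inversions (take p g) + count_if (\<lambda>x. g ! p < x) (take p g)"
    proof -
      have "cross xs [y] = count_if (\<lambda>x. y < x) xs" for xs y by (induction xs) auto
      then show ?thesis using cut(4) by (simp add: take_Suc_conv_app_nth inversions_append)
    qed
    have E4: "cross (take (Suc p) g) (drop p g) = cross (take p g) (drop p g) + count_if (\<lambda>y. y < g ! p) (drop p g)"
      by (rule cross_take_Suc [OF cut(4)])
    have E5: "(\<Sum>q\<leftarrow>qs. count_if (\<lambda>x. g ! q < x) (take (Suc p) g)) =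
        (\<Sum>q\<leftarrow>qs. count_if (\<lambda>x. g ! q < x) (take p g)) + count_if (\<lambda>q. g ! q < g ! p) qs"
      using cut(4) by (induction qs) (auto simp: take_Suc_conv_app_nth)
    have E6: "count_if (\<lambda>x. x < g ! p) g = count_if (\<lambda>x. x < g ! p) (take p g) + count_if (\<lambda>x. x < g ! p) (drop p g)"
      by (metis append_take_drop_id filter_append length_append)
    have E7: "p = count_if (\<lambda>x. x < g ! p) (take p g) + count_list (take p g) (g ! p) + count_if (\<lambda>x. g ! p < x) (take p g)"
      using count_if_lt_eq_gt [of "take p g" "g ! p"] cut(4) by (simp add: count_list_count_if)
    have E8: "length f = count_if (\<lambda>v. v < i) f + Suc (length qs) + count_if (\<lambda>v. i < v) f"
      using count_if_lt_eq_gt [of f i] Suc_count_list_minus_1 [OF cut(2)] cut(8) by (simp add: count_list_count_if [symmetric])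
    note E9 = cut_inversions_Cons [OF cut(4-6)]
    have E10: "length g = p + length (drop p g)" using cut(4) by simp
    have S: "step_exponent i (v # f) (length g) ps = p * length f + step_exponent i f (length (drop p g)) (map (\<lambda>q. q - p) qs)"
      "inversions (v # f) = count_if (\<lambda>v. v < i) f + inversions f"
      "count_if (\<lambda>w. i < w) (v # f) = count_if (\<lambda>w. i < w) f"
      using cut by auto
    have E9': "cut_inversions g ps = cut_inversions g (p # qs)" using cut by simp
    show ?thesis
      unfolding S E9'
      by (rule glue_parity_step [OF IH E1 E3 E4 E5 E2 E6 E7 E8 E9 E10 refl refl])
  qed
qed simp

section \<open>Orientations and composition\<close>

lemma prepend_sum: "prepend x (sum F I) = (\<Sum>i\<in>I. prepend x (F i))"
  by (induction I rule: infinite_finite_induct) auto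

lemma frag_extend_sum': "frag_extend G (sum F I) = (\<Sum>i\<in>I. frag_extend G (F i))"
  by (induction I rule: infinite_finite_induct) (auto simp: frag_extend_add)

text \<open>
  As long as a marker is left, \<open>g\<close> may be left behind any of its letters. The position of that
  letter is the first cut.
\<close>

lemma ins_at_sum:
  assumes "z \<in> set f"
  shows "ins_at z \<alpha> \<beta> f g = (\<Sum>p<length g. frag_cmul ((-1) ^ (p * length f))
    (frag_extend (\<lambda>w. frag_of (map \<beta> (take (Suc p) g) @ w)) (ins z \<alpha> \<beta> f (drop p g))))"
proof (induction g)
  case Nil
  then show ?case using assms by (simp add: keep_def)
next
  case (Cons x g)
  show ?case
    unfolding ins_at_simps Cons length_Cons sum.lessThan_Suc_shift
    by (simp add: prepend_sum frag_cmul_sum prepend_extend power_add flip: frag_expansion) (simp add: prepend_def)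
qed

lemma ins_at_absent:
  assumes "z \<notin> set f"
  shows "ins_at z \<alpha> \<beta> f g = frag_cmul ((-1) ^ ((length g + 1) * length f)) (frag_of (map \<beta> g @ map \<alpha> f))"
proof (induction g)
  case (Cons x g)
  have "ins z \<alpha> \<beta> f (x # g) = 0"
    using keys_ins [of _ z \<alpha> \<beta> f "x # g"] assms by (metis all_not_in_conv keys_eq_empty)
  then show ?case using Cons by (simp add: power_add)
qed (use assms in \<open>simp add: keep_def\<close>)

lemma ins_sum_cuts:
  assumes "i \<in> set f"
  shows "ins i (val_shift i s) (val_block i) f g = (\<Sum>ps\<in>cuts (count_list f i - 1) g.
     frag_cmul ((-1) ^ step_exponent i f (length g) ps) (frag_of (glue i s f g ps)))"
  using assms
proof (induction f arbitrary: g)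
  case (Cons v f)
  show ?case
  proof (cases "v = i")
    case False
    then show ?thesis using Cons by (simp add: prepend_sum)
  next
    case True
    show ?thesis
    proof (cases "i \<in> set f")
      case False
      then show ?thesis using True by (simp add: ins_at_absent count_list_0_iff glue_absent)
    next
      case in_f: True
      have m: "count_list (v # f) i - 1 = Suc (count_list f i - 1)"
        using Suc_count_list_minus_1 [OF in_f] True by simp
      show ?thesis
        unfolding m sum_cuts_Suc using True
        by (simp add: ins_at_sum [OF in_f] Cons.IH [OF in_f] frag_extend_sum' frag_cmul_sum frag_extend_cmul comp_def power_add)
    qed
  qed
qed simp

lemma sum_count_list: "finite A \<Longrightarrow> (\<Sum>v\<in>A. count_list g v) = count_if (\<lambda>y. y \<in> A) g"
proof (induction g)
  case (Cons x g)
  have "(\<Sum>v\<in>A. count_list (x # g) v) = (\<Sum>v\<in>A. (if v = x then 1 else 0) + count_list g v)"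
    by (rule sum.cong) auto
  then show ?case using Cons by (simp add: sum.distrib)
qed simp

text \<open>
  Every value contributes one letter more than edges.
\<close>

lemma sum_mdeg:
  assumes "finite A" "A \<subseteq> set g"
  shows "(\<Sum>v\<in>A. mdeg g v) + card A = count_if (\<lambda>y. y \<in> A) g"
proof -
  have "(\<Sum>v\<in>A. mdeg g v) + card A = (\<Sum>v\<in>A. mdeg g v + 1)" unfolding sum.distrib by simp
  also have "\<dots> = (\<Sum>v\<in>A. count_list g v)"
    using assms by (intro sum.cong) (auto simp: mdeg_def Suc_count_list_minus_1)
  finally show ?thesis using sum_count_list assms by metis
qed

lemma sum_mdeg_less:
  assumes "set g = {1..s}" "1 \<le> x" "x \<le> s"
  shows "(\<Sum>v = 1..<x. mdeg g v) + (x - 1) = count_if (\<lambda>y. y < x) g"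
proof -
  have eq: "count_if (\<lambda>y. y \<in> {1..<x}) g = count_if (\<lambda>y. y < x) g"
    by (rule arg_cong [where f = length], rule filter_cong [OF refl]) (simp add: assms)
  have sub: "{1..<x} \<subseteq> set g" unfolding assms(1) using assms(2,3) by auto
  show ?thesis
    using sum_mdeg [OF finite_atLeastLessThan sub] unfolding eq card_atLeastLessThan .
qed

lemma sum_mdeg_greater:
  assumes "set f = {1..r}"
  shows "(\<Sum>v = i + 1..r. mdeg f v) + (r - i) = count_if (\<lambda>y. i < y) f"
proof -
  have eq: "count_if (\<lambda>y. y \<in> {i + 1..r}) f = count_if (\<lambda>y. i < y) f"
    by (rule arg_cong [where f = length], rule filter_cong [OF refl]) (auto simp add: assms)
  have sub: "{i + 1..r} \<subseteq> set f" unfolding assms(1) by auto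
  show ?thesis
    using sum_mdeg [OF finite_atLeastAtMost sub] unfolding eq card_atLeastAtMost by simp
qed

lemma sum_mdeg_all:
  assumes "set g = {1..s}"
  shows "(\<Sum>v = 1..s. mdeg g v) + s = length g"
proof -
  have eq: "count_if (\<lambda>y. y \<in> {1..s}) g = length g" unfolding assms [symmetric] by (simp add: filter_id_conv)
  have sub: "{1..s} \<subseteq> set g" unfolding assms(1) by auto
  show ?thesis
    using sum_mdeg [OF finite_atLeastAtMost sub] unfolding eq card_atLeastAtMost by simp
qed

text \<open>
  This sign compares the orientation of a sequence by the edges of its simplices, which are
  ordered by value, with that by its letters in the order of writing. Sorting the letters by
  value costs the inversions. In the sorted word one letter is split off for each value; moving
  the \<open>v - 1\<close> letters split off for smaller values past the edges of value \<open>v\<close> costs \<open>v - 1\<close> for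
  each such edge. The second summand has the same parity up to a constant that depends only on
  the number of values, since the number of letters with value \<open>v\<close> exceeds that of the edges by
  one.
\<close>

definition orient :: "nat list \<Rightarrow> int" where
  "orient w = (-1) ^ (inversions w + (\<Sum>x\<leftarrow>w. x + 1))"

lemma neg_one_power_eqI: "even (a + b) \<Longrightarrow> (-1 :: int) ^ a = (-1) ^ b"
  by (simp add: minus_one_power_iff)

lemma sum_glue:
  assumes "i \<in> set f" "ps \<in> cuts (count_list f i - 1) g" "i \<ge> 1"
  shows "(\<Sum>x\<leftarrow>glue i s f g ps. x + 1) + count_list f i * (i + 1) + count_if (\<lambda>v. i < v) f =
    (\<Sum>x\<leftarrow>f. x + 1) + s * count_if (\<lambda>v. i < v) f + (\<Sum>x\<leftarrow>g. x + i) + (\<Sum>p\<leftarrow>ps. g ! p + i)"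
  using assms(1,2)
proof (induction f arbitrary: g ps)
  case (Cons v f)
  have block: "(\<Sum>x\<leftarrow>map (val_block i) h. x + 1) = (\<Sum>x\<leftarrow>h. x + i)" for h
    using assms(3) by (induction h) (auto simp: val_block_def)
  from Cons.prems show ?case
  proof (cases rule: cuts_cases)
    case other
    then have "val_shift i s v + 1 + (if i < v then 1 else 0) = v + 1 + (if i < v then s else 0)"
      by (auto simp: val_shift_def)
    then show ?thesis using Cons.IH [OF other(2,3)] other by (auto split: if_splits)
  next
    case last
    have shift: "i \<notin> set h \<Longrightarrow> (\<Sum>x\<leftarrow>map (val_shift i s) h. x + 1) + count_if (\<lambda>v. i < v) h = (\<Sum>x\<leftarrow>h. x + 1) + s * count_if (\<lambda>v. i < v) h" for h
      using assms(3) by (induction h) (auto simp: val_shift_def)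
    have "count_list f i = 0" using last by (simp add: count_list_0_iff)
    then show ?thesis using last block [of g] shift [of f] by (simp add: glue_absent)
  next
    case (cut p qs)
    have "(\<Sum>q\<leftarrow>map (\<lambda>q. q - p) qs. drop p g ! q + i) = (\<Sum>q\<leftarrow>qs. g ! q + i)"
      unfolding map_map comp_def using cut(4,5) by (intro arg_cong [where f = sum_list] map_cong) auto
    moreover have "(\<Sum>x\<leftarrow>take (Suc p) g. x + i) = (\<Sum>x\<leftarrow>take p g. x + i) + (g ! p + i)"
      using cut(4) by (simp add: take_Suc_conv_app_nth)
    moreover have "(\<Sum>x\<leftarrow>g. x + i) = (\<Sum>x\<leftarrow>take p g. x + i) + (\<Sum>x\<leftarrow>drop p g. x + i)"
      by (metis append_take_drop_id map_append sum_list_append)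
    ultimately show ?thesis
      using Cons.IH [OF cut(2,7)] cut(1-4) block [of "take (Suc p) g"] by simp
  qed
qed simp

text \<open>
  The exponent of the sign of an operadic suspension: the degree of the second word, which has
  length \<open>n\<close>, passes \<open>r - 1\<close> shifts, and \<open>s - 1\<close> shifts pass those of the \<open>i - 1\<close> inputs in
  front of \<open>i\<close>. Sums are used instead of differences, with the same parity.
\<close>

definition suspension :: "nat \<Rightarrow> nat \<Rightarrow> nat \<Rightarrow> nat \<Rightarrow> nat" where
  "suspension r i s n = (n + s) * (r + 1) + (s + 1) * (i + 1)"

text \<open>
  The arithmetic of \<open>orient_glue\<close>, with all counts replaced by variables.
\<close>

lemma orient_parity:
  fixes iglue :: nat
  assumes "even (iglue + step + i_f + (n + 1) * N + ig + ci)"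
    and "sglue + (m + 1) * (i + 1) + N = sf + s * N + (X + n * i) + (P + m * i)"
    and "cx + P = ci + m + M * D" "N = M + ri" "n = D + s" "r = i + ri" "sg = X + n"
  shows "even (cx + i_f + sf + (ig + sg) + ((n + s) * (r + 1) + (s + 1) * (i + 1) + step + (iglue + sglue)))"
proof -
  define th where "th = (n + s) * (r + 1) + (s + 1) * (i + 1)"
  let ?T = "cx + i_f + sf + (ig + sg) + (th + step + (iglue + sglue))"
  let ?T1 = "iglue + step + i_f + (n + 1) * N + ig + ci"
  let ?B = "n * N + (i + 1) + s * N + n * (i + 1) + M * D + th"
  have 1: "?T + 2 * (n * N + N + (i + 1)) = ?T1 + ?B + 2 * (sf + X)"
    using assms(2,3,7) unfolding distrib_left distrib_right mult_1 mult_1_right by linarith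
  have "?B = 2 * (D * M + D * ri + s * (M + ri) + D * (i + 1) + (s + 1) * (i + 1) + s * (i + ri + 1))"
    unfolding assms(4-6) th_def distrib_left distrib_right mult_1 mult_1_right by (simp add: mult.commute)
  then have 2: "even ?B" by (simp only: dvd_triv_left)
  have "even (?T + 2 * (n * N + N + (i + 1)))"
    unfolding 1 by (rule dvd_add [OF dvd_add [OF assms(1) 2] dvd_triv_left])
  then show ?thesis unfolding th_def by (simp only: dvd_add_left_iff [OF dvd_triv_left])
qed
text \<open>
  The three kinds of terms in \<open>cut_exponent\<close> correspond to terms of \<open>inversions_glue\<close>, with
  edges in place of letters. What is left over after replacing one by the other depends on
  lengths and arities only, and this is the suspension sign.
\<close>

lemma orient_glue:
  assumes f: "set f = {1..r}" and g: "set g = {1..s}" and i: "i \<in> {1..r}" and ps: "ps \<in> cuts (mdeg f i) g"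
  shows "(-1) ^ cut_exponent r i s f g ps * orient f * orient g =
    (-1) ^ suspension r i s (length g) * (-1) ^ step_exponent i f (length g) ps * orient (glue i s f g ps)"
proof -
  have i_f: "i \<in> set f" and ps': "ps \<in> cuts (count_list f i - 1) g" and i1: "i \<ge> 1"
    using f i ps by (auto simp: mdeg_def)
  have m: "count_list f i = length ps + 1"
    using ps' Suc_count_list_minus_1 [OF i_f] by (simp add: cuts_def)
  let ?N = "count_if (\<lambda>v. i < v) f" and ?P = "\<Sum>p\<leftarrow>ps. g ! p"
  let ?M = "\<Sum>v = i + 1..r. mdeg f v" and ?D = "\<Sum>v = 1..s. mdeg g v"
  have "(\<Sum>p\<leftarrow>ps. (\<Sum>v = 1..<g ! p. mdeg g v) + count_list (take p g) (g ! p)) + ?P =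
     (\<Sum>p\<leftarrow>ps. count_if (\<lambda>x. x < g ! p) g + count_list (take p g) (g ! p)) + length ps"
  proof -
    have "\<forall>p\<in>set ps. p < length g" using ps by (auto simp: cuts_def)
    then show ?thesis
    proof (induction ps)
      case (Cons p ps)
      then have "g ! p \<in> {1..s}" using g nth_mem by auto
      then have b: "1 \<le> g ! p" "g ! p \<le> s" by simp_all
      have "(\<Sum>v = 1..<g ! p. mdeg g v) + g ! p = count_if (\<lambda>y. y < g ! p) g + 1"
        using sum_mdeg_less [OF g b] b by linarith
      then show ?case using Cons by simp
    qed simp
  qed
  note less = this
  have "cut_exponent r i s f g ps + ?P = cut_inversions g ps + length ps + ?M * ?D"
  proof -
    have "{(a, b). a < b \<and> b < length ps \<and> g ! (ps ! a) > g ! (ps ! b)} =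
        {(a, b). a < b \<and> b < length (map ((!) g) ps) \<and> map ((!) g) ps ! a > map ((!) g) ps ! b}"
      by auto
    then show ?thesis
      using less by (simp add: cut_exponent_def cut_inversions_def inversions_card)
  qed
  moreover have "(\<Sum>x\<leftarrow>g. x + i) = (\<Sum>x\<leftarrow>g. x) + length g * i" "(\<Sum>p\<leftarrow>ps. g ! p + i) = ?P + length ps * i"
    "(\<Sum>x\<leftarrow>g. x + 1) = (\<Sum>x\<leftarrow>g. x) + length g"
    by (simp_all only: sum_list_addf sum_list_count_if_const mult.commute mult_1)
  moreover have "?N = ?M + (r - i)" "length g = ?D + s" "r = i + (r - i)"
    using sum_mdeg_greater [OF f] sum_mdeg_all [OF g] i by auto
  moreover note inversions_glue [OF i_f ps' _ i1, of s] sum_glue [OF i_f ps' i1, of s]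
  ultimately have "even (cut_exponent r i s f g ps + inversions f + (\<Sum>x\<leftarrow>f. x + 1) + (inversions g + (\<Sum>x\<leftarrow>g. x + 1)) +
     ((length g + s) * (r + 1) + (s + 1) * (i + 1) + step_exponent i f (length g) ps +
        (inversions (glue i s f g ps) + (\<Sum>x\<leftarrow>glue i s f g ps. x + 1))))"
    using g unfolding m by (intro orient_parity) simp_all
  then show ?thesis
    unfolding orient_def suspension_def power_add [symmetric]
    by (intro neg_one_power_eqI) (simp only: add.assoc)
qed

text \<open>
  The generator that corresponds to the product of the letters of \<open>w\<close>, each of degree one.
\<close>

definition oriented :: "nat \<Rightarrow> nat list \<Rightarrow> (nat list \<Rightarrow>\<^sub>0 int)" where
  "oriented r w = frag_cmul (orient w) (seq_class r w)"

lemma oriented_degenerate: "\<not> nondegenerate r w \<Longrightarrow> oriented r w = 0"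
  by (simp add: oriented_def seq_class_def)

lemma orient_orient [simp]: "orient w * orient w = 1"
  by (simp add: orient_def flip: power_add mult_2)

lemma frag_of_eq_oriented: "nondegenerate r w \<Longrightarrow> frag_of w = frag_cmul (orient w) (oriented r w)"
  by (simp add: oriented_def seq_class_def)

abbreviation ins_val :: "nat \<Rightarrow> nat \<Rightarrow> nat list \<Rightarrow> nat list \<Rightarrow> (nat list \<Rightarrow>\<^sub>0 int)" where
  "ins_val i s \<equiv> ins i (val_shift i s) (val_block i)"

lemma range_val:
  assumes "i \<in> {1..r}"
  shows "val_shift i s ` ({1..r} - {i}) \<union> val_block i ` {1..s} = {1..r + s - 1}"
proof (intro subset_antisym subsetI)
  fix x assume "x \<in> val_shift i s ` ({1..r} - {i}) \<union> val_block i ` {1..s}"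
  then show "x \<in> {1..r + s - 1}" using assms by (auto simp: val_shift_def val_block_def)
next
  fix x assume x: "x \<in> {1..r + s - 1}"
  consider "x < i" | "i \<le> x" "x < i + s" | "i + s \<le> x" by linarith
  then show "x \<in> val_shift i s ` ({1..r} - {i}) \<union> val_block i ` {1..s}"
  proof cases
    case 1
    then have "x = val_shift i s x" "x \<in> {1..r} - {i}" using x assms by (auto simp: val_shift_def)
    then show ?thesis by blast
  next
    case 2
    then have "x = val_block i (x + 1 - i)" "x + 1 - i \<in> {1..s}" using assms by (auto simp: val_block_def)
    then show ?thesis by blast
  next
    case 3
    then have "x = val_shift i s (x + 1 - s)" "x + 1 - s \<in> {1..r} - {i}" using x assms by (auto simp: val_shift_def)
    then show ?thesis by blast
  qed
qed

lemma val_inj: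
  assumes "i \<ge> 1"
  shows "inj_on (val_shift i s) (- {i})" "inj (val_block i)"
    "v \<noteq> i \<Longrightarrow> x \<in> {1..s} \<Longrightarrow> val_shift i s v \<noteq> val_block i x"
proof -
  show "inj_on (val_shift i s) (- {i})"
    using assms by (auto simp: inj_on_def val_shift_def split: if_splits)
  show "inj (val_block i)" by (auto simp: inj_on_def val_block_def)
  show "v \<noteq> i \<Longrightarrow> x \<in> {1..s} \<Longrightarrow> val_shift i s v \<noteq> val_block i x"
    using assms by (auto simp: val_shift_def val_block_def)
qed

text \<open>
  Besides repetitions this concerns values that do not occur: they are renamed injectively, so
  they do not occur in the composed word either.
\<close>

lemma ins_val_degenerate:
  assumes u: "u \<in> supp (ins_val i s f g)" and i: "i \<in> {1..r}"
    and f: "set f \<subseteq> {1..r}" and g: "set g \<subseteq> {1..s}"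
    and deg: "\<not> nondegenerate r f \<or> \<not> nondegenerate s g"
  shows "\<not> nondegenerate (r + s - 1) u"
proof
  assume nd: "nondegenerate (r + s - 1) u"
  then have adj: "distinct_adj f" "distinct_adj g"
    using ins_degenerate_left [OF _ u] ins_degenerate_right [OF _ u] unfolding nondegenerate_def by auto
  have k: "i \<in> set f" "set u = val_shift i s ` (set f - {i}) \<union> val_block i ` set g"
    using keys_ins [OF u] by auto
  have eq: "val_shift i s ` (set f - {i}) \<union> val_block i ` set g =
      val_shift i s ` ({1..r} - {i}) \<union> val_block i ` {1..s}"
    using nd k range_val [OF i, of s] by (simp add: nondegenerate_def)
  have i1: "i \<ge> 1" using i by simp
  note inj = val_inj(1) [OF i1, of s] val_inj(2) [OF i1] val_inj(3) [OF i1, where s = s]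
  have "v \<in> set f" if "v \<in> {1..r}" for v
  proof (cases "v = i")
    case False
    then have "val_shift i s v \<in> val_shift i s ` (set f - {i}) \<union> val_block i ` set g"
      unfolding eq using that by auto
    then show ?thesis
    proof
      assume "val_shift i s v \<in> val_shift i s ` (set f - {i})"
      then obtain v' where "v' \<in> set f" "v' \<noteq> i" "val_shift i s v = val_shift i s v'" by blast
      then show ?thesis using inj_onD [OF inj(1), of v v'] False by simp
    next
      assume "val_shift i s v \<in> val_block i ` set g"
      then show ?thesis using inj(3) [OF False] g by blast
    qed
  qed (use k in simp)
  moreover have "x \<in> set g" if "x \<in> {1..s}" for x
  proof -
    have "val_block i x \<in> val_shift i s ` (set f - {i}) \<union> val_block i ` set g"
      unfolding eq using that by auto
    then show ?thesis
    proof
      assume "val_block i x \<in> val_shift i s ` (set f - {i})"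
      then obtain v where "v \<noteq> i" "val_block i x = val_shift i s v" by blast
      then show ?thesis using inj(3) [of v x] that by simp
    next
      assume "val_block i x \<in> val_block i ` set g"
      then show ?thesis using inj_image_mem_iff [OF inj(2)] by blast
    qed
  qed
  ultimately show False
    using deg adj f g unfolding nondegenerate_def by blast
qed

text \<open>
  The words on the right need not be nondegenerate and neither need \<open>f\<close> and \<open>g\<close>, so that this
  equation can be iterated and extended linearly.
\<close>

lemma pcomp_oriented:
  assumes i: "i \<in> {1..r}" and f: "set f \<subseteq> {1..r}" and g: "set g \<subseteq> {1..s}"
  shows "surj_pcomp r i s (oriented r f) (oriented s g) =
    frag_cmul ((-1) ^ suspension r i s (length g)) (frag_extend (oriented (r + s - 1)) (ins_val i s f g))"
proof (cases "nondegenerate r f \<and> nondegenerate s g")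
  case False
  then have "frag_extend (oriented (r + s - 1)) (ins_val i s f g) = 0"
    using ins_val_degenerate [OF _ i f g] by (intro frag_extend_eq_0 oriented_degenerate) blast
  moreover have "surj_pcomp r i s (oriented r f) (oriented s g) = 0"
    using False by (auto simp: surj_pcomp_def oriented_degenerate frag_extend_fun_0)
  ultimately show ?thesis by simp
next
  case True
  then have sets: "set f = {1..r}" "set g = {1..s}" by (auto simp: nondegenerate_def)
  then have i_f: "i \<in> set f" using i by simp
  have "surj_pcomp r i s (oriented r f) (oriented s g) = (\<Sum>ps\<in>cuts (mdeg f i) g.
     frag_cmul ((-1) ^ cut_exponent r i s f g ps * orient f * orient g)
       (seq_class (r + s - 1) (glue i s f g ps)))"
    using True substitute_pieces [OF i_f]
    by (simp add: surj_pcomp_def oriented_def seq_class_def [of r f] seq_class_def [of s g] frag_extend_cmul frag_extend_fun_cmul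
        frag_cmul_sum mdeg_def mult.commute mult.left_commute)
  also have "\<dots> = (\<Sum>ps\<in>cuts (mdeg f i) g.
     frag_cmul ((-1) ^ suspension r i s (length g))
       (frag_extend (oriented (r + s - 1)) (frag_cmul ((-1) ^ step_exponent i f (length g) ps) (frag_of (glue i s f g ps)))))"
  proof (rule sum.cong [OF refl])
    fix ps assume ps: "ps \<in> cuts (mdeg f i) g"
    show "frag_cmul ((-1) ^ cut_exponent r i s f g ps * orient f * orient g) (seq_class (r + s - 1) (glue i s f g ps)) =
       frag_cmul ((-1) ^ suspension r i s (length g))
       (frag_extend (oriented (r + s - 1)) (frag_cmul ((-1) ^ step_exponent i f (length g) ps) (frag_of (glue i s f g ps))))"
      unfolding orient_glue [OF sets i ps]
      by (simp only: frag_extend_cmul frag_extend_of oriented_def frag_cmul_cmul mult.assoc)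
  qed
  also have "\<dots> = frag_cmul ((-1) ^ suspension r i s (length g)) (frag_extend (oriented (r + s - 1)) (ins_val i s f g))"
    unfolding ins_sum_cuts [OF i_f] frag_extend_sum' frag_cmul_sum mdeg_def ..
  finally show ?thesis .
qed

section \<open>Boundary and symmetric action on oriented words\<close>

definition remove_nth :: "nat \<Rightarrow> 'a list \<Rightarrow> 'a list" where
  "remove_nth p w = take p w @ drop (Suc p) w"

lemma word_bdry_sum: "word_bdry w = (\<Sum>p<length w. frag_cmul ((-1) ^ p) (frag_of (remove_nth p w)))"
proof (induction w)
  case (Cons x w)
  show ?case
    unfolding word_bdry.simps Cons prepend_sum length_Cons sum.lessThan_Suc_shift
    by (simp add: remove_nth_def sum_negf frag_cmul_uminus flip: minus_frag_cmul)
qed simp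

text \<open>
  The \<open>j\<close>-th element with the property \<open>P\<close> is reindexed by its position, and \<open>j\<close> becomes the
  number of earlier elements with this property.
\<close>

lemma sum_filter_upt:
  "(\<Sum>j<length (filter P [0..<n]). G j (filter P [0..<n] ! j)) = (\<Sum>p | p < n \<and> P p. G (card {q. q < p \<and> P q}) p)"
proof (induction n)
  case (Suc n)
  have eq: "{p. p < Suc n \<and> P p} = (if P n then insert n {p. p < n \<and> P p} else {p. p < n \<and> P p})"
    by (auto simp: less_Suc_eq)
  have len: "length (filter P [0..<n]) = card {q. q < n \<and> P q}"
    by (subst length_filter_conv_card) (rule arg_cong [where f = card], auto)
  have "(\<Sum>j<length (filter P [0..<n]). G j ((filter P [0..<n] @ [n]) ! j)) = (\<Sum>j<length (filter P [0..<n]). G j (filter P [0..<n] ! j))"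
    by (rule sum.cong) (auto simp: nth_append)
  moreover have "(filter P [0..<n] @ [n]) ! card {q. q < n \<and> P q} = n"
    unfolding len [symmetric] by simp
  ultimately show ?case
    using Suc unfolding eq by (simp add: len add.commute)
qed simp

lemma count_list_take: "p \<le> length w \<Longrightarrow> count_list (take p w) x = card {q. q < p \<and> w ! q = x}"
  by (simp add: count_list_count_if length_filter_conv_card) (rule arg_cong [where f = card], auto)

lemma sum_occurrences:
  assumes "set w = {1..r}"
  shows "(\<Sum>i = 1..r. \<Sum>j = 0..mdeg w i. G i j (occurrences w i ! j)) =
    (\<Sum>p<length w. G (w ! p) (count_list (take p w) (w ! p)) p)"
proof -
  have "(\<Sum>j = 0..mdeg w i. G i j (occurrences w i ! j)) =
      (\<Sum>p | p \<in> {..<length w} \<and> w ! p = i. G (w ! p) (count_list (take p w) (w ! p)) p)" if "i \<in> {1..r}" for i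
  proof -
    have "i \<in> set w" using that assms by simp
    moreover have "length (occurrences w i) = count_list w i"
      by (simp add: occurrences_def length_filter_conv_card count_list_count_if cong: conj_cong)
    ultimately have "{0..mdeg w i} = {..<length (occurrences w i)}"
      using Suc_count_list_minus_1 [of i w] by (auto simp: mdeg_def)
    then have "(\<Sum>j = 0..mdeg w i. G i j (occurrences w i ! j)) =
      (\<Sum>p | p < length w \<and> w ! p = i. G i (card {q. q < p \<and> w ! q = i}) p)"
      using sum_filter_upt [where P = "\<lambda>p. w ! p = i" and n = "length w" and G = "G i"] by (simp add: occurrences_def)
    also have "\<dots> = (\<Sum>p | p \<in> {..<length w} \<and> w ! p = i. G (w ! p) (count_list (take p w) (w ! p)) p)"
      by (rule sum.cong) (auto simp: count_list_take)
    finally show ?thesis .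
  qed
  then have "(\<Sum>i = 1..r. \<Sum>j = 0..mdeg w i. G i j (occurrences w i ! j)) =
     (\<Sum>i = 1..r. \<Sum>p | p \<in> {..<length w} \<and> w ! p = i. G (w ! p) (count_list (take p w) (w ! p)) p)"
    by (rule sum.cong [OF refl])
  also have "\<dots> = (\<Sum>p<length w. G (w ! p) (count_list (take p w) (w ! p)) p)"
    by (rule sum.group) (use assms nth_mem in auto)
  finally show ?thesis .
qed

text \<open>
  The exponent of the boundary in terms of simplices counts the edges of smaller values and the
  earlier letters of the same value; that in terms of words counts the letters in front. The
  difference is the change of the exponent of \<open>orient\<close> when the letter is removed.
\<close>

lemma orient_remove_nth:
  assumes w: "set w = {1..r}" and p: "p < length w"
  shows "(-1) ^ ((\<Sum>v = 1..<w ! p. mdeg w v) + count_list (take p w) (w ! p)) * orient w =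
    (-1) ^ p * orient (remove_nth p w)"
proof -
  let ?x = "w ! p" and ?u = "take p w" and ?v = "drop (Suc p) w"
  have w_eq: "w = ?u @ ?x # ?v" using p by (rule id_take_nth_drop)
  have x: "1 \<le> ?x" "?x \<le> r" using w nth_mem [OF p] by auto
  have split: "count_if P w = count_if P ?u + (if P ?x then 1 else 0) + count_if P ?v" for P
    by (subst w_eq) (simp del: append_take_drop_id)
  have "cross xs (y # ys) = cross xs ys + count_if (\<lambda>x. y < x) xs" for xs y ys by (induction xs) auto
  then have "inversions (?u @ ?x # ?v) = inversions (remove_nth p w) + count_if (\<lambda>y. ?x < y) ?u + count_if (\<lambda>y. y < ?x) ?v"
    by (simp add: remove_nth_def inversions_append)
  then have 1: "inversions w = inversions (remove_nth p w) + count_if (\<lambda>y. ?x < y) ?u + count_if (\<lambda>y. y < ?x) ?v"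
    using w_eq by simp
  have "(\<Sum>x\<leftarrow>?u @ ?x # ?v. x + 1) = (\<Sum>x\<leftarrow>remove_nth p w. x + 1) + (?x + 1)"
    by (simp add: remove_nth_def)
  then have 2: "(\<Sum>x\<leftarrow>w. x + 1) = (\<Sum>x\<leftarrow>remove_nth p w. x + 1) + (?x + 1)"
    using w_eq by simp
  have 3: "p = count_if (\<lambda>y. y < ?x) ?u + count_list ?u ?x + count_if (\<lambda>y. ?x < y) ?u"
    using count_if_lt_eq_gt [of ?u ?x] p by (simp add: count_list_count_if)
  have 4: "(\<Sum>v = 1..<?x. mdeg w v) + ?x = count_if (\<lambda>y. y < ?x) ?u + count_if (\<lambda>y. y < ?x) ?v + 1"
    using sum_mdeg_less [OF w x] x split [of "\<lambda>y. y < ?x"] by simp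
  have "((\<Sum>v = 1..<?x. mdeg w v) + count_list ?u ?x + (inversions w + (\<Sum>x\<leftarrow>w. x + 1))) +
     (p + (inversions (remove_nth p w) + (\<Sum>x\<leftarrow>remove_nth p w. x + 1))) =
     2 * (inversions (remove_nth p w) + (\<Sum>x\<leftarrow>remove_nth p w. x + 1) + p + count_if (\<lambda>y. y < ?x) ?v + 1)"
  proof -
    have "S + ct + (iw + sw) + (p + (ir + sr)) = 2 * (ir + sr + p + V + 1)"
      if "iw = ir + Gt + V" "sw = sr + (x + 1)" "p = A + ct + Gt" "S + x = A + V + 1"
      for S ct iw sw p ir sr V Gt x A :: nat
      using that by presburger
    from this [OF 1 2 3 4] show ?thesis .
  qed
  then have "even (((\<Sum>v = 1..<?x. mdeg w v) + count_list ?u ?x + (inversions w + (\<Sum>x\<leftarrow>w. x + 1))) +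
     (p + (inversions (remove_nth p w) + (\<Sum>x\<leftarrow>remove_nth p w. x + 1))))"
    by (simp only: dvd_triv_left)
  then show ?thesis
    unfolding orient_def power_add [symmetric] by (rule neg_one_power_eqI)
qed

lemma not_distinct_adjE:
  assumes "\<not> distinct_adj w"
  obtains u x v where "w = u @ x # x # v"
  using assms
proof (induction w arbitrary: thesis)
  case (Cons y w)
  from Cons.prems(2) show ?case
  proof (cases rule: not_distinct_adj_ConsE)
    case 1
    then obtain u x v where "w = u @ x # x # v" using Cons.IH by metis
    then show ?thesis using Cons.prems(1) [of "y # u"] by simp
  next
    case (2 w')
    then show ?thesis using Cons.prems(1) [of "[]"] by simp
  qed
qed simp

lemma word_bdry_not_nondegenerate:
  assumes w: "set w \<subseteq> {1..r}" and deg: "\<not> nondegenerate r w" and u: "u \<in> supp (word_bdry w)"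
  shows "\<not> nondegenerate r u"
proof (cases "distinct_adj w")
  case True
  then have "set w \<noteq> {1..r}" using deg by (simp add: nondegenerate_def)
  then show ?thesis using w keys_word_bdry [OF u] by (auto simp: nondegenerate_def)
next
  case False
  then obtain a x b where "w = a @ x # x # b" by (rule not_distinct_adjE)
  from word_bdry_degenerate [OF this u] show ?thesis by (simp add: nondegenerate_def)
qed

lemma bdry_oriented:
  assumes w: "set w \<subseteq> {1..r}"
  shows "surj_bdry r (oriented r w) = frag_extend (oriented r) (word_bdry w)"
proof (cases "nondegenerate r w")
  case False
  then have "frag_extend (oriented r) (word_bdry w) = 0"
    using word_bdry_not_nondegenerate [OF w] by (intro frag_extend_eq_0 oriented_degenerate)
  then show ?thesis using False by (simp add: oriented_degenerate surj_bdry_def)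
next
  case True
  then have w': "set w = {1..r}" by (simp add: nondegenerate_def)
  have "surj_bdry r (oriented r w) = frag_cmul (orient w) (\<Sum>p<length w.
      frag_cmul ((-1) ^ ((\<Sum>v = 1..<w ! p. mdeg w v) + count_list (take p w) (w ! p))) (seq_class r (remove_nth p w)))"
    using True sum_occurrences [OF w', of "\<lambda>i j p. frag_cmul ((-1) ^ ((\<Sum>v = 1..<i. mdeg w v) + j)) (seq_class r (remove_nth p w))"]
    by (simp add: surj_bdry_def oriented_def seq_class_def [of r w] frag_extend_cmul remove_nth_def Let_def)
  also have "\<dots> = (\<Sum>p<length w. frag_extend (oriented r) (frag_cmul ((-1) ^ p) (frag_of (remove_nth p w))))"
    unfolding frag_cmul_sum frag_cmul_cmul
  proof (rule sum.cong [OF refl])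
    fix p assume "p \<in> {..<length w}"
    then have p: "p < length w" by simp
    show "frag_cmul (orient w * (-1) ^ ((\<Sum>v = 1..<w ! p. mdeg w v) + count_list (take p w) (w ! p))) (seq_class r (remove_nth p w)) =
      frag_extend (oriented r) (frag_cmul ((-1) ^ p) (frag_of (remove_nth p w)))"
      unfolding mult.commute [of "orient w"] orient_remove_nth [OF w' p]
      by (simp only: oriented_def frag_extend_cmul frag_extend_of frag_cmul_cmul)
  qed
  also have "\<dots> = frag_extend (oriented r) (word_bdry w)"
    unfolding word_bdry_sum frag_extend_sum' ..
  finally show ?thesis .
qed

definition inverted :: "nat \<Rightarrow> (nat \<Rightarrow> nat) \<Rightarrow> (nat \<times> nat) set" where
  "inverted r \<sigma> = {(i, j). 1 \<le> i \<and> i < j \<and> j \<le> r \<and> \<sigma> i > \<sigma> j}"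

text \<open>
  The sign of \<open>\<sigma>\<close>, written through the word of its values because the parity of the inversions
  of such words is what the lemmas above compute.
\<close>

definition perm_sign :: "nat \<Rightarrow> (nat \<Rightarrow> nat) \<Rightarrow> int" where
  "perm_sign r \<sigma> = (-1) ^ inversions (map \<sigma> [1..<Suc r])"

lemma finite_inverted [simp]: "finite (inverted r \<sigma>)"
  by (rule finite_subset [of _ "{1..r} \<times> {1..r}"]) (auto simp: inverted_def)

text \<open>
  When the values are permuted, \<open>v\<close> moves from position \<open>v\<close> to position \<open>\<sigma> v\<close>. The values that
  it passes in one direction are those larger than \<open>v\<close>, and in the other direction those smaller
  than \<open>v\<close>; the difference of their numbers is \<open>\<sigma> v - v\<close>.
\<close>

lemma inverted_degree:
  assumes \<sigma>: "\<sigma> permutes {1..r}" and v: "v \<in> {1..r}"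
  shows "card {j. (v, j) \<in> inverted r \<sigma>} + v = card {i. (i, v) \<in> inverted r \<sigma>} + \<sigma> v"
proof -
  have \<sigma>v: "\<sigma> v \<in> {1..r}" using permutes_in_image [OF \<sigma>, of v] v by simp
  have inj: "inj \<sigma>" by (rule permutes_inj [OF \<sigma>])
  let ?R = "{j. (v, j) \<in> inverted r \<sigma>}" and ?L = "{i. (i, v) \<in> inverted r \<sigma>}"
  define A where "A = {j \<in> {1..r}. \<sigma> j < \<sigma> v}"
  define C where "C = {j \<in> {1..r}. j < v \<and> \<sigma> j < \<sigma> v}"
  have fin: "finite ?R" "finite ?L" "finite C"
    by (rule finite_subset [of _ "{1..r}"]; auto simp: inverted_def C_def)+
  \<comment> \<open>The set \<open>A\<close> has \<open>\<sigma> v - 1\<close> elements, and there are \<open>v - 1\<close> values below \<open>v\<close>. These two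
      sets share \<open>C\<close>, and their other elements are the ones that form an inverted pair with
      \<open>v\<close>.\<close>
  have "\<sigma> ` A = {1..<\<sigma> v}"
  proof (rule Set.set_eqI)
    fix y
    have "y \<in> {1..r} \<longleftrightarrow> (\<exists>j\<in>{1..r}. y = \<sigma> j)"
      using permutes_image [OF \<sigma>] by blast
    then show "y \<in> \<sigma> ` A \<longleftrightarrow> y \<in> {1..<\<sigma> v}"
      using \<sigma>v by (auto simp: A_def)
  qed
  moreover have "card (\<sigma> ` A) = card A"
    by (rule card_image [OF inj_on_subset [OF inj subset_UNIV]])
  ultimately have "card A = \<sigma> v - 1" by simp
  moreover have "A = ?R \<union> C"
  proof (rule Set.set_eqI)
    fix j show "j \<in> A \<longleftrightarrow> j \<in> ?R \<union> C"
      using v by (cases j v rule: linorder_cases) (auto simp: inverted_def A_def C_def)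
  qed
  moreover have "card (?R \<union> C) = card ?R + card C"
    by (rule card_Un_disjoint [OF fin(1,3)]) (auto simp: inverted_def C_def)
  ultimately have 1: "card ?R + card C = \<sigma> v - 1" by simp
  have "{1..<v} = ?L \<union> C"
  proof (rule Set.set_eqI)
    fix i
    have "\<sigma> i = \<sigma> v \<Longrightarrow> i = v" by (rule injD [OF inj])
    then show "i \<in> {1..<v} \<longleftrightarrow> i \<in> ?L \<union> C"
      using v by (cases "\<sigma> i" "\<sigma> v" rule: linorder_cases) (auto simp: inverted_def C_def)
  qed
  moreover have "card (?L \<union> C) = card ?L + card C"
    by (rule card_Un_disjoint [OF fin(2,3)]) (auto simp: inverted_def C_def)
  ultimately have "card ?L + card C = card {1..<v}" by simp
  then have "card ?L + card C = v - 1" by simp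
  moreover have "1 \<le> v" "1 \<le> \<sigma> v" using v \<sigma>v by simp_all
  ultimately show ?thesis using 1 by linarith
qed

lemma sum_inverted_count_if:
  "(\<Sum>(i, j)\<in>inverted r \<sigma>. (if i = v then c j else 0) + (if j = v then c i else 0)) =
    sum c {j. (v, j) \<in> inverted r \<sigma>} + sum c {i. (i, v) \<in> inverted r \<sigma>}" for c :: "nat \<Rightarrow> nat"
proof -
  have 1: "(\<Sum>(i, j)\<in>inverted r \<sigma>. (if i = v then c j else 0)) = sum c {j. (v, j) \<in> inverted r \<sigma>}"
  proof -
    have "(\<Sum>(i, j)\<in>inverted r \<sigma>. (if i = v then c j else 0)) = (\<Sum>(i, j)\<in>(\<lambda>j. (v, j)) ` {j. (v, j) \<in> inverted r \<sigma>}. c j)"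
      by (rule sum.mono_neutral_cong_right) auto
    then show ?thesis by (simp add: sum.reindex inj_on_def)
  qed
  have 2: "(\<Sum>(i, j)\<in>inverted r \<sigma>. (if j = v then c i else 0)) = sum c {i. (i, v) \<in> inverted r \<sigma>}"
  proof -
    have "(\<Sum>(i, j)\<in>inverted r \<sigma>. (if j = v then c i else 0)) = (\<Sum>(i, j)\<in>(\<lambda>i. (i, v)) ` {i. (i, v) \<in> inverted r \<sigma>}. c i)"
      by (rule sum.mono_neutral_cong_right) auto
    then show ?thesis by (simp add: sum.reindex inj_on_def)
  qed
  show ?thesis unfolding 1 [symmetric] 2 [symmetric] by (simp add: sum.distrib case_prod_unfold)
qed

text \<open>
  Renaming changes the relative order of two letters exactly if their values form a pair that is
  inverted by \<open>\<sigma>\<close>.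
\<close>

lemma inversions_map:
  assumes \<sigma>: "\<sigma> permutes {1..r}" and w: "set w \<subseteq> {1..r}"
  shows "even (inversions (map \<sigma> w) + inversions w + (\<Sum>(i, j)\<in>inverted r \<sigma>. count_list w i * count_list w j))"
  using w
proof (induction w)
  case (Cons x w)
  have inj: "inj \<sigma>" by (rule permutes_inj [OF \<sigma>])
  let ?R = "{j. (x, j) \<in> inverted r \<sigma>}" and ?L = "{i. (i, x) \<in> inverted r \<sigma>}"
  have fin: "finite ?R" "finite ?L"
    by (rule finite_subset [of _ "{1..r}"]; auto simp: inverted_def)+
  have "(\<Sum>(i, j)\<in>inverted r \<sigma>. count_list (x # w) i * count_list (x # w) j) =
     (\<Sum>(i, j)\<in>inverted r \<sigma>. count_list w i * count_list w j + ((if i = x then count_list w j else 0) + (if j = x then count_list w i else 0)))"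
    by (rule sum.cong) (auto simp: inverted_def)
  also have "\<dots> = (\<Sum>(i, j)\<in>inverted r \<sigma>. count_list w i * count_list w j) + (sum (count_list w) ?R + sum (count_list w) ?L)"
    unfolding sum_inverted_count_if [symmetric] by (simp add: sum.distrib case_prod_unfold)
  finally have 1: "(\<Sum>(i, j)\<in>inverted r \<sigma>. count_list (x # w) i * count_list (x # w) j) =
    (\<Sum>(i, j)\<in>inverted r \<sigma>. count_list w i * count_list w j) + (count_if (\<lambda>y. y \<in> ?R) w + count_if (\<lambda>y. y \<in> ?L) w)"
    by (simp only: sum_count_list fin)
  \<comment> \<open>A letter \<open>y\<close> contributes equally to both sides: it is counted by one of the last terms
      exactly if \<open>\<sigma>\<close> inverts its order relative to \<open>x\<close>.\<close>
  have 2: "count_if (\<lambda>y. \<sigma> y < \<sigma> x) w + count_if (\<lambda>y. y \<in> ?L) w = count_if (\<lambda>y. y < x) w + count_if (\<lambda>y. y \<in> ?R) w"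
    using Cons.prems
  proof (induction w)
    case (Cons y w)
    have xy: "1 \<le> x" "x \<le> r" "1 \<le> y" "y \<le> r" using Cons.prems by auto
    have "(if \<sigma> y < \<sigma> x then 1 else 0) + (if y \<in> ?L then 1 else 0) = (if y < x then 1 else 0) + (if y \<in> ?R then 1 else 0 :: nat)"
    proof (cases "y = x")
      case True
      then show ?thesis by (simp add: inverted_def)
    next
      case False
      then have "\<sigma> y < \<sigma> x \<or> \<sigma> x < \<sigma> y" using injD [OF inj, of y x] by linarith
      then show ?thesis using xy False by (simp add: inverted_def) linarith
    qed
    moreover have c: "count_if P (y # w) = (if P y then 1 else 0) + count_if P w" for P by simp
    moreover have "count_if (\<lambda>y. \<sigma> y < \<sigma> x) w + count_if (\<lambda>y. y \<in> ?L) w = count_if (\<lambda>y. y < x) w + count_if (\<lambda>y. y \<in> ?R) w"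
      by (rule Cons.IH) (use Cons.prems in auto)
    ultimately show ?case unfolding c by linarith
  qed simp
  have "inversions (map \<sigma> (x # w)) + inversions (x # w) + (\<Sum>(i, j)\<in>inverted r \<sigma>. count_list (x # w) i * count_list (x # w) j) =
    (inversions (map \<sigma> w) + inversions w + (\<Sum>(i, j)\<in>inverted r \<sigma>. count_list w i * count_list w j)) +
     2 * (count_if (\<lambda>y. y < x) w + count_if (\<lambda>y. y \<in> ?R) w)"
    unfolding 1 using 2 by (simp add: filter_map comp_def)
  moreover have "even (inversions (map \<sigma> w) + inversions w + (\<Sum>(i, j)\<in>inverted r \<sigma>. count_list w i * count_list w j))"
    by (rule Cons.IH) (use Cons.prems in auto)
  ultimately show ?case by (metis dvd_add dvd_triv_left)
qed simp

text \<open>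
  Parities for opaque summands. In the instances these are sums over words, whose definitions
  would only get in the way of the arithmetic.
\<close>

lemma even_sum_if_sum_eq: "a + x = b + y \<Longrightarrow> even (a + b + y + x)" for a :: nat
  by presburger

lemma even_insert_pair: "even (r + l + y + x) \<Longrightarrow> even (d + a + b) \<Longrightarrow> even (d + (r + l) + (y + 1 + a) + (x + 1 + b))" for a :: nat
  by presburger

lemma even_orient_map: "S + D = C + I \<Longrightarrow> even (mw + w + C) \<Longrightarrow> even (D + sm + sw) \<Longrightarrow> even (p + I) \<Longrightarrow>
    even ((S + (w + sw)) + (p + (mw + sm)))" for S :: nat
  by presburger

lemma even_trans_sum: "even (b + x + f + y + g) \<Longrightarrow> even (x + y + z) \<Longrightarrow> even (b + (z + f + g))" for b :: nat
  by presburger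

text \<open>
  The sum over the inverted pairs counts every letter as often as its value occurs in such a
  pair, which by \<open>inverted_degree\<close> has the parity of the difference between the value and its
  image.
\<close>

lemma inverted_sum_degree:
  assumes \<sigma>: "\<sigma> permutes {1..r}" and w: "set w \<subseteq> {1..r}"
  shows "even ((\<Sum>(i, j)\<in>inverted r \<sigma>. count_list w i + count_list w j) + (\<Sum>x\<leftarrow>map \<sigma> w. x + 1) + (\<Sum>x\<leftarrow>w. x + 1))"
  using w
proof (induction w)
  case (Cons x w)
  let ?R = "{j. (x, j) \<in> inverted r \<sigma>}" and ?L = "{i. (i, x) \<in> inverted r \<sigma>}"
  have "(\<Sum>(i, j)\<in>inverted r \<sigma>. count_list (x # w) i + count_list (x # w) j) =
     (\<Sum>(i, j)\<in>inverted r \<sigma>. (count_list w i + count_list w j) + ((if i = x then 1 else 0) + (if j = x then 1 else 0)))"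
    by (rule sum.cong) (auto simp: inverted_def)
  also have "\<dots> = (\<Sum>(i, j)\<in>inverted r \<sigma>. count_list w i + count_list w j) + (card ?R + card ?L)"
    using sum_inverted_count_if [where c = "\<lambda>_. 1" and v = x and r = r and \<sigma> = \<sigma>] by (simp add: sum.distrib case_prod_unfold)
  finally have 1: "(\<Sum>(i, j)\<in>inverted r \<sigma>. count_list (x # w) i + count_list (x # w) j) =
    (\<Sum>(i, j)\<in>inverted r \<sigma>. count_list w i + count_list w j) + (card ?R + card ?L)" .
  have "card ?R + x = card ?L + \<sigma> x"
    by (rule inverted_degree [OF \<sigma>]) (use Cons.prems in simp)
  from even_sum_if_sum_eq [OF this] have "even (card ?R + card ?L + \<sigma> x + x)" .
  moreover have "even ((\<Sum>(i, j)\<in>inverted r \<sigma>. count_list w i + count_list w j) + (\<Sum>x\<leftarrow>map \<sigma> w. x + 1) + (\<Sum>x\<leftarrow>w. x + 1))"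
    by (rule Cons.IH) (use Cons.prems in simp)
  ultimately show ?case
    unfolding 1 list.map sum_list.Cons by (rule even_insert_pair)
qed simp

lemma inversions_upt [simp]: "inversions [a..<b] = 0"
proof (induction "b - a" arbitrary: a)
  case (Suc n)
  then have "a < b" by simp
  then have "[a..<b] = a # [Suc a..<b]" by (rule upt_conv_Cons)
  moreover have "inversions [Suc a..<b] = 0" using Suc by simp
  moreover have "filter (\<lambda>y. y < a) [Suc a..<b] = []" by (simp add: filter_empty_conv)
  ultimately show ?case by simp
qed simp

lemma count_list_distinct: "distinct xs \<Longrightarrow> x \<in> set xs \<Longrightarrow> count_list xs x = 1"
  by (induction xs) (auto simp: count_list_0_iff)

lemma inversions_perm:
  assumes \<sigma>: "\<sigma> permutes {1..r}"
  shows "even (inversions (map \<sigma> [1..<Suc r]) + card (inverted r \<sigma>))"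
proof -
  have "(\<Sum>(i, j)\<in>inverted r \<sigma>. count_list [1..<Suc r] i * count_list [1..<Suc r] j) = (\<Sum>(i, j)\<in>inverted r \<sigma>. 1)"
  proof (rule sum.cong [OF refl], clarify)
    fix i j assume "(i, j) \<in> inverted r \<sigma>"
    then have "i \<in> set [1..<Suc r]" "j \<in> set [1..<Suc r]" by (auto simp: inverted_def)
    then show "count_list [1..<Suc r] i * count_list [1..<Suc r] j = 1"
      by (simp only: count_list_distinct [OF distinct_upt] mult_1)
  qed
  also have "\<dots> = card (inverted r \<sigma>)" by (simp add: case_prod_unfold)
  finally have eq: "(\<Sum>(i, j)\<in>inverted r \<sigma>. count_list [1..<Suc r] i * count_list [1..<Suc r] j) = card (inverted r \<sigma>)" .
  have "even (inversions (map \<sigma> [1..<Suc r]) + inversions [1..<Suc r] +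
      (\<Sum>(i, j)\<in>inverted r \<sigma>. count_list [1..<Suc r] i * count_list [1..<Suc r] j))"
    by (rule inversions_map [OF \<sigma>]) auto
  then show ?thesis
    unfolding eq inversions_upt by (simp del: upt_Suc)
qed

text \<open>
  Counting letters instead of edges turns the product \<open>m\<^sub>i m\<^sub>j\<close> into \<open>(m\<^sub>i + 1) (m\<^sub>j + 1)\<close>. The
  mixed terms are absorbed by the change of the second summand of \<open>orient\<close>, and the constant \<open>1\<close>
  for each inverted pair gives the sign of \<open>\<sigma>\<close>.
\<close>

lemma orient_map:
  assumes \<sigma>: "\<sigma> permutes {1..r}" and w: "set w = {1..r}"
  shows "(\<Prod>(i, j)\<in>inverted r \<sigma>. (-1) ^ (mdeg w i * mdeg w j)) * orient w = perm_sign r \<sigma> * orient (map \<sigma> w)"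
proof -
  let ?S = "\<Sum>(i, j)\<in>inverted r \<sigma>. mdeg w i * mdeg w j" and ?C = "\<Sum>(i, j)\<in>inverted r \<sigma>. count_list w i * count_list w j"
  let ?D = "\<Sum>(i, j)\<in>inverted r \<sigma>. count_list w i + count_list w j"
  have prod: "(\<Prod>(i, j)\<in>inverted r \<sigma>. (-1) ^ (mdeg w i * mdeg w j)) = (-1 :: int) ^ ?S"
    by (simp add: power_sum case_prod_unfold)
  have "?S + ?D = (\<Sum>(i, j)\<in>inverted r \<sigma>. mdeg w i * mdeg w j + (count_list w i + count_list w j))"
    by (simp add: sum.distrib case_prod_unfold)
  also have "\<dots> = (\<Sum>(i, j)\<in>inverted r \<sigma>. count_list w i * count_list w j + 1)"
  proof (rule sum.cong [OF refl], clarify)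
    fix i j assume "(i, j) \<in> inverted r \<sigma>"
    then have "i \<in> {1..r}" "j \<in> {1..r}" by (auto simp: inverted_def)
    then have "i \<in> set w" "j \<in> set w" unfolding w by simp_all
    then have "count_list w i = Suc (mdeg w i)" "count_list w j = Suc (mdeg w j)"
      by (simp_all add: mdeg_def Suc_count_list_minus_1)
    then show "mdeg w i * mdeg w j + (count_list w i + count_list w j) = count_list w i * count_list w j + 1"
      by simp
  qed
  also have "\<dots> = ?C + card (inverted r \<sigma>)"
    by (simp add: sum.distrib sum_Suc case_prod_unfold)
  finally have "?S + ?D = ?C + card (inverted r \<sigma>)" .
  moreover have "even (inversions (map \<sigma> w) + inversions w + ?C)"
    by (rule inversions_map [OF \<sigma>]) (simp add: w)
  moreover have "even (?D + (\<Sum>x\<leftarrow>map \<sigma> w. x + 1) + (\<Sum>x\<leftarrow>w. x + 1))"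
    by (rule inverted_sum_degree [OF \<sigma>]) (simp add: w)
  moreover note inversions_perm [OF \<sigma>]
  ultimately have "even ((?S + (inversions w + (\<Sum>x\<leftarrow>w. x + 1))) +
     (inversions (map \<sigma> [1..<Suc r]) + (inversions (map \<sigma> w) + (\<Sum>x\<leftarrow>map \<sigma> w. x + 1))))"
    by (rule even_orient_map)
  then show ?thesis
    unfolding prod orient_def perm_sign_def power_add [symmetric] by (rule neg_one_power_eqI)
qed

lemma nondegenerate_map:
  assumes \<sigma>: "\<sigma> permutes {1..r}"
  shows "nondegenerate r (map \<sigma> w) \<longleftrightarrow> nondegenerate r w"
proof -
  have inj: "inj \<sigma>" by (rule permutes_inj [OF \<sigma>])
  have "\<sigma> ` set w = {1..r} \<longleftrightarrow> \<sigma> ` set w = \<sigma> ` {1..r}"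
    by (simp only: permutes_image [OF \<sigma>])
  then have "\<sigma> ` set w = {1..r} \<longleftrightarrow> set w = {1..r}"
    by (simp only: inj_image_eq_iff [OF inj])
  then show ?thesis
    by (simp add: nondegenerate_def distinct_adj_map_iff [OF inj_on_subset [OF inj subset_UNIV]])
qed

lemma act_oriented:
  assumes \<sigma>: "\<sigma> permutes {1..r}"
  shows "surj_act r \<sigma> (oriented r w) = frag_cmul (perm_sign r \<sigma>) (oriented r (map \<sigma> w))"
proof (cases "nondegenerate r w")
  case False
  then show ?thesis by (simp add: oriented_degenerate nondegenerate_map [OF \<sigma>] surj_act_def)
next
  case True
  then have w: "set w = {1..r}" by (simp add: nondegenerate_def)
  have "surj_act r \<sigma> (oriented r w) =
      frag_cmul ((\<Prod>(i, j)\<in>inverted r \<sigma>. (-1) ^ (mdeg w i * mdeg w j)) * orient w) (frag_of (map \<sigma> w))"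
    using True by (simp add: surj_act_def oriented_def seq_class_def frag_extend_cmul inverted_def mult.commute)
  also have "\<dots> = frag_cmul (perm_sign r \<sigma>) (oriented r (map \<sigma> w))"
    unfolding orient_map [OF \<sigma> w] using True by (simp add: oriented_def seq_class_def nondegenerate_map [OF \<sigma>])
  finally show ?thesis .
qed

section \<open>Block permutations\<close>

lemma upt_split_at: "i \<le> j \<Longrightarrow> j \<le> k \<Longrightarrow> [i..<k] = [i..<j] @ [j..<k]"
  by (metis le_add_diff_inverse upt_add_eq_append)

lemma glue_append: "i \<notin> set f1 \<Longrightarrow> glue i s (f1 @ f2) g ps = map (val_shift i s) f1 @ glue i s f2 g ps"
  by (induction f1) auto

lemma step_exponent_append: "i \<notin> set f1 \<Longrightarrow> step_exponent i (f1 @ f2) n ps = step_exponent i f2 n ps"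
  by (induction f1) auto

context
  fixes r s i :: nat and \<sigma> \<tau> :: "nat \<Rightarrow> nat"
  assumes i: "i \<in> {1..r}" and \<sigma>: "\<sigma> permutes {1..r}" and \<tau>: "\<tau> permutes {1..s}"
begin

lemma \<sigma>_i: "\<sigma> i \<in> {1..r}"
  using permutes_in_image [OF \<sigma>, of i] i by simp

lemma \<sigma>_neq: "v \<noteq> i \<Longrightarrow> \<sigma> v \<noteq> \<sigma> i"
  using injD [OF permutes_inj [OF \<sigma>], of v i] by argo

lemma block_shift: "v \<noteq> i \<Longrightarrow> block_perm s i \<sigma> \<tau> (val_shift i s v) = val_shift (\<sigma> i) s (\<sigma> v)"
  by (auto simp: block_perm_def val_shift_def Let_def)

lemma block_block: "x \<in> {1..s} \<Longrightarrow> block_perm s i \<sigma> \<tau> (val_block i x) = val_block (\<sigma> i) (\<tau> x)"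
  using i by (auto simp: block_perm_def val_block_def Let_def)

lemma upt_split: "[1..<Suc r] = [1..<i] @ i # [Suc i..<Suc r]"
proof -
  have "[1..<Suc r] = [1..<i] @ [i..<Suc r]" using i by (intro upt_split_at) auto
  then show ?thesis using i by (simp add: upt_conv_Cons)
qed

lemma upt_block_split:
  "[1..<r + s] = map (val_shift i s) [1..<i] @ map (val_block i) [1..<Suc s] @ map (val_shift i s) [Suc i..<Suc r]"
proof -
  have "map (val_shift i s) [1..<i] = [1..<i]" by (intro map_idI) (simp add: val_shift_def)
  moreover have "map (val_block i) [1..<Suc s] = [i..<i + s]"
    using i by (intro nth_equalityI) (auto simp: val_block_def simp del: upt_Suc)
  moreover have "map (val_shift i s) [Suc i..<Suc r] = [i + s..<r + s]"
    using i by (intro nth_equalityI) (auto simp: val_shift_def simp del: upt_Suc)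
  moreover have "[1..<r + s] = [1..<i] @ [i..<i + s] @ [i + s..<r + s]"
    using i upt_split_at [of 1 i "r + s"] upt_split_at [of i "i + s" "r + s"] by simp
  ultimately show ?thesis by simp
qed

text \<open>
  As a word, the block permutation is composed from the words of \<open>\<sigma>\<close> and \<open>\<tau>\<close> at the letter
  \<open>\<sigma> i\<close>. This makes its sign an instance of \<open>inversions_glue\<close>, without cuts.
\<close>

lemma map_block_eq_glue:
  "map (block_perm s i \<sigma> \<tau>) [1..<r + s] = glue (\<sigma> i) s (map \<sigma> [1..<Suc r]) (map \<tau> [1..<Suc s]) []"
proof -
  have ni: "\<sigma> i \<notin> set (map \<sigma> [1..<i])" "\<sigma> i \<notin> set (map \<sigma> [Suc i..<Suc r])"
    unfolding set_map inj_image_mem_iff [OF permutes_inj [OF \<sigma>]] by auto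
  have sh: "map (block_perm s i \<sigma> \<tau>) (map (val_shift i s) xs) = map (val_shift (\<sigma> i) s) (map \<sigma> xs)" if "i \<notin> set xs" for xs
    using that block_shift by (induction xs) auto
  have "i \<notin> set [1..<i]" "i \<notin> set [Suc i..<Suc r]" by simp_all
  note sh = sh [OF this(1)] sh [OF this(2)]
  have bl: "map (block_perm s i \<sigma> \<tau>) (map (val_block i) [1..<Suc s]) = map (val_block (\<sigma> i)) (map \<tau> [1..<Suc s])"
    by (auto simp: block_block simp del: upt_Suc)
  show ?thesis
    by (simp only: upt_block_split upt_split map_append sh bl list.map glue_append [OF ni(1)] glue.simps if_True refl
        list.case glue_absent [OF ni(2)])
qed

lemma block_permutes: "block_perm s i \<sigma> \<tau> permutes {1..r + s - 1}"
proof (rule bij_imp_permutes)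
  have S: "set [1..<r + s] = {1..r + s - 1}" using i by auto
  have \<tau>s: "\<tau> ` {1..s} = {1..s}" by (rule permutes_image [OF \<tau>])
  have "\<sigma> ` ({1..r} - {i}) = {1..r} - {\<sigma> i}"
    using permutes_image [OF \<sigma>] image_set_diff [OF permutes_inj [OF \<sigma>], of "{1..r}" "{i}"] by simp
  then have e: "val_shift (\<sigma> i) s ` \<sigma> ` ({1..r} - {i}) \<union> val_block (\<sigma> i) ` \<tau> ` {1..s} = {1..r + s - 1}"
    unfolding \<tau>s using range_val [OF \<sigma>_i, of s] by simp
  have "block_perm s i \<sigma> \<tau> ` {1..r + s - 1} =
      block_perm s i \<sigma> \<tau> ` val_shift i s ` ({1..r} - {i}) \<union> block_perm s i \<sigma> \<tau> ` val_block i ` {1..s}"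
    unfolding range_val [OF i, symmetric] by (rule image_Un)
  also have "block_perm s i \<sigma> \<tau> ` val_shift i s ` ({1..r} - {i}) = val_shift (\<sigma> i) s ` \<sigma> ` ({1..r} - {i})"
    unfolding image_image by (rule image_cong [OF refl]) (simp add: block_shift)
  also have "block_perm s i \<sigma> \<tau> ` val_block i ` {1..s} = val_block (\<sigma> i) ` \<tau> ` {1..s}"
    unfolding image_image by (rule image_cong [OF refl]) (simp add: block_block)
  finally have surj: "block_perm s i \<sigma> \<tau> ` {1..r + s - 1} = {1..r + s - 1}" unfolding e .
  then show "bij_betw (block_perm s i \<sigma> \<tau>) {1..r + s - 1} {1..r + s - 1}"
    unfolding bij_betw_def using eq_card_imp_inj_on [of "{1..r + s - 1}" "block_perm s i \<sigma> \<tau>"] by simp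
  fix a assume a: "a \<notin> {1..r + s - 1}"
  then consider "a = 0" | "r + s \<le> a" using i by fastforce
  then show "block_perm s i \<sigma> \<tau> a = a"
  proof cases
    case 1
    have "\<sigma> 0 = 0" by (rule permutes_not_in [OF \<sigma>]) simp
    then show ?thesis using 1 i \<sigma>_i by (simp add: block_perm_def)
  next
    case 2
    have "\<sigma> (a + 1 - s) = a + 1 - s" by (rule permutes_not_in [OF \<sigma>]) (use 2 in auto)
    moreover have "\<not> a + 1 - s < \<sigma> i" using 2 \<sigma>_i by auto
    ultimately show ?thesis using 2 i by (simp add: block_perm_def)
  qed
qed

lemma perm_sign_block:
  "perm_sign (r + s - 1) (block_perm s i \<sigma> \<tau>) = (-1) ^ ((s + 1) * (i + \<sigma> i)) * perm_sign r \<sigma> * perm_sign s \<tau>"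
proof -
  let ?f = "map \<sigma> [1..<Suc r]" and ?g = "map \<tau> [1..<Suc s]"
  have set_f: "set ?f = {1..r}" "set ?g = {1..s}"
    using permutes_image [OF \<sigma>] permutes_image [OF \<tau>] by (simp_all add: atLeastLessThanSuc_atLeastAtMost del: upt_Suc)
  have dist: "distinct ?f"
    by (simp add: distinct_map inj_on_subset [OF permutes_inj [OF \<sigma>] subset_UNIV] del: upt_Suc)
  have si: "\<sigma> i \<in> set ?f" unfolding set_f by (rule \<sigma>_i)
  have ps: "[] \<in> cuts (count_list ?f (\<sigma> i) - 1) ?g"
    by (simp only: count_list_distinct [OF dist si]) simp
  have ni: "\<sigma> i \<notin> set (map \<sigma> [1..<i])"
    unfolding set_map inj_image_mem_iff [OF permutes_inj [OF \<sigma>]] by auto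
  have step: "step_exponent (\<sigma> i) ?f (length ?g) [] = (s + 1) * (r - i)"
    unfolding upt_split map_append list.map step_exponent_append [OF ni] by (simp del: upt_Suc)
  have "(\<Sum>v = \<sigma> i + 1..r. mdeg ?f v) = 0"
  proof (rule sum.neutral, rule ballI)
    fix v assume "v \<in> {\<sigma> i + 1..r}"
    then have "v \<in> set ?f" unfolding set_f by simp
    then show "mdeg ?f v = 0" by (simp only: mdeg_def count_list_distinct [OF dist])
  qed
  then have N: "count_if (\<lambda>v. \<sigma> i < v) ?f = r - \<sigma> i"
    using sum_mdeg_greater [OF set_f(1), of "\<sigma> i"] by simp
  have lg: "length ?g = s" and sub: "set ?g \<subseteq> {1..s}" and i1: "1 \<le> \<sigma> i"
    using \<sigma>_i set_f(2) by (simp_all del: upt_Suc)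
  note inversions_glue [OF si ps sub i1, unfolded step N, unfolded lg]
  then have *: "even (inversions (map (block_perm s i \<sigma> \<tau>) [1..<r + s]) + (s + 1) * (r - i) + inversions ?f + (s + 1) * (r - \<sigma> i) + inversions ?g)"
    unfolding map_block_eq_glue [symmetric] by (simp add: cut_inversions_def del: upt_Suc)
  have "(s + 1) * (r - i) + (s + 1) * (r - \<sigma> i) + (s + 1) * (i + \<sigma> i) = 2 * ((s + 1) * r)"
  proof -
    have "r - i + (r - \<sigma> i) + (i + \<sigma> i) = 2 * r" using i \<sigma>_i by simp
    then show ?thesis by (metis distrib_left mult.left_commute)
  qed
  then have "even ((s + 1) * (r - i) + (s + 1) * (r - \<sigma> i) + (s + 1) * (i + \<sigma> i))"
    by (simp only: dvd_triv_left)
  from even_trans_sum [OF * this] have "even (inversions (map (block_perm s i \<sigma> \<tau>) [1..<r + s]) + ((s + 1) * (i + \<sigma> i) + inversions ?f + inversions ?g))"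
    .
  moreover have "Suc (r + s - 1) = r + s" using i by simp
  ultimately show ?thesis
    unfolding perm_sign_def power_add [symmetric] by (intro neg_one_power_eqI) simp
qed

end

section \<open>The operad structure\<close>

definition basis :: "nat \<Rightarrow> int \<Rightarrow> nat list set" where
  "basis r n = {w. nondegenerate r w \<and> int (length w) = n + int r}"

lemma surj_chain_basis: "surj_chain r n = free_Abelian_group (basis r n)"
  by (simp add: surj_chain_def basis_def)

text \<open>
  The oriented words generate, since they are basis elements up to sign. Equations between
  linear maps need only be checked on them.
\<close>

lemma chain_induct [consumes 1, case_names zero diff gen]:
  assumes x: "supp x \<subseteq> basis r n"
    and "P 0" and diff: "\<And>a b. P a \<Longrightarrow> P b \<Longrightarrow> P (a - b)"
    and gen: "\<And>w. set w = {1..r} \<Longrightarrow> distinct_adj w \<Longrightarrow> int (length w) = n + int r \<Longrightarrow> P (oriented r w)"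
  shows "P x"
  using x
proof (induction x rule: frag_induction)
  case (one w)
  then have nd: "nondegenerate r w" and P: "P (oriented r w)" using gen by (auto simp: basis_def nondegenerate_def)
  have "orient w = 1 \<or> orient w = -1" by (simp add: orient_def minus_one_power_iff)
  then have "frag_of w = oriented r w \<or> frag_of w = 0 - oriented r w"
    using frag_of_eq_oriented [OF nd] by auto
  then show ?case using P diff [OF \<open>P 0\<close> P] by metis
qed (use assms in auto)

lemma keys_oriented_extend:
  assumes "u \<in> supp (frag_extend (oriented r) W)"
  shows "nondegenerate r u" "u \<in> supp W"
proof -
  from subsetD [OF keys_frag_extend assms] obtain w where w: "w \<in> supp W" "u \<in> supp (oriented r w)"
    by blast
  then have "nondegenerate r w" "u = w"
    by (auto simp: oriented_def seq_class_def split: if_split_asm)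
  then show "nondegenerate r u" "u \<in> supp W" using w by simp_all
qed

lemma keys_diff_subset: "supp a \<subseteq> B \<Longrightarrow> supp b \<subseteq> B \<Longrightarrow> supp (a - b) \<subseteq> B"
  by (meson Un_least keys_diff order.trans)

lemma surj_bdry_linear [simp]:
  "surj_bdry r 0 = 0" "surj_bdry r (x - y) = surj_bdry r x - surj_bdry r y"
  "surj_bdry r (x + y) = surj_bdry r x + surj_bdry r y" "surj_bdry r (frag_cmul c x) = frag_cmul c (surj_bdry r x)"
  by (simp_all add: surj_bdry_def frag_linear)

lemma surj_act_linear [simp]:
  "surj_act r \<sigma> 0 = 0" "surj_act r \<sigma> (x - y) = surj_act r \<sigma> x - surj_act r \<sigma> y"
  "surj_act r \<sigma> (x + y) = surj_act r \<sigma> x + surj_act r \<sigma> y" "surj_act r \<sigma> (frag_cmul c x) = frag_cmul c (surj_act r \<sigma> x)"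
  by (simp_all add: surj_act_def frag_linear)

lemma surj_pcomp_left_linear [simp]:
  "surj_pcomp r i s 0 z = 0" "surj_pcomp r i s (x - y) z = surj_pcomp r i s x z - surj_pcomp r i s y z"
  "surj_pcomp r i s (x + y) z = surj_pcomp r i s x z + surj_pcomp r i s y z"
  "surj_pcomp r i s (frag_cmul c x) z = frag_cmul c (surj_pcomp r i s x z)"
  by (simp_all add: surj_pcomp_def frag_linear)

lemma surj_pcomp_right_linear [simp]:
  "surj_pcomp r i s z 0 = 0" "surj_pcomp r i s z (x - y) = surj_pcomp r i s z x - surj_pcomp r i s z y"
  "surj_pcomp r i s z (x + y) = surj_pcomp r i s z x + surj_pcomp r i s z y"
  "surj_pcomp r i s z (frag_cmul c x) = frag_cmul c (surj_pcomp r i s z x)"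
  by (simp_all add: surj_pcomp_def frag_linear frag_extend_fun_0 frag_extend_fun_diff frag_extend_fun_add frag_extend_fun_cmul)

text \<open>
  These rules transport the operations to linear combinations of words, which arise when
  operations are iterated.
\<close>

lemma bdry_oriented_extend:
  assumes "\<And>u. u \<in> supp W \<Longrightarrow> set u \<subseteq> {1..r}"
  shows "surj_bdry r (frag_extend (oriented r) W) = frag_extend (oriented r) (frag_extend word_bdry W)"
proof -
  have "surj_bdry r (frag_extend (oriented r) W) = frag_extend (\<lambda>u. surj_bdry r (oriented r u)) W"
    by (rule frag_extend_linear_comp) simp_all
  also have "\<dots> = frag_extend (\<lambda>u. frag_extend (oriented r) (word_bdry u)) W"
    by (rule frag_extend_eq) (rule bdry_oriented [OF assms])
  finally show ?thesis by (simp only: frag_extend_frag_extend)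
qed

lemma act_oriented_extend:
  assumes "\<sigma> permutes {1..r}"
  shows "surj_act r \<sigma> (frag_extend (oriented r) W) =
    frag_cmul (perm_sign r \<sigma>) (frag_extend (oriented r) (frag_extend (\<lambda>u. frag_of (map \<sigma> u)) W))"
proof -
  have "surj_act r \<sigma> (frag_extend (oriented r) W) = frag_extend (\<lambda>u. surj_act r \<sigma> (oriented r u)) W"
    by (rule frag_extend_linear_comp) simp_all
  then show ?thesis
    by (simp only: act_oriented [OF assms] frag_extend_fun_cmul frag_extend_frag_extend frag_extend_of)
qed

lemma pcomp_oriented_extend_left:
  assumes i: "i \<in> {1..r}" and W: "\<And>u. u \<in> supp W \<Longrightarrow> set u \<subseteq> {1..r}" and g: "set g \<subseteq> {1..s}"
  shows "surj_pcomp r i s (frag_extend (oriented r) W) (oriented s g) =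
    frag_cmul ((-1) ^ suspension r i s (length g)) (frag_extend (oriented (r + s - 1)) (frag_extend (\<lambda>f. ins_val i s f g) W))"
proof -
  have "surj_pcomp r i s (frag_extend (oriented r) W) (oriented s g) = frag_extend (\<lambda>u. surj_pcomp r i s (oriented r u) (oriented s g)) W"
    by (rule frag_extend_linear_comp) simp_all
  also have "\<dots> = frag_extend (\<lambda>u. frag_cmul ((-1) ^ suspension r i s (length g)) (frag_extend (oriented (r + s - 1)) (ins_val i s u g))) W"
    by (rule frag_extend_eq) (rule pcomp_oriented [OF i W g])
  finally show ?thesis by (simp only: frag_extend_frag_extend frag_extend_fun_cmul)
qed

lemma pcomp_oriented_extend_right:
  assumes i: "i \<in> {1..r}" and f: "set f \<subseteq> {1..r}"
    and W: "\<And>u. u \<in> supp W \<Longrightarrow> set u \<subseteq> {1..s} \<and> Suc (length u) = l"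
  shows "surj_pcomp r i s (oriented r f) (frag_extend (oriented s) W) =
    frag_cmul ((-1) ^ suspension r i s (l + 1)) (frag_extend (oriented (r + s - 1)) (frag_extend (ins_val i s f) W))"
proof -
  have "surj_pcomp r i s (oriented r f) (frag_extend (oriented s) W) = frag_extend (\<lambda>u. surj_pcomp r i s (oriented r f) (oriented s u)) W"
    by (rule frag_extend_linear_comp) simp_all
  also have "\<dots> = frag_extend (\<lambda>u. frag_cmul ((-1) ^ suspension r i s (l + 1)) (frag_extend (oriented (r + s - 1)) (ins_val i s f u))) W"
  proof (rule frag_extend_eq)
    fix u assume u: "u \<in> supp W"
    then have "suspension r i s (l + 1) = suspension r i s (length u) + 2 * (r + 1)"
      using W [OF u] by (auto simp: suspension_def algebra_simps)
    then have "(-1 :: int) ^ suspension r i s (length u) = (-1) ^ suspension r i s (l + 1)"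
      by (simp add: power_add)
    then show "surj_pcomp r i s (oriented r f) (oriented s u) =
        frag_cmul ((-1) ^ suspension r i s (l + 1)) (frag_extend (oriented (r + s - 1)) (ins_val i s f u))"
      using pcomp_oriented [OF i f, of u s] W [OF u] by simp
  qed
  finally show ?thesis by (simp only: frag_extend_frag_extend frag_extend_fun_cmul)
qed

lemma keys_ins_val:
  assumes u: "u \<in> supp (ins_val i s f g)" and i: "i \<in> {1..r}" and f: "set f \<subseteq> {1..r}" and g: "set g \<subseteq> {1..s}"
  shows "set u \<subseteq> {1..r + s - 1}" "Suc (length u) = length f + length g"
proof -
  have "set u = val_shift i s ` (set f - {i}) \<union> val_block i ` set g" "Suc (length u) = length f + length g"
    using keys_ins [OF u] by blast+
  then show "set u \<subseteq> {1..r + s - 1}" "Suc (length u) = length f + length g"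
    using range_val [OF i, of s] f g by fast+
qed

lemma keys_bdry: "supp x \<subseteq> basis r n \<Longrightarrow> supp (surj_bdry r x) \<subseteq> basis r (n - 1)"
proof (induction x rule: chain_induct)
  case (gen w)
  show ?case
  proof
    fix u assume "u \<in> supp (surj_bdry r (oriented r w))"
    then have "u \<in> supp (frag_extend (oriented r) (word_bdry w))" using bdry_oriented [of w r] gen by simp
    from keys_oriented_extend [OF this] have "nondegenerate r u" "Suc (length u) = length w" using keys_word_bdry [of u w] by auto
    then show "u \<in> basis r (n - 1)" using gen by (simp add: basis_def)
  qed
qed (simp_all add: keys_diff_subset)

lemma keys_act:
  assumes \<sigma>: "\<sigma> permutes {1..r}"
  shows "supp x \<subseteq> basis r n \<Longrightarrow> supp (surj_act r \<sigma> x) \<subseteq> basis r n"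
proof (induction x rule: chain_induct)
  case (gen w)
  then have "nondegenerate r w" by (simp add: nondegenerate_def)
  then show ?case
    using gen unfolding act_oriented [OF \<sigma>] by (auto simp: oriented_def seq_class_def basis_def nondegenerate_map [OF \<sigma>])
qed (simp_all add: keys_diff_subset)

lemma keys_pcomp:
  assumes i: "i \<in> {1..r}" and x: "supp x \<subseteq> basis r m" and y: "supp y \<subseteq> basis s n"
  shows "supp (surj_pcomp r i s x y) \<subseteq> basis (r + s - 1) (m + n)"
  using x
proof (induction x rule: chain_induct)
  case (gen f)
  show ?case
    using y
  proof (induction y rule: chain_induct)
    case (gen g)
    show ?case
    proof
      fix u assume "u \<in> supp (surj_pcomp r i s (oriented r f) (oriented s g))"
      then have u: "u \<in> supp (frag_extend (oriented (r + s - 1)) (ins_val i s f g))"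
        using pcomp_oriented [OF i, of f g s] \<open>set f = _\<close> gen(1) by simp
      from keys_ins_val(2) [OF keys_oriented_extend(2) [OF u] i] keys_oriented_extend(1) [OF u]
      show "u \<in> basis (r + s - 1) (m + n)"
        using \<open>set f = _\<close> \<open>int (length f) = _\<close> gen i by (simp add: basis_def)
    qed
  qed (simp_all add: keys_diff_subset)
qed (simp_all add: keys_diff_subset)

lemma surj_bdry_bdry: "supp x \<subseteq> basis r n \<Longrightarrow> surj_bdry r (surj_bdry r x) = 0"
proof (induction x rule: chain_induct)
  case (gen w)
  have "set u \<subseteq> {1..r}" if "u \<in> supp (word_bdry w)" for u
    using keys_word_bdry [OF that] gen(1) by simp
  then show ?case using gen(1) by (simp add: bdry_oriented bdry_oriented_extend word_bdry_word_bdry)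
qed auto

lemma perm_sign_comp:
  assumes \<sigma>: "\<sigma> permutes {1..r}" and \<tau>: "\<tau> permutes {1..r}"
  shows "perm_sign r (\<sigma> \<circ> \<tau>) = perm_sign r \<sigma> * perm_sign r \<tau>"
proof -
  let ?w = "map \<tau> [1..<Suc r]"
  have w: "set ?w = {1..r}" using permutes_image [OF \<tau>] by (simp add: atLeastLessThanSuc_atLeastAtMost del: upt_Suc)
  have dist: "distinct ?w"
    by (simp add: distinct_map inj_on_subset [OF permutes_inj [OF \<tau>] subset_UNIV] del: upt_Suc)
  have "(\<Sum>(i, j)\<in>inverted r \<sigma>. count_list ?w i * count_list ?w j) = (\<Sum>(i, j)\<in>inverted r \<sigma>. 1)"
  proof (rule sum.cong [OF refl], clarify)
    fix i j assume "(i, j) \<in> inverted r \<sigma>"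
    then have "i \<in> set ?w" "j \<in> set ?w" unfolding w by (auto simp: inverted_def)
    then show "count_list ?w i * count_list ?w j = 1"
      by (simp only: count_list_distinct [OF dist] mult_1)
  qed
  also have "\<dots> = card (inverted r \<sigma>)" by (simp add: case_prod_unfold)
  finally have eq: "(\<Sum>(i, j)\<in>inverted r \<sigma>. count_list ?w i * count_list ?w j) = card (inverted r \<sigma>)" .
  have "even (inversions (map \<sigma> ?w) + inversions ?w + card (inverted r \<sigma>))"
    using inversions_map [OF \<sigma>, of ?w] unfolding eq w by simp
  moreover note inversions_perm [OF \<sigma>]
  ultimately have "even (inversions (map \<sigma> ?w) + (inversions (map \<sigma> [1..<Suc r]) + inversions ?w))" by presburger
  then show ?thesis
    unfolding perm_sign_def power_add [symmetric] by (intro neg_one_power_eqI) (simp only: map_map)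
qed

lemma surj_act_comp:
  assumes \<sigma>: "\<sigma> permutes {1..r}" and \<tau>: "\<tau> permutes {1..r}"
  shows "supp x \<subseteq> basis r n \<Longrightarrow> surj_act r (\<sigma> \<circ> \<tau>) x = surj_act r \<sigma> (surj_act r \<tau> x)"
proof (induction x rule: chain_induct)
  case (gen w)
  show ?case
    by (simp only: act_oriented [OF \<sigma>] act_oriented [OF \<tau>] act_oriented [OF permutes_compose [OF \<tau> \<sigma>]] perm_sign_comp [OF \<sigma> \<tau>]
        surj_act_linear frag_cmul_cmul map_map mult.commute)
qed auto

lemma surj_act_id: "supp x \<subseteq> basis r n \<Longrightarrow> surj_act r id x = x"
proof (induction x rule: chain_induct)
  case (gen w)
  have "perm_sign r id = 1" unfolding perm_sign_def list.map_id id_apply inversions_upt by simp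
  then show ?case by (simp only: act_oriented [OF permutes_id] frag_cmul_one list.map_id)
qed auto

lemma word_bdry_map: "word_bdry (map \<phi> w) = frag_extend (\<lambda>u. frag_of (map \<phi> u)) (word_bdry w)"
  by (induction w) (simp_all add: frag_extend_diff map_prepend)

lemma surj_bdry_act:
  assumes \<sigma>: "\<sigma> permutes {1..r}"
  shows "supp x \<subseteq> basis r n \<Longrightarrow> surj_bdry r (surj_act r \<sigma> x) = surj_act r \<sigma> (surj_bdry r x)"
proof (induction x rule: chain_induct)
  case (gen w)
  have "set (map \<sigma> w) \<subseteq> {1..r}" using permutes_image [OF \<sigma>] gen(1) by simp
  then show ?case
    using gen(1) by (simp add: act_oriented [OF \<sigma>] bdry_oriented act_oriented_extend [OF \<sigma>] word_bdry_map)
qed auto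

definition int_sign :: "int \<Rightarrow> int" where
  "int_sign k = (if even k then 1 else -1)"

lemma sign_pow_surj:
  "supp x \<subseteq> B \<Longrightarrow> sign_pow (free_Abelian_group B) k x = frag_cmul (int_sign k) x"
  by (simp add: sign_pow_def int_sign_def)

text \<open>
  The sign of \<open>ins_leibniz\<close> is relative to the length of \<open>f\<close>. The shift of \<open>suspension\<close> when \<open>g\<close>
  loses a letter turns it into the degree, which is the length minus the arity.
\<close>

lemma surj_leibniz:
  assumes i: "i \<in> {1..r}" and x: "supp x \<subseteq> basis r m" and y: "supp y \<subseteq> basis s n"
  shows "surj_bdry (r + s - 1) (surj_pcomp r i s x y) =
    surj_pcomp r i s (surj_bdry r x) y + frag_cmul (int_sign m) (surj_pcomp r i s x (surj_bdry s y))"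
  using x
proof (induction x rule: chain_induct)
  case (gen f)
  note f = gen
  show ?case
    using y
  proof (induction y rule: chain_induct)
    case (gen g)
    have sub: "set f \<subseteq> {1..r}" "set g \<subseteq> {1..s}" using f gen by simp_all
    have wf: "set u \<subseteq> {1..r}" if "u \<in> supp (word_bdry f)" for u
      using keys_word_bdry [OF that] sub by auto
    have wg: "set u \<subseteq> {1..s} \<and> Suc (length u) = length g" if "u \<in> supp (word_bdry g)" for u
      using keys_word_bdry [OF that] sub by auto
    have wi: "set u \<subseteq> {1..r + s - 1}" if "u \<in> supp (ins_val i s f g)" for u
      by (rule keys_ins_val(1) [OF that i sub])
    have "int_sign m * (-1) ^ suspension r i s (length g + 1) = - ((-1) ^ suspension r i s (length g) * (-1) ^ length f)"
    proof -
      have "suspension r i s (length g + 1) = suspension r i s (length g) + (r + 1)" by (simp add: suspension_def)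
      moreover have "int_sign m * (-1) ^ r = (-1) ^ length f"
      proof -
        have "even m \<longleftrightarrow> (even (length f) \<longleftrightarrow> even r)" using f(3) by presburger
        then show ?thesis by (simp add: int_sign_def minus_one_power_iff)
      qed
      ultimately show ?thesis by (simp add: power_add)
    qed
    then show ?case
      by (simp only: pcomp_oriented [OF i sub] bdry_oriented_extend [OF wi] bdry_oriented [OF sub(1)] bdry_oriented [OF sub(2)]
          surj_bdry_linear pcomp_oriented_extend_left [OF i wf sub(2)] pcomp_oriented_extend_right [OF i sub(1) wg] ins_leibniz
          frag_linear frag_cmul_cmul minus_frag_cmul [symmetric] add_uminus_conv_diff)
  qed (simp_all add: frag_linear)
qed (simp_all add: frag_linear)

text \<open>
  The signs of the permutations enter through \<open>act_oriented\<close>. By \<open>perm_sign_block\<close> they differ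
  from that of the block permutation in the same way as the suspension signs at \<open>i\<close> and at \<open>\<sigma> i\<close>
  differ.
\<close>

lemma surj_pcomp_act:
  assumes i: "i \<in> {1..r}" and \<sigma>: "\<sigma> permutes {1..r}" and \<tau>: "\<tau> permutes {1..s}"
    and x: "supp x \<subseteq> basis r m" and y: "supp y \<subseteq> basis s n"
  shows "surj_pcomp r (\<sigma> i) s (surj_act r \<sigma> x) (surj_act s \<tau> y) =
     surj_act (r + s - 1) (block_perm s i \<sigma> \<tau>) (surj_pcomp r i s x y)"
  using x
proof (induction x rule: chain_induct)
  case (gen f)
  note f = gen
  show ?case
    using y
  proof (induction y rule: chain_induct)
    case (gen g)
    have sub: "set f \<subseteq> {1..r}" "set g \<subseteq> {1..s}" using f gen by simp_all
    have sub': "set (map \<sigma> f) \<subseteq> {1..r}" "set (map \<tau> g) \<subseteq> {1..s}"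
      using permutes_image [OF \<sigma>] permutes_image [OF \<tau>] f gen by simp_all
    have ins: "ins_val (\<sigma> i) s (map \<sigma> f) (map \<tau> g) =
      frag_extend (\<lambda>u. frag_of (map (block_perm s i \<sigma> \<tau>) u)) (ins_val i s f g)"
      unfolding map_ins
    proof (rule ins_map_cong)
      show "\<forall>v\<in>set f. v \<noteq> i \<longrightarrow> \<sigma> v \<noteq> \<sigma> i \<and> val_shift (\<sigma> i) s (\<sigma> v) = block_perm s i \<sigma> \<tau> (val_shift i s v)"
        using \<sigma>_neq [OF i \<sigma> \<tau>] block_shift [OF i \<sigma> \<tau>] by simp
      show "\<forall>x\<in>set g. val_block (\<sigma> i) (\<tau> x) = block_perm s i \<sigma> \<tau> (val_block i x)"
        using block_block [OF i \<sigma> \<tau>] gen(1) by simp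
    qed
    have "(-1 :: int) ^ suspension r (\<sigma> i) s (length g) = (-1) ^ ((s + 1) * (i + \<sigma> i)) * (-1) ^ suspension r i s (length g)"
      unfolding power_add [symmetric] suspension_def
      by (rule neg_one_power_eqI) (cases "even s"; cases "even i"; cases "even (\<sigma> i)"; simp)
    then show ?case
      by (simp only: act_oriented [OF \<sigma>] act_oriented [OF \<tau>] pcomp_oriented [OF i sub] pcomp_oriented [OF \<sigma>_i [OF i \<sigma> \<tau>] sub']
        act_oriented_extend [OF block_permutes [OF i \<sigma> \<tau>]] perm_sign_block [OF i \<sigma> \<tau>] ins
        surj_pcomp_left_linear surj_pcomp_right_linear surj_act_linear frag_cmul_cmul mult_ac length_map)
  qed simp_all
qed simp_all

text \<open>
  On words this is \<open>ins_assoc_seq\<close>, whose markers are the values \<open>i\<close> of \<open>f\<close> and \<open>j\<close> of \<open>g\<close>. The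
  suspension signs of the two sides have the same parity.
\<close>

lemma surj_assoc_seq:
  assumes i: "i \<in> {1..r}" and j: "j \<in> {1..s}" and x: "supp x \<subseteq> basis r m"
    and y: "supp y \<subseteq> basis s n" and z: "supp z \<subseteq> basis t l"
  shows "surj_pcomp (r + s - 1) (i - 1 + j) t (surj_pcomp r i s x y) z =
    surj_pcomp r i (s + t - 1) x (surj_pcomp s j t y z)"
  using x
proof (induction x rule: chain_induct)
  case (gen f)
  note f = gen
  show ?case
    using y
  proof (induction y rule: chain_induct)
    case (gen g)
    note g = gen
    show ?case
      using z
    proof (induction z rule: chain_induct)
      case (gen h)
      have sub: "set f \<subseteq> {1..r}" "set g \<subseteq> {1..s}" "set h \<subseteq> {1..t}" using f g gen by simp_all
      have ij: "i - 1 + j \<in> {1..r + s - 1}" using i j by auto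
      have w1: "set u \<subseteq> {1..r + s - 1}" if "u \<in> supp (ins_val i s f g)" for u
        by (rule keys_ins_val(1) [OF that i sub(1,2)])
      have w2: "set u \<subseteq> {1..s + t - 1} \<and> Suc (length u) = length g + length h" if "u \<in> supp (ins_val j t g h)" for u
        using keys_ins_val [OF that j sub(2,3)] by blast
      have ar: "r + (s + t - 1) - 1 = r + s - 1 + t - 1" using j by auto
      have ins: "frag_extend (\<lambda>u. ins_val (i - 1 + j) t u h) (ins_val i s f g) =
          frag_extend (ins_val i (s + t - 1) f) (ins_val j t g h)"
      proof (rule ins_assoc_seq)
        show "v \<noteq> i \<Longrightarrow> val_shift i s v \<noteq> i - 1 + j \<and> val_shift (i - 1 + j) t (val_shift i s v) = val_shift i (s + t - 1) v" for v
          using i j by (auto simp: val_shift_def)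
        show "x \<noteq> j \<Longrightarrow> val_block i x \<noteq> i - 1 + j \<and> val_shift (i - 1 + j) t (val_block i x) = val_block i (val_shift j t x)" for x
          using i j by (auto simp: val_shift_def val_block_def)
        show "val_block (i - 1 + j) u = val_block i (val_block j u)" for u
          using i j by (auto simp: val_block_def)
      qed (simp add: val_block_def)
      \<comment> \<open>The arities are written as successors because the next step has to decide the
          parity of the truncated differences \<open>i - 1\<close> and \<open>s + t - 1\<close>.\<close>
      obtain i' s' where i': "i = Suc i'" and s': "s = Suc s'" using i j by (cases i; cases s) auto
      have sgn: "(-1 :: int) ^ suspension r i s (length g) * (-1) ^ suspension (r + s - 1) (i - 1 + j) t (length h) =
        (-1) ^ suspension s j t (length h) * (-1) ^ suspension r i (s + t - 1) (length g + length h + 1)"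
        unfolding power_add [symmetric] suspension_def i' s'
        by (rule neg_one_power_eqI)
           (cases "even r"; cases "even i'"; cases "even s'"; cases "even t"; cases "even j";
            cases "even (length g)"; cases "even (length h)"; simp)
      show ?case
        by (simp only: pcomp_oriented [OF i sub(1,2)] pcomp_oriented [OF j sub(2,3)] surj_pcomp_left_linear surj_pcomp_right_linear
          pcomp_oriented_extend_left [OF ij w1 sub(3)] pcomp_oriented_extend_right [OF i sub(1) w2] frag_cmul_cmul ins sgn ar)
    qed simp_all
  qed simp_all
qed simp_all

lemma ins_cong_right: "\<forall>x\<in>set g. \<beta> x = \<beta>' x \<Longrightarrow> ins z \<alpha> \<beta> f g = ins z \<alpha> \<beta>' f g"
  using ins_map_cong [of f z id \<alpha> \<alpha> g \<beta> id \<beta>'] by simp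

text \<open>
  The renamings are changed at values outside the words, where they could collide with a marker:
  the assumptions of \<open>ins_assoc_par\<close> concern all letters.
\<close>

lemma ins_val_assoc_par:
  assumes i: "i \<in> {1..r}" and k: "k \<in> {1..r}" "i < k" and g: "set g \<subseteq> {1..s}" and h: "set h \<subseteq> {1..t}"
  shows "frag_extend (\<lambda>u. ins_val (k + s - 1) t u h) (ins_val i s f g) =
    frag_cmul ((-1) ^ ((length g + 1) * (length h + 1))) (frag_extend (\<lambda>u. ins_val i s u g) (ins_val k t f h))"
proof -
  let ?\<beta> = "\<lambda>x. if x \<in> {1..s} then val_block i x else 0" and ?\<gamma> = "\<lambda>x. if x \<in> {1..t} then val_block k x else 0"
  have ge: "x \<in> set g \<Longrightarrow> 1 \<le> x \<and> x \<le> s" and he: "x \<in> set h \<Longrightarrow> 1 \<le> x \<and> x \<le> t" for x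
    using g h by auto
  have sk: "val_shift i s k = k + s - 1" "val_shift k t i = i" using k by (simp_all add: val_shift_def)
  have "ins_val i s f g = ins i (val_shift i s) ?\<beta> f g"
    by (rule ins_cong_right) (use ge in auto)
  moreover have "ins_val k t f h = ins k (val_shift k t) ?\<gamma> f h"
    by (rule ins_cong_right) (use he in auto)
  moreover have "ins_val (k + s - 1) t u h = ins (val_shift i s k) (val_shift (k + s - 1) t) (\<lambda>x. val_shift i s (?\<gamma> x)) u h" for u
    unfolding sk by (rule ins_cong_right, rule ballI, drule he) (use i k in \<open>auto simp: val_shift_def val_block_def\<close>)
  moreover have "ins_val i s u g = ins (val_shift k t i) (val_shift i s) (\<lambda>x. val_shift (k + s - 1) t (?\<beta> x)) u g" for u
    unfolding sk by (rule ins_cong_right, rule ballI, drule ge) (use i k in \<open>auto simp: val_shift_def val_block_def\<close>)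
  moreover have "frag_extend (\<lambda>u. ins (val_shift i s k) (val_shift (k + s - 1) t) (\<lambda>x. val_shift i s (?\<gamma> x)) u h) (ins i (val_shift i s) ?\<beta> f g) =
    frag_cmul ((-1) ^ ((length g + 1) * (length h + 1)))
     (frag_extend (\<lambda>u. ins (val_shift k t i) (val_shift i s) (\<lambda>x. val_shift (k + s - 1) t (?\<beta> x)) u g) (ins k (val_shift k t) ?\<gamma> f h))"
  proof (rule ins_assoc_par)
    show "i \<noteq> k" using k by simp
    show "v \<noteq> i \<Longrightarrow> v \<noteq> k \<Longrightarrow> val_shift i s v \<noteq> val_shift i s k \<and> val_shift k t v \<noteq> val_shift k t i \<and>
         val_shift (k + s - 1) t (val_shift i s v) = val_shift i s (val_shift k t v)" for v
      using i k by (auto simp: val_shift_def)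
    show "?\<beta> x \<noteq> val_shift i s k \<and> val_shift (k + s - 1) t (?\<beta> x) = val_shift (k + s - 1) t (?\<beta> x)" for x
      unfolding sk using i k by (auto simp: val_block_def)
    show "?\<gamma> x \<noteq> val_shift k t i \<and> val_shift i s (?\<gamma> x) = val_shift i s (?\<gamma> x)" for x
      unfolding sk using i k by (auto simp: val_block_def)
  qed
  ultimately show ?thesis by (simp only:)
qed

text \<open>
  The suspension signs turn the Koszul sign of \<open>ins_assoc_par\<close>, which is formed with lengths,
  into the one formed with degrees.
\<close>

lemma surj_assoc_par:
  assumes i: "i \<in> {1..r}" and k: "k \<in> {1..r}" and ik: "i < k" and x: "supp x \<subseteq> basis r m"
    and y: "supp y \<subseteq> basis s n" and z: "supp z \<subseteq> basis t l"
  shows "surj_pcomp (r + s - 1) (k + s - 1) t (surj_pcomp r i s x y) z =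
    frag_cmul (int_sign (n * l)) (surj_pcomp (r + t - 1) i s (surj_pcomp r k t x z) y)"
  using x
proof (induction x rule: chain_induct)
  case (gen f)
  note f = gen
  show ?case
    using y
  proof (induction y rule: chain_induct)
    case (gen g)
    note g = gen
    show ?case
      using z
    proof (induction z rule: chain_induct)
      case (gen h)
      have sub: "set f \<subseteq> {1..r}" "set g \<subseteq> {1..s}" "set h \<subseteq> {1..t}" using f g gen by simp_all
      have ks: "k + s - 1 \<in> {1..r + s - 1}" "i \<in> {1..r + t - 1}" using i k ik by auto
      have w1: "set u \<subseteq> {1..r + s - 1}" if "u \<in> supp (ins_val i s f g)" for u
        by (rule keys_ins_val(1) [OF that i sub(1,2)])
      have w2: "set u \<subseteq> {1..r + t - 1}" if "u \<in> supp (ins_val k t f h)" for u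
        by (rule keys_ins_val(1) [OF that k sub(1,3)])
      have ar: "r + t - 1 + s - 1 = r + s - 1 + t - 1" using i k ik by auto
      \<comment> \<open>Again to decide the parity of truncated differences.\<close>
      obtain r' k' where r': "r = Suc r'" and k': "k = Suc k'" using i k ik by (cases r; cases k) auto
      have "even n \<longleftrightarrow> (even (length g) \<longleftrightarrow> even s)" "even l \<longleftrightarrow> (even (length h) \<longleftrightarrow> even t)"
        using g(3) gen(3) by presburger+
      then have "int_sign (n * l) = (-1) ^ ((length g + s) * (length h + t))"
        by (simp add: int_sign_def minus_one_power_iff)
      then have "int_sign (n * l) * ((-1) ^ suspension r k t (length h) * (-1) ^ suspension (r + t - 1) i s (length g)) =
        (-1) ^ ((length g + s) * (length h + t) + (suspension r k t (length h) + suspension (r + t - 1) i s (length g)))"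
        by (simp add: power_add)
      also have "\<dots> = (-1) ^ (suspension r i s (length g) + suspension (r + s - 1) (k + s - 1) t (length h) + (length g + 1) * (length h + 1))"
        unfolding suspension_def r' k'
        by (rule neg_one_power_eqI)
           (cases "even r'"; cases "even i"; cases "even k'"; cases "even s"; cases "even t";
            cases "even (length g)"; cases "even (length h)"; simp)
      finally have sgn: "int_sign (n * l) * ((-1) ^ suspension r k t (length h) * (-1) ^ suspension (r + t - 1) i s (length g)) =
        (-1) ^ suspension r i s (length g) * ((-1) ^ suspension (r + s - 1) (k + s - 1) t (length h) * (-1) ^ ((length g + 1) * (length h + 1)))"
        by (simp only: power_add mult.assoc)
      show ?case
        by (simp only: pcomp_oriented [OF i sub(1,2)] pcomp_oriented [OF k sub(1,3)] surj_pcomp_left_linear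
          pcomp_oriented_extend_left [OF ks(1) w1 sub(3)] pcomp_oriented_extend_left [OF ks(2) w2 sub(2)] frag_cmul_cmul sgn
          ins_val_assoc_par [OF i k ik sub(2,3)] frag_linear ar)
    qed (simp_all add: frag_linear)
  qed (simp_all add: frag_linear)
qed (simp_all add: frag_linear)

lemma unit_oriented: "frag_of [1] = oriented 1 [1]"
  by (simp add: oriented_def seq_class_def nondegenerate_def orient_def)

lemma surj_unit_left:
  "supp y \<subseteq> basis s n \<Longrightarrow> surj_pcomp 1 1 s (frag_of [1]) y = y"
proof (induction y rule: chain_induct)
  case (gen g)
  have "ins_val 1 s [1] g = frag_of g"
    unfolding ins_single_left by (simp add: map_idI val_block_def)
  moreover have "even (suspension 1 1 s (length g))" by (simp add: suspension_def)
  ultimately show ?case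
    using gen unfolding unit_oriented by (subst pcomp_oriented) auto
qed simp_all

lemma surj_unit_right:
  assumes i: "i \<in> {1..r}"
  shows "supp x \<subseteq> basis r m \<Longrightarrow> surj_pcomp r i 1 x (frag_of [1]) = x"
proof (induction x rule: chain_induct)
  case (gen f)
  have "map (\<lambda>v. if v = i then val_block i 1 else val_shift i 1 v) f = f"
    by (intro map_idI) (use i in \<open>auto simp: val_block_def val_shift_def\<close>)
  then have "ins_val i 1 f [1] = frag_of f"
    using i gen(1) by (simp only: ins_single_right if_True)
  moreover have "even (suspension r i 1 1)" by (simp add: suspension_def)
  ultimately show ?case
    using gen i unfolding unit_oriented by (subst pcomp_oriented) auto
qed simp_all

lemma surj_operad_simps [simp]:
  "chain surj_operad r n = free_Abelian_group (basis r n)" "bdry surj_operad r n = surj_bdry r"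
  "act surj_operad r n = surj_act r" "pcomp surj_operad r m i s n = surj_pcomp r i s" "opunit surj_operad = frag_of [1]"
  by (simp_all add: surj_operad_def surj_chain_basis)

text \<open>
  Stated for any family of groups of permutations, as it is needed for the symmetric and the
  cyclic groups.
\<close>

lemma surj_gamma_module:
  assumes G: "\<And>r. carrier (G r) \<subseteq> {p. p permutes {1..r}}" "\<And>r. \<one>\<^bsub>G r\<^esub> = id" "\<And>r. mult (G r) = (\<circ>)"
  shows "gamma_module G surj_operad"
proof (rule gamma_module.intro)
  have perm: "g \<in> carrier (G r) \<Longrightarrow> g permutes {1..r}" for g r using G(1) by blast
  show "comm_group (chain surj_operad r n)" for r n by (simp add: abelian_free_Abelian_group)
  show "bdry surj_operad r n \<in> hom (chain surj_operad r n) (chain surj_operad r (n - 1))" for r n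
    by (rule homI) (simp_all add: keys_bdry)
  show "bdry surj_operad r (n - 1) (bdry surj_operad r n x) = \<one>\<^bsub>chain surj_operad r (n - 1 - 1)\<^esub>"
    if "x \<in> carrier (chain surj_operad r n)" for x r n
    using surj_bdry_bdry that by simp
  show "act surj_operad r n g \<in> hom (chain surj_operad r n) (chain surj_operad r n)" if "g \<in> carrier (G r)" for g r n
    by (rule homI) (simp_all add: keys_act [OF perm [OF that]])
  show "act surj_operad r n \<one>\<^bsub>G r\<^esub> x = x" if "x \<in> carrier (chain surj_operad r n)" for r n x
    using surj_act_id that by (simp only: G(2) surj_operad_simps carrier_free_Abelian_group_iff)
  show "act surj_operad r n (g \<otimes>\<^bsub>G r\<^esub> k) x = act surj_operad r n g (act surj_operad r n k x)"
    if "g \<in> carrier (G r)" "k \<in> carrier (G r)" "x \<in> carrier (chain surj_operad r n)" for g k r n x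
    using surj_act_comp [OF perm [OF that(1)] perm [OF that(2)]] that(3)
    by (simp only: G(3) surj_operad_simps carrier_free_Abelian_group_iff)
  show "bdry surj_operad r n (act surj_operad r n g x) = act surj_operad r (n - 1) g (bdry surj_operad r n x)"
    if "g \<in> carrier (G r)" "x \<in> carrier (chain surj_operad r n)" for g r n x
    using surj_bdry_act [OF perm [OF that(1)]] that(2) by simp
qed

lemma surj_sym_module: "gamma_module sym_group surj_operad"
  by (rule surj_gamma_module) (auto simp: sym_group_def)

lemma operad_surj: "operad surj_operad"
proof (intro operad.intro surj_sym_module operad_axioms.intro)
  show "(\<lambda>x. pcomp surj_operad r m i s n x y) \<in> hom (chain surj_operad r m) (chain surj_operad (r + s - 1) (m + n))"
    if "i \<in> {1..r}" "y \<in> carrier (chain surj_operad s n)" for i r s n m y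
    by (rule homI) (use keys_pcomp [OF that(1)] that(2) in simp_all)
  show "(\<lambda>y. pcomp surj_operad r m i s n x y) \<in> hom (chain surj_operad s n) (chain surj_operad (r + s - 1) (m + n))"
    if "i \<in> {1..r}" "x \<in> carrier (chain surj_operad r m)" for i r s n m x
    by (rule homI) (use keys_pcomp [OF that(1)] that(2) in simp_all)
  show "bdry surj_operad (r + s - 1) (m + n) (pcomp surj_operad r m i s n x y) =
      pcomp surj_operad r (m - 1) i s n (bdry surj_operad r m x) y \<otimes>\<^bsub>chain surj_operad (r + s - 1) (m + n - 1)\<^esub>
      sign_pow (chain surj_operad (r + s - 1) (m + n - 1)) m (pcomp surj_operad r m i s (n - 1) x (bdry surj_operad s n y))"
    if that: "i \<in> {1..r}" "x \<in> carrier (chain surj_operad r m)" "y \<in> carrier (chain surj_operad s n)" for i r s m n x y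
  proof -
    have "supp (surj_pcomp r i s x (surj_bdry s y)) \<subseteq> basis (r + s - 1) (m + (n - 1))"
      using keys_pcomp [OF that(1) _ keys_bdry] that(2,3) by simp
    moreover have "m + (n - 1) = m + n - 1" by simp
    ultimately have "supp (surj_pcomp r i s x (surj_bdry s y)) \<subseteq> basis (r + s - 1) (m + n - 1)" by (simp only:)
    then show ?thesis
      using surj_leibniz [OF that(1)] that(2,3) by (simp only: surj_operad_simps carrier_free_Abelian_group_iff sign_pow_surj mult_free_Abelian_group)
  qed
  show "pcomp surj_operad r m (\<sigma> i) s n (act surj_operad r m \<sigma> x) (act surj_operad s n \<tau> y) =
      act surj_operad (r + s - 1) (m + n) (block_perm s i \<sigma> \<tau>) (pcomp surj_operad r m i s n x y)"
    if "i \<in> {1..r}" "\<sigma> \<in> carrier (sym_group r)" "\<tau> \<in> carrier (sym_group s)"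
      "x \<in> carrier (chain surj_operad r m)" "y \<in> carrier (chain surj_operad s n)" for i r s \<sigma> \<tau> x y m n
    using surj_pcomp_act that by (simp only: surj_operad_simps carrier_free_Abelian_group_iff sym_group_carrier)
  show "pcomp surj_operad (r + s - 1) (m + n) (i - 1 + j) t l (pcomp surj_operad r m i s n x y) z =
      pcomp surj_operad r m i (s + t - 1) (n + l) x (pcomp surj_operad s n j t l y z)"
    if "i \<in> {1..r}" "j \<in> {1..s}" "x \<in> carrier (chain surj_operad r m)" "y \<in> carrier (chain surj_operad s n)"
      "z \<in> carrier (chain surj_operad t l)" for i r s j x y z m n l t
    using surj_assoc_seq that by (simp only: surj_operad_simps carrier_free_Abelian_group_iff)
  show "pcomp surj_operad (r + s - 1) (m + n) (k + s - 1) t l (pcomp surj_operad r m i s n x y) z =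
      sign_pow (chain surj_operad (r + s - 1 + t - 1) (m + n + l)) (n * l)
        (pcomp surj_operad (r + t - 1) (m + l) i s n (pcomp surj_operad r m k t l x z) y)"
    if that: "i \<in> {1..r}" "k \<in> {1..r}" "i < k" "x \<in> carrier (chain surj_operad r m)" "y \<in> carrier (chain surj_operad s n)"
      "z \<in> carrier (chain surj_operad t l)" for i r s k x y z m n l t
  proof -
    have xyz: "supp x \<subseteq> basis r m" "supp y \<subseteq> basis s n" "supp z \<subseteq> basis t l"
      using that(4-6) by simp_all
    have "i \<in> {1..r + t - 1}" using that(1-3) by auto
    from keys_pcomp [OF this keys_pcomp [OF that(2) xyz(1,3)] xyz(2)]
    have "supp (surj_pcomp (r + t - 1) i s (surj_pcomp r k t x z) y) \<subseteq> basis (r + t - 1 + s - 1) (m + l + n)" .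
    moreover have "r + t - 1 + s - 1 = r + s - 1 + t - 1" "m + l + n = m + n + l" using that(1-3) by auto
    ultimately have "supp (surj_pcomp (r + t - 1) i s (surj_pcomp r k t x z) y) \<subseteq> basis (r + s - 1 + t - 1) (m + n + l)"
      by (simp only:)
    then show ?thesis
      using surj_assoc_par [OF that(1-3) xyz] by (simp only: surj_operad_simps sign_pow_surj)
  qed
  show "opunit surj_operad \<in> carrier (chain surj_operad 1 0)"
    by (simp add: basis_def nondegenerate_def)
  show "bdry surj_operad 1 0 (opunit surj_operad) = \<one>\<^bsub>chain surj_operad 1 (- 1)\<^esub>"
  proof -
    have "oriented 1 [] = 0" by (simp add: oriented_degenerate nondegenerate_def)
    then show ?thesis
      unfolding surj_operad_simps unit_oriented by (simp add: bdry_oriented)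
  qed
  show "pcomp surj_operad 1 0 1 s n (opunit surj_operad) y = y" if "y \<in> carrier (chain surj_operad s n)" for s n y
    using surj_unit_left that by (simp only: surj_operad_simps carrier_free_Abelian_group_iff)
  show "pcomp surj_operad r m i 1 0 x (opunit surj_operad) = x" if "i \<in> {1..r}" "x \<in> carrier (chain surj_operad r m)" for i r m x
    using surj_unit_right that by (simp only: surj_operad_simps carrier_free_Abelian_group_iff)
qed

section \<open>The contracting homotopy\<close>

lemma frag_of_Nil_oriented: "frag_of [] = oriented 0 []"
  by (simp add: oriented_def seq_class_def nondegenerate_def orient_def)

lemma h_linear [simp]:
  "h_i 0 = 0" "h_i (x - y) = h_i x - h_i y" "h_i (x + y) = h_i x + h_i y" "h_i (frag_cmul c x) = frag_cmul c (h_i x)"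
  "h_p 0 = 0" "h_p (x - y) = h_p x - h_p y" "h_p (x + y) = h_p x + h_p y" "h_p (frag_cmul c x) = frag_cmul c (h_p x)"
  "h_s 0 = 0" "h_s (x - y) = h_s x - h_s y" "h_s (x + y) = h_s x + h_s y" "h_s (frag_cmul c x) = frag_cmul c (h_s x)"
  by (simp_all add: h_i_def h_p_def h_s_def frag_linear)

lemma basis_induct [consumes 1, case_names zero diff one]:
  assumes x: "supp x \<subseteq> basis r n"
    and "P 0" and "\<And>a b. P a \<Longrightarrow> P b \<Longrightarrow> P (a - b)"
    and "\<And>w. w \<in> basis r n \<Longrightarrow> P (frag_of w)"
  shows "P x"
  using x by (induction x rule: frag_induction) (use assms in auto)

text \<open>
  If \<open>1\<close> occurs more than once there are no cuts of the empty sequence; if it occurs once, the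
  empty sequence replaces it. So \<open>p\<close> is composition with a cycle, and it is a chain map by the
  Leibniz rule.
\<close>

lemma h_p_eq_pcomp:
  "supp x \<subseteq> basis (Suc r) n \<Longrightarrow> h_p x = surj_pcomp (Suc r) 1 0 x (frag_of [])"
proof (induction x rule: basis_induct)
  case (one f)
  then have f: "set f = {1..Suc r}" "distinct_adj f" by (auto simp: basis_def nondegenerate_def)
  then have one: "1 \<in> set f" by simp
  let ?t = "map (\<lambda>v. v - 1) (removeAll 1 f)"
  have sub: "substitute 1 0 f [[]] = map (\<lambda>v. v - 1) (removeAll 1 f)" if "count_list f 1 = 1" "\<forall>v\<in>set f. v \<ge> 1" for f
  proof -
    have *: "substitute 1 0 f gs = map (\<lambda>v. v - 1) f" if "1 \<notin> set f" "\<forall>v\<in>set f. v \<ge> 1" for f gs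
      using that by (induction f) auto
    show ?thesis using that
    proof (induction f)
      case (Cons v f)
      show ?case
      proof (cases "v = 1")
        case True
        then have "1 \<notin> set f" using Cons.prems by (simp add: count_list_0_iff)
        then show ?thesis using * [of f "[]"] True Cons.prems by (simp add: removeAll_id)
      qed (use Cons in auto)
    qed simp
  qed
  show ?case
  proof (cases "mdeg f 1 = 0")
    case True
    then have c: "count_list f 1 = 1" using Suc_count_list_minus_1 [OF one] by (simp add: mdeg_def)
    have "set ?t = {1..r}"
    proof (rule Set.set_eqI)
      fix y
      have "y \<in> set ?t \<longleftrightarrow> (\<exists>v\<in>{1..Suc r}. v \<noteq> 1 \<and> y = v - 1)" using f(1) by auto
      also have "\<dots> \<longleftrightarrow> y \<in> {1..r}"
      proof
        assume "y \<in> {1..r}"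
        then show "\<exists>v\<in>{1..Suc r}. v \<noteq> 1 \<and> y = v - 1" by (intro bexI [of _ "Suc y"]) auto
      qed auto
      finally show "y \<in> set ?t \<longleftrightarrow> y \<in> {1..r}" .
    qed
    then have "nondegenerate r ?t \<longleftrightarrow> distinct_adj ?t" by (simp add: nondegenerate_def)
    moreover have pos: "\<forall>v\<in>set f. v \<ge> 1" using f(1) by simp
    have "surj_pcomp (Suc r) 1 0 (frag_of f) (frag_of []) = seq_class r (substitute 1 0 f [[]])"
      unfolding surj_pcomp_def frag_extend_of True cuts_0 by (simp add: pieces_Nil cut_exponent_def)
    then have "surj_pcomp (Suc r) 1 0 (frag_of f) (frag_of []) = seq_class r ?t"
      unfolding sub [OF c pos] .
    moreover have "h_p (frag_of f) = (if distinct_adj ?t then frag_of ?t else 0)"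
      unfolding h_p_def frag_extend_of Let_def using c by (simp only: simp_thms)
    ultimately show ?thesis by (simp only: seq_class_def)
  next
    case False
    then have "count_list f 1 \<noteq> 1" by (simp add: mdeg_def)
    moreover have "cuts (mdeg f 1) [] = {}" using False by (auto simp: cuts_def)
    ultimately show ?thesis
      by (simp add: h_p_def surj_pcomp_def Let_def)
  qed
qed simp_all

lemma keys_frag_of_Nil: "supp (frag_of []) \<subseteq> basis 0 0"
  by (simp add: basis_def nondegenerate_def)

lemma keys_h_p: "supp x \<subseteq> basis (Suc r) n \<Longrightarrow> supp (h_p x) \<subseteq> basis r n"
  using keys_pcomp [of 1 "Suc r" x n "frag_of []" 0 0] keys_frag_of_Nil by (simp add: h_p_eq_pcomp)

lemma bdry_h_p:
  assumes "supp x \<subseteq> basis (Suc r) n"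
  shows "surj_bdry r (h_p x) = h_p (surj_bdry (Suc r) x)"
proof -
  have "surj_bdry 0 (frag_of []) = 0" by (simp add: frag_of_Nil_oriented bdry_oriented)
  then show ?thesis
    using surj_leibniz [of 1 "Suc r" x n "frag_of []" 0 0] assms keys_frag_of_Nil
    by (simp add: h_p_eq_pcomp [OF assms] h_p_eq_pcomp [OF keys_bdry [OF assms]])
qed

lemma nondegenerate_i: "set w \<subseteq> {1..r} \<Longrightarrow> nondegenerate (Suc r) (1 # map Suc w) \<longleftrightarrow> nondegenerate r w"
proof -
  assume w: "set w \<subseteq> {1..r}"
  have "insert 1 (Suc ` set w) = {1..Suc r} \<longleftrightarrow> set w = {1..r}"
  proof
    assume eq: "insert 1 (Suc ` set w) = {1..Suc r}"
    have "{1..r} \<subseteq> set w"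
    proof
      fix v assume v: "v \<in> {1..r}"
      then have "Suc v \<in> insert 1 (Suc ` set w)" unfolding eq by simp
      then show "v \<in> set w" using v by auto
    qed
    then show "set w = {1..r}" using w by simp
  next
    assume "set w = {1..r}"
    then have "Suc ` set w = {2..Suc r}" by (simp add: image_Suc_atLeastAtMost numeral_2_eq_2)
    then show "insert 1 (Suc ` set w) = {1..Suc r}" by auto
  qed
  moreover have "distinct_adj (1 # map Suc w) \<longleftrightarrow> distinct_adj w"
  proof -
    have "w \<noteq> [] \<Longrightarrow> hd w \<ge> 1" using w hd_in_set by fastforce
    then show ?thesis by (cases w) (auto simp: distinct_adj_Cons distinct_adj_map_iff hd_map)
  qed
  ultimately show ?thesis by (simp add: nondegenerate_def)
qed

lemma inversions_map_Suc: "inversions (map Suc w) = inversions w"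
  by (induction w) (simp_all add: filter_map comp_def)

lemma h_i_oriented:
  assumes w: "set w \<subseteq> {1..r}"
  shows "h_i (oriented r w) = frag_cmul ((-1) ^ length w) (oriented (Suc r) (1 # map Suc w))"
proof (cases "nondegenerate r w")
  case False
  then show ?thesis using nondegenerate_i [OF w] by (simp add: oriented_degenerate)
next
  case True
  have "filter (\<lambda>y. y < 1) (map Suc w) = []" by (simp add: filter_empty_conv)
  moreover have "(\<Sum>x\<leftarrow>map Suc w. x + 1) = (\<Sum>x\<leftarrow>w. x + 1) + length w" by (induction w) auto
  ultimately have "orient (1 # map Suc w) = orient w * (-1) ^ length w"
    by (simp add: orient_def inversions_map_Suc power_add del: map_map)
  then have "(-1) ^ length w * orient (1 # map Suc w) = orient w * ((-1) ^ length w * (-1) ^ length w)"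
    by (simp add: mult_ac)
  also have "(-1 :: int) ^ length w * (-1) ^ length w = 1" by (simp flip: power_add mult_2)
  finally have "(-1) ^ length w * orient (1 # map Suc w) = orient w" by simp
  then show ?thesis
    using True nondegenerate_i [OF w] by (simp add: oriented_def seq_class_def h_i_def frag_extend_cmul)
qed

lemma h_i_oriented_extend:
  assumes "\<And>u. u \<in> supp W \<Longrightarrow> set u \<subseteq> {1..r} \<and> Suc (length u) = l"
  shows "h_i (frag_extend (oriented r) W) = - frag_cmul ((-1) ^ l) (frag_extend (oriented (Suc r)) (frag_extend (\<lambda>u. frag_of (1 # map Suc u)) W))"
proof -
  have "h_i (frag_extend (oriented r) W) = frag_extend (\<lambda>u. h_i (oriented r u)) W"
    by (rule frag_extend_linear_comp) simp_all
  also have "\<dots> = frag_extend (\<lambda>u. frag_cmul (- ((-1) ^ l)) (oriented (Suc r) (1 # map Suc u))) W"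
  proof (rule frag_extend_eq)
    fix u assume u: "u \<in> supp W"
    then have "(-1 :: int) ^ length u = - ((-1) ^ l)" using assms [OF u] by auto
    then show "h_i (oriented r u) = frag_cmul (- ((-1) ^ l)) (oriented (Suc r) (1 # map Suc u))"
      using h_i_oriented [of u r] assms [OF u] by simp
  qed
  finally show ?thesis by (simp add: frag_extend_fun_cmul frag_extend_frag_extend)
qed

lemma keys_h_i: "supp x \<subseteq> basis r n \<Longrightarrow> supp (h_i x) \<subseteq> basis (Suc r) n"
proof (induction x rule: basis_induct)
  case (one w)
  then show ?case using nondegenerate_i [of w r] by (simp add: h_i_def basis_def nondegenerate_def)
qed (simp_all add: keys_diff_subset)

text \<open>
  The term of the boundary that removes the new first letter vanishes, because the value \<open>1\<close> is
  then missing.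
\<close>

lemma bdry_h_i:
  "supp x \<subseteq> basis r n \<Longrightarrow> surj_bdry (Suc r) (h_i x) = h_i (surj_bdry r x)"
proof (induction x rule: chain_induct)
  case (gen w)
  have sub: "set w \<subseteq> {1..r}" "set (1 # map Suc w) \<subseteq> {1..Suc r}" using gen(1) by auto
  have kw: "set u \<subseteq> {1..r} \<and> Suc (length u) = length w" if "u \<in> supp (word_bdry w)" for u
    using keys_word_bdry [OF that] sub by auto
  have "1 \<notin> set (map Suc w)" using gen(1) by auto
  then have "\<not> nondegenerate (Suc r) (map Suc w)" unfolding nondegenerate_def by (metis atLeastAtMost_iff le_add1 order_refl plus_1_eq_Suc)
  then have "oriented (Suc r) (map Suc w) = 0" by (rule oriented_degenerate)
  moreover have "word_bdry (1 # map Suc w) = frag_of (map Suc w) - frag_extend (\<lambda>u. frag_of (1 # map Suc u)) (word_bdry w)"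
    by (simp add: word_bdry_map prepend_extend)
  ultimately show ?case
    by (simp only: h_i_oriented [OF sub(1)] bdry_oriented [OF sub(1)] surj_bdry_linear bdry_oriented [OF sub(2)] h_i_oriented_extend [OF kw]
        frag_linear frag_extend_of) simp
qed simp_all

text \<open>
  On words that contain a \<open>1\<close> the homotopy puts another \<open>1\<close> in front. The correction term is
  needed for words without a \<open>1\<close>: these represent zero, but putting a \<open>1\<close> in front of them does
  not.
\<close>

lemma h_s_oriented:
  assumes u: "set u \<subseteq> {1..Suc r}"
  shows "h_s (oriented (Suc r) u) = oriented (Suc r) (1 # u) - frag_extend (oriented (Suc r)) (prepend 1 (keep 1 id u))"
proof (cases "1 \<in> set u")
  case False
  then have "set u \<noteq> {1..Suc r}" by (metis atLeastAtMost_iff le_add1 order_refl plus_1_eq_Suc)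
  then have "oriented (Suc r) u = 0" by (simp add: oriented_degenerate nondegenerate_def)
  then show ?thesis using False by (simp add: keep_def)
next
  case True
  have nd: "nondegenerate (Suc r) (1 # u) \<longleftrightarrow> nondegenerate (Suc r) u \<and> hd u \<noteq> 1"
    using True by (auto simp: nondegenerate_def distinct_adj_Cons insert_absorb)
  have "filter (\<lambda>y. y < 1) u = []" using u by (auto simp: filter_empty_conv)
  then have "orient (1 # u) = orient u" by (simp add: orient_def)
  then have "h_s (oriented (Suc r) u) = oriented (Suc r) (1 # u)"
    using True nd by (auto simp: oriented_def seq_class_def h_s_def frag_extend_cmul)
  then show ?thesis using True by (simp add: keep_def)
qed

lemma h_s_oriented_extend:
  assumes "\<And>u. u \<in> supp W \<Longrightarrow> set u \<subseteq> {1..Suc r}"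
  shows "h_s (frag_extend (oriented (Suc r)) W) =
    frag_extend (oriented (Suc r)) (prepend 1 W) - frag_extend (oriented (Suc r)) (prepend 1 (frag_extend (keep 1 id) W))"
proof -
  have "h_s (frag_extend (oriented (Suc r)) W) = frag_extend (\<lambda>u. h_s (oriented (Suc r) u)) W"
    by (rule frag_extend_linear_comp) simp_all
  also have "\<dots> = frag_extend (\<lambda>u. oriented (Suc r) (1 # u) - frag_extend (oriented (Suc r)) (prepend 1 (keep 1 id u))) W"
    by (rule frag_extend_eq) (rule h_s_oriented [OF assms])
  finally show ?thesis by (simp only: frag_extend_fun_diff extend_prepend frag_extend_frag_extend)
qed

lemma keys_h_s: "supp x \<subseteq> basis (Suc r) n \<Longrightarrow> supp (h_s x) \<subseteq> basis (Suc r) (n + 1)"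
proof (induction x rule: basis_induct)
  case (one w)
  from one have "set w = {1..Suc r}" "distinct_adj w" "int (length w) = n + int (Suc r)" by (auto simp: basis_def nondegenerate_def)
  note w = this
  have "1 # w \<in> basis (Suc r) (n + 1)" if "hd w \<noteq> 1"
  proof -
    have "set (1 # w) = {1..Suc r}" unfolding list.set w(1) by (rule insert_absorb) simp
    moreover have "distinct_adj (1 # w)" using w(2) that by (cases w) simp_all
    ultimately show ?thesis using w(3) by (simp add: basis_def nondegenerate_def)
  qed
  moreover have "w \<noteq> []" using w(1) by (intro notI) simp
  ultimately show ?case by (simp add: h_s_def)
qed (simp_all add: keys_diff_subset)

text \<open>
  The map \<open>i p\<close> moves the only \<open>1\<close> of a word to the front.
\<close>

lemma h_i_h_p_oriented:
  assumes w: "set w = {1..Suc r}"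
  shows "h_i (h_p (oriented (Suc r) w)) = - frag_cmul ((-1) ^ length w) (frag_extend (oriented (Suc r)) (prepend 1 (ins 1 id id w [])))"
proof -
  have sub: "set w \<subseteq> {1..Suc r}" "set [] \<subseteq> {1..0::nat}" "1 \<in> {1..Suc r}" using w by simp_all
  have keys: "set u \<subseteq> {1..r} \<and> Suc (length u) = length w" if "u \<in> supp (ins_val 1 0 w [])" for u
    using keys_ins_val [OF that sub(3,1,2)] by simp
  have "supp (oriented (Suc r) w) \<subseteq> basis (Suc r) (int (length w) - int (Suc r))"
    by (auto simp: oriented_def seq_class_def basis_def)
  then have "h_p (oriented (Suc r) w) = surj_pcomp (Suc r) 1 0 (oriented (Suc r) w) (oriented 0 [])"
    by (simp add: h_p_eq_pcomp frag_of_Nil_oriented)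
  also have "\<dots> = frag_extend (oriented r) (ins_val 1 0 w [])"
    unfolding pcomp_oriented [OF sub(3,1,2)] by (simp add: suspension_def)
  finally have "h_i (h_p (oriented (Suc r) w)) =
    - frag_cmul ((-1) ^ length w) (frag_extend (oriented (Suc r)) (frag_extend (\<lambda>u. frag_of (1 # map Suc u)) (ins_val 1 0 w [])))"
    by (simp only: h_i_oriented_extend [OF keys])
  also have "frag_extend (\<lambda>u. frag_of (1 # map Suc u)) (ins_val 1 0 w []) = prepend 1 (frag_extend (\<lambda>u. frag_of (map Suc u)) (ins_val 1 0 w []))"
    by (simp add: prepend_extend)
  also have "frag_extend (\<lambda>u. frag_of (map Suc u)) (ins_val 1 0 w []) = ins 1 id id w []"
    unfolding map_ins using ins_map_cong [of w 1 id id "\<lambda>v. Suc (val_shift 1 0 v)" "[]" id id "\<lambda>x. Suc (val_block 1 x)"] w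
    by (simp add: val_shift_def)
  finally show ?thesis .
qed

text \<open>
  The terms of the boundary of \<open>1 w\<close> other than \<open>w\<close> cancel against those of \<open>s\<close> applied to the
  boundary of \<open>w\<close>, except for the term in which the only \<open>1\<close> of \<open>w\<close> is removed. On the left
  there is then a \<open>1\<close> in front, and \<open>s\<close> has no such term. This is \<open>i p\<close> by \<open>keep_word_bdry\<close>.
\<close>

lemma h_s_homotopy:
  "supp x \<subseteq> basis (Suc r) n \<Longrightarrow>
     surj_bdry (Suc r) (h_s x) + h_s (surj_bdry (Suc r) x) = x - h_i (h_p x)"
proof (induction x rule: chain_induct)
  case (gen w)
  have sub: "set w \<subseteq> {1..Suc r}" "set (1 # w) \<subseteq> {1..Suc r}" and one: "1 \<in> set w" using gen(1) by auto
  have kw: "set u \<subseteq> {1..Suc r}" if "u \<in> supp (word_bdry w)" for u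
    using keys_word_bdry [OF that] sub(1) by auto
  have "h_s (oriented (Suc r) w) = oriented (Suc r) (1 # w)"
    using h_s_oriented [OF sub(1)] one by (simp add: keep_def)
  then have "surj_bdry (Suc r) (h_s (oriented (Suc r) w)) = oriented (Suc r) w - frag_extend (oriented (Suc r)) (prepend 1 (word_bdry w))"
    by (simp only: bdry_oriented [OF sub(2)] word_bdry.simps frag_linear frag_extend_of)
  moreover have "h_s (surj_bdry (Suc r) (oriented (Suc r) w)) =
     frag_extend (oriented (Suc r)) (prepend 1 (word_bdry w)) - frag_extend (oriented (Suc r)) (prepend 1 (frag_extend (keep 1 id) (word_bdry w)))"
    by (simp only: bdry_oriented [OF sub(1)] h_s_oriented_extend [OF kw])
  moreover have "frag_extend (keep 1 id) (word_bdry w) = - frag_cmul ((-1) ^ length w) (ins 1 id id w [])"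
    using keep_word_bdry [of 1 id w id] one by (simp add: keep_def)
  ultimately show ?case
    unfolding h_i_h_p_oriented [OF gen(1)] by (simp only: prepend_linear frag_linear) simp
qed (simp_all add: algebra_simps)

lemma h_i_sum: "h_i (sum F A) = (\<Sum>k\<in>A. h_i (F k))"
  by (induction A rule: infinite_finite_induct) simp_all

lemma homotopy_simps:
  "homotopy 0 x = 0" "homotopy (Suc r) x = h_s x + h_i (homotopy r (h_p x))"
  unfolding homotopy_def sum.lessThan_Suc_shift h_i_sum by (simp_all add: funpow_swap1)

text \<open>
  The iterate \<open>p\<^sup>r\<close> takes values in \<open>\<X>(0)\<close>, which is spanned by the empty sequence.
\<close>

fun aug :: "nat \<Rightarrow> (nat list \<Rightarrow>\<^sub>0 int) \<Rightarrow> int" where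
  "aug 0 x = Poly_Mapping.lookup x []"
| "aug (Suc r) x = aug r (h_p x)"

lemma homotopy_0 [simp]: "homotopy r 0 = 0"
  by (induction r) (simp_all add: homotopy_simps)

lemma aug_linear [simp]: "aug r 0 = 0" "aug r (x - y) = aug r x - aug r y" "aug r (x + y) = aug r x + aug r y"
  "aug r (frag_cmul c x) = c * aug r x"
  by (induction r arbitrary: x y) (simp_all add: lookup_minus lookup_add)

lemma basis_0: "basis 0 n = (if n = 0 then {[]} else {})"
  by (auto simp: basis_def nondegenerate_def)

lemma keys_homotopy:
  "supp x \<subseteq> basis r n \<Longrightarrow> supp (homotopy r x) \<subseteq> basis r (n + 1)"
proof (induction r arbitrary: x)
  case (Suc r)
  have "supp (h_i (homotopy r (h_p x))) \<subseteq> basis (Suc r) (n + 1)"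
    by (rule keys_h_i [OF Suc.IH [OF keys_h_p [OF Suc.prems]]])
  with keys_h_s [OF Suc.prems] show ?case
    unfolding homotopy_simps by (meson Un_least keys_add order.trans)
qed (simp add: homotopy_simps)

lemma bdry_basis_0: "supp x \<subseteq> basis 0 n \<Longrightarrow> surj_bdry 0 x = 0"
  by (simp add: surj_bdry_def frag_extend_fun_0)

text \<open>
  This iterates \<open>h_s_homotopy\<close>, using \<open>h = s + i h p\<close> and that \<open>i\<close> and \<open>p\<close> are chain maps. In
  arity zero both sides vanish, because there the augmentation is the identity.
\<close>

lemma homotopy:
  "supp x \<subseteq> basis r n \<Longrightarrow>
     surj_bdry r (homotopy r x) + homotopy r (surj_bdry r x) = x - frag_cmul (aug r x) (frag_of [1..<Suc r])"
proof (induction r arbitrary: x n)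
  case 0
  have "x = frag_cmul (Poly_Mapping.lookup x []) (frag_of [])"
  proof (rule poly_mapping_eqI)
    fix w show "Poly_Mapping.lookup x w = Poly_Mapping.lookup (frag_cmul (Poly_Mapping.lookup x []) (frag_of [])) w"
      using 0 by (cases "w = []") (auto simp: basis_0 in_keys_iff split: if_split_asm)
  qed
  then show ?case by (simp add: homotopy_simps)
next
  case (Suc r)
  have p: "supp (h_p x) \<subseteq> basis r n" by (rule keys_h_p [OF Suc.prems])
  have "h_i (frag_of [1..<Suc r]) = frag_of [1..<Suc (Suc r)]"
  proof -
    have "1 # map Suc [1..<Suc r] = [1..<Suc (Suc r)]"
      by (simp only: map_Suc_upt) (simp add: upt_conv_Cons del: upt_Suc)
    then show ?thesis by (simp add: h_i_def del: upt_Suc)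
  qed
  then have 1: "h_i (surj_bdry r (homotopy r (h_p x)) + homotopy r (surj_bdry r (h_p x))) =
      h_i (h_p x) - frag_cmul (aug (Suc r) x) (frag_of [1..<Suc (Suc r)])"
    unfolding Suc.IH [OF p] by (simp del: upt_Suc)
  have "surj_bdry (Suc r) (homotopy (Suc r) x) + homotopy (Suc r) (surj_bdry (Suc r) x) =
    (surj_bdry (Suc r) (h_s x) + h_s (surj_bdry (Suc r) x)) +
      h_i (surj_bdry r (homotopy r (h_p x)) + homotopy r (surj_bdry r (h_p x)))"
    unfolding homotopy_simps surj_bdry_linear bdry_h_i [OF keys_homotopy [OF p]] bdry_h_p [OF Suc.prems]
    by simp
  then show ?case unfolding 1 h_s_homotopy [OF Suc.prems] by (simp del: upt_Suc)
qed

lemma aug_nonzero_degree: "supp x \<subseteq> basis r n \<Longrightarrow> n \<noteq> 0 \<Longrightarrow> aug r x = 0"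
proof (induction r arbitrary: x)
  case 0
  then have "supp x = {}" by (simp add: basis_0)
  then show ?case by simp
qed (use keys_h_p in auto)

lemma aug_bdry: "supp x \<subseteq> basis r n \<Longrightarrow> aug r (surj_bdry r x) = 0"
proof (induction r arbitrary: x)
  case (Suc r)
  show ?case using Suc.IH [OF keys_h_p [OF Suc.prems]] unfolding bdry_h_p [OF Suc.prems] by simp
qed (simp add: bdry_basis_0)

lemma distinct_basis_degree_0:
  assumes "w \<in> basis r 0" shows "distinct w" "length w = r" "set w = {1..r}"
proof -
  show l: "length w = r" "set w = {1..r}" using assms by (auto simp: basis_def nondegenerate_def)
  then show "distinct w" by (intro card_distinct) simp
qed

lemma distinct_imp_distinct_adj: "distinct xs \<Longrightarrow> distinct_adj xs"
  by (induction xs) (auto simp: distinct_adj_Cons)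

text \<open>
  In degree zero a sequence is a permutation, and \<open>p\<close> never creates a repetition.
\<close>

lemma aug_word: "w \<in> basis r 0 \<Longrightarrow> aug r (frag_of w) = 1"
proof (induction r arbitrary: w)
  case 0
  then show ?case using distinct_basis_degree_0 [OF 0] by simp
next
  case (Suc r)
  note w = distinct_basis_degree_0 [OF Suc.prems]
  have "1 \<in> set w" unfolding w(3) by simp
  then have c: "count_list w 1 = 1" by (rule count_list_distinct [OF w(1)])
  let ?t = "map (\<lambda>v. v - 1) (removeAll 1 w)"
  have "inj_on (\<lambda>v. v - 1 :: nat) (set (removeAll 1 w))"
    unfolding set_removeAll w(3) by (auto simp: inj_on_def)
  then have "distinct ?t" using w(1) by (simp add: distinct_map distinct_removeAll)
  then have "distinct_adj ?t" by (rule distinct_imp_distinct_adj)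
  then have p: "h_p (frag_of w) = frag_of ?t" using c by (simp add: h_p_def Let_def)
  have "supp (h_p (frag_of w)) \<subseteq> basis r 0" by (rule keys_h_p) (use Suc.prems in simp)
  then have "?t \<in> basis r 0" unfolding p by simp
  from Suc.IH [OF this] show ?case by (simp add: p)
qed

lemma aug_act:
  assumes \<sigma>: "\<sigma> permutes {1..r}"
  shows "supp x \<subseteq> basis r n \<Longrightarrow> aug r (surj_act r \<sigma> x) = aug r x"
proof (induction x rule: basis_induct)
  case (one w)
  show ?case
  proof (cases "n = 0")
    case False
    then show ?thesis using keys_act [OF \<sigma>, of "frag_of w" n] one by (simp add: aug_nonzero_degree)
  next
    case True
    then have w: "w \<in> basis r 0" using one by simp
    note w' = distinct_basis_degree_0 [OF w]
    have "mdeg w v = 0" for v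
      using w' count_list_distinct [OF w'(1), of v] by (cases "v \<in> set w") (simp_all add: mdeg_def count_list_0_iff)
    then have act: "surj_act r \<sigma> (frag_of w) = frag_of (map \<sigma> w)" by (simp add: surj_act_def case_prod_unfold)
    have "supp (surj_act r \<sigma> (frag_of w)) \<subseteq> basis r 0" by (rule keys_act [OF \<sigma>]) (use w in simp)
    then have "map \<sigma> w \<in> basis r 0" unfolding act by simp
    then show ?thesis unfolding act by (simp add: aug_word w)
  qed
qed simp_all

lemma upt_basis: "[1..<Suc r] \<in> basis r 0"
  by (simp add: basis_def nondegenerate_def atLeastLessThanSuc_atLeastAtMost distinct_adj_conv_nth del: upt_Suc)

section \<open>Quasi-isomorphisms\<close>

lemma set_mult_carrier: "K <#>\<^bsub>A\<lparr>carrier := Z\<rparr>\<^esub> L = K <#>\<^bsub>A\<^esub> L"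
  by (simp add: set_mult_def)

lemma carrier_quotient: "carrier (A\<lparr>carrier := Z\<rparr> Mod B) = (\<lambda>x. B #>\<^bsub>A\<^esub> x) ` Z"
  by (auto simp: FactGroup_def RCOSETS_def)

text \<open>
  The homology groups have the cycles as carrier but the operations of the chain group. The
  statement is therefore about a quotient of a subset that is closed under the operations.
\<close>

lemma quotient_map_iso:
  assumes A: "comm_group A" and A': "comm_group A'"
    and B: "subgroup B A" and B': "subgroup B' A'"
    and Z: "Z \<subseteq> carrier A" "\<And>x y. x \<in> Z \<Longrightarrow> y \<in> Z \<Longrightarrow> x \<otimes>\<^bsub>A\<^esub> y \<in> Z" "\<And>x. x \<in> Z \<Longrightarrow> inv\<^bsub>A\<^esub> x \<in> Z"
    and Z': "Z' \<subseteq> carrier A'"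
    and f: "f \<in> hom A A'" "f ` Z \<subseteq> Z'" "f ` B \<subseteq> B'"
    and inj: "\<And>x. x \<in> Z \<Longrightarrow> f x \<in> B' \<Longrightarrow> x \<in> B"
    and surj: "\<And>y. y \<in> Z' \<Longrightarrow> \<exists>x\<in>Z. \<exists>b\<in>B'. y = b \<otimes>\<^bsub>A'\<^esub> f x"
  shows "(\<lambda>c. \<Union>x\<in>c. B' #>\<^bsub>A'\<^esub> f x) \<in> iso (A\<lparr>carrier := Z\<rparr> Mod B) (A'\<lparr>carrier := Z'\<rparr> Mod B')"
    (is "?F \<in> iso ?H ?H'")
proof -
  interpret A: comm_group A by (rule A)
  interpret A': comm_group A' by (rule A')
  interpret B: normal B A by (rule A.subgroup_imp_normal [OF B])
  interpret B': normal B' A' by (rule A'.subgroup_imp_normal [OF B'])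
  interpret f: group_hom A A' f using f(1) by unfold_locales
  have absorb: "B' #>\<^bsub>A'\<^esub> (b \<otimes>\<^bsub>A'\<^esub> y) = B' #>\<^bsub>A'\<^esub> y" if "b \<in> B'" "y \<in> carrier A'" for b y
    using A'.coset_mult_assoc [OF B'.subset B'.mem_carrier [OF that(1)] that(2)]
      A'.coset_join2 [OF B'.mem_carrier [OF that(1)] B' that(1)] by simp
  have absorb_A: "B #>\<^bsub>A\<^esub> (b \<otimes>\<^bsub>A\<^esub> y) = B #>\<^bsub>A\<^esub> y" if "b \<in> B" "y \<in> carrier A" for b y
    using A.coset_mult_assoc [OF B.subset B.mem_carrier [OF that(1)] that(2)]
      A.coset_join2 [OF B.mem_carrier [OF that(1)] B that(1)] by simp
  have F: "?F (B #>\<^bsub>A\<^esub> x) = B' #>\<^bsub>A'\<^esub> f x" if x: "x \<in> Z" for x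
  proof -
    have xA: "x \<in> carrier A" using x Z(1) by blast
    have eq: "B' #>\<^bsub>A'\<^esub> f y = B' #>\<^bsub>A'\<^esub> f x" if y: "y \<in> B #>\<^bsub>A\<^esub> x" for y
    proof -
      from y obtain b where b: "b \<in> B" "y = b \<otimes>\<^bsub>A\<^esub> x" by (auto simp: r_coset_def)
      then have "f y = f b \<otimes>\<^bsub>A'\<^esub> f x" using f.hom_mult [OF B.mem_carrier [OF b(1)] xA] by simp
      moreover have "f b \<in> B'" using b(1) f(3) by blast
      ultimately show ?thesis using absorb [of "f b" "f x"] f.hom_closed [OF xA] by simp
    qed
    have "B #>\<^bsub>A\<^esub> x \<noteq> {}" using A.rcos_self [OF xA B] by (rule ex_in_conv [THEN iffD1, OF exI])
    then show ?thesis by (rule SUP_eq_const) (rule eq)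
  qed
  have fZ: "f x \<in> Z'" if "x \<in> Z" for x using f(2) that by blast
  have hom: "?F \<in> hom ?H ?H'"
  proof (rule homI)
    fix c assume "c \<in> carrier ?H"
    then obtain x where x: "x \<in> Z" "c = B #>\<^bsub>A\<^esub> x" unfolding carrier_quotient by blast
    then show "?F c \<in> carrier ?H'" unfolding x(2) F [OF x(1)] carrier_quotient by (intro imageI fZ)
  next
    fix c d assume "c \<in> carrier ?H" "d \<in> carrier ?H"
    then obtain x y where x: "x \<in> Z" "c = B #>\<^bsub>A\<^esub> x" and y: "y \<in> Z" "d = B #>\<^bsub>A\<^esub> y"
      unfolding carrier_quotient by blast
    have xA: "x \<in> carrier A" "y \<in> carrier A" using x y Z(1) by blast+
    have "c \<otimes>\<^bsub>?H\<^esub> d = B #>\<^bsub>A\<^esub> (x \<otimes>\<^bsub>A\<^esub> y)"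
      unfolding x(2) y(2) mult_FactGroup set_mult_carrier by (rule B.rcos_sum [OF xA])
    moreover have "?F c \<otimes>\<^bsub>?H'\<^esub> ?F d = B' #>\<^bsub>A'\<^esub> (f x \<otimes>\<^bsub>A'\<^esub> f y)"
      unfolding x(2) y(2) F [OF x(1)] F [OF y(1)] mult_FactGroup set_mult_carrier
      by (rule B'.rcos_sum) (simp_all add: xA)
    ultimately show "?F (c \<otimes>\<^bsub>?H\<^esub> d) = ?F c \<otimes>\<^bsub>?H'\<^esub> ?F d"
      using F [OF Z(2) [OF x(1) y(1)]] f.hom_mult [OF xA] by simp
  qed
  have "inj_on ?F (carrier ?H)"
  proof (rule inj_onI)
    fix c d assume "c \<in> carrier ?H" "d \<in> carrier ?H" and eq: "?F c = ?F d"
    then obtain x y where x: "x \<in> Z" "c = B #>\<^bsub>A\<^esub> x" and y: "y \<in> Z" "d = B #>\<^bsub>A\<^esub> y"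
      unfolding carrier_quotient by blast
    have xA: "x \<in> carrier A" "y \<in> carrier A" using x y Z(1) by blast+
    have "f x \<in> B' #>\<^bsub>A'\<^esub> f x" by (rule A'.rcos_self [OF f.hom_closed [OF xA(1)] B'])
    also have "B' #>\<^bsub>A'\<^esub> f x = B' #>\<^bsub>A'\<^esub> f y" using eq unfolding x(2) y(2) F [OF x(1)] F [OF y(1)] .
    finally obtain b where b: "b \<in> B'" "f x = b \<otimes>\<^bsub>A'\<^esub> f y" by (auto simp: r_coset_def)
    have "f (x \<otimes>\<^bsub>A\<^esub> inv\<^bsub>A\<^esub> y) = b"
      using xA b(2) B'.mem_carrier [OF b(1)] by (simp add: A'.m_assoc)
    then have "x \<otimes>\<^bsub>A\<^esub> inv\<^bsub>A\<^esub> y \<in> B" using inj [OF Z(2) [OF x(1) Z(3) [OF y(1)]]] b(1) by simp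
    from absorb_A [OF this xA(2)] show "c = d" unfolding x(2) y(2) using xA by (simp add: A.m_assoc)
  qed
  moreover have "?F ` carrier ?H = carrier ?H'"
  proof
    show "?F ` carrier ?H \<subseteq> carrier ?H'" using hom_carrier [OF hom] .
    show "carrier ?H' \<subseteq> ?F ` carrier ?H"
    proof
      fix d assume "d \<in> carrier ?H'"
      then obtain y where y: "y \<in> Z'" "d = B' #>\<^bsub>A'\<^esub> y" unfolding carrier_quotient by blast
      from surj [OF y(1)] obtain x b where x: "x \<in> Z" and b: "b \<in> B'" "y = b \<otimes>\<^bsub>A'\<^esub> f x" by blast
      have "f x \<in> carrier A'" using fZ [OF x] Z' by blast
      from absorb [OF b(1) this] have "d = ?F (B #>\<^bsub>A\<^esub> x)" unfolding y(2) b(2) F [OF x] .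
      moreover have "B #>\<^bsub>A\<^esub> x \<in> carrier ?H" unfolding carrier_quotient using x by blast
      ultimately show "d \<in> ?F ` carrier ?H" by blast
    qed
  qed
  ultimately show ?thesis using hom by (simp add: iso_def bij_betw_def)
qed

lemma (in gamma_module) bdry_group_hom: "group_hom (chain M r n) (chain M r (n - 1)) (bdry M r n)"
  using chain_comm_group bdry_hom by (simp add: group_hom_def group_hom_axioms_def comm_group_def)

lemma (in gamma_module) cycles_iff:
  "x \<in> cycles M r n \<longleftrightarrow> x \<in> carrier (chain M r n) \<and> bdry M r n x = \<one>\<^bsub>chain M r (n - 1)\<^esub>"
  by (simp add: cycles_def kernel_def)

lemma (in gamma_module) subgroup_boundaries: "subgroup (boundaries M r n) (chain M r n)"
proof -
  have "group_hom (chain M r (n + 1)) (chain M r n) (bdry M r (n + 1))"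
    using bdry_group_hom [of r "n + 1"] by simp
  from group_hom.img_is_subgroup [OF this] show ?thesis by (simp add: boundaries_def)
qed

text \<open>
  The conditions speak of representatives instead of classes, so that contracting homotopies
  verify them directly.
\<close>

lemma quasi_isoI:
  assumes f: "gamma_morphism G M M' f"
    and inj: "\<And>r n x. x \<in> cycles M r n \<Longrightarrow> f r n x \<in> boundaries M' r n \<Longrightarrow> x \<in> boundaries M r n"
    and surj: "\<And>r n y. y \<in> cycles M' r n \<Longrightarrow> \<exists>x\<in>cycles M r n. \<exists>b\<in>boundaries M' r n. y = b \<otimes>\<^bsub>chain M' r n\<^esub> f r n x"
  shows "quasi_iso M M' f"
  unfolding quasi_iso_def
proof (intro allI)
  fix r n
  interpret gamma_morphism G M M' f by (rule f)
  have src: "subgroup (cycles M r n) (chain M r n)"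
    unfolding cycles_def by (rule group_hom.subgroup_kernel [OF src.bdry_group_hom])
  have hom_one: "f r n \<one>\<^bsub>chain M r n\<^esub> = \<one>\<^bsub>chain M' r n\<^esub>" for r n
    using src.chain_comm_group [of r n] tgt.chain_comm_group [of r n] map_hom [of r n]
    by (simp add: hom_one comm_group_def)
  show "homology_map M' f r n \<in> iso (homology M r n) (homology M' r n)"
    unfolding homology_map_def homology_def
  proof (rule quotient_map_iso)
    show "cycles M r n \<subseteq> carrier (chain M r n)" "\<And>x y. x \<in> cycles M r n \<Longrightarrow> y \<in> cycles M r n \<Longrightarrow> x \<otimes>\<^bsub>chain M r n\<^esub> y \<in> cycles M r n"
      "\<And>x. x \<in> cycles M r n \<Longrightarrow> inv\<^bsub>chain M r n\<^esub> x \<in> cycles M r n"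
      using subgroup.subset [OF src] subgroup.m_closed [OF src] subgroup.m_inv_closed [OF src] by auto
    show "cycles M' r n \<subseteq> carrier (chain M' r n)" by (auto simp: cycles_def kernel_def)
    show "f r n ` cycles M r n \<subseteq> cycles M' r n"
    proof (rule image_subsetI)
      fix x assume "x \<in> cycles M r n"
      then have x: "x \<in> carrier (chain M r n)" "bdry M r n x = \<one>\<^bsub>chain M r (n - 1)\<^esub>" by (simp_all add: src.cycles_iff)
      then show "f r n x \<in> cycles M' r n"
        using map_bdry [OF x(1)] hom_in_carrier [OF map_hom x(1)] by (simp add: tgt.cycles_iff hom_one)
    qed
    show "f r n ` boundaries M r n \<subseteq> boundaries M' r n"
    proof (rule image_subsetI)
      fix b assume "b \<in> boundaries M r n"
      then obtain x where x: "x \<in> carrier (chain M r (n + 1))" "b = bdry M r (n + 1) x" by (auto simp: boundaries_def)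
      have "f r n b = bdry M' r (n + 1) (f r (n + 1) x)" using map_bdry [OF x(1)] x(2) by simp
      then show "f r n b \<in> boundaries M' r n"
        unfolding boundaries_def using hom_in_carrier [OF map_hom x(1)] by blast
    qed
  qed (use src.chain_comm_group tgt.chain_comm_group src.subgroup_boundaries tgt.subgroup_boundaries map_hom inj surj in simp_all)
qed

section \<open>The augmentation and freeness\<close>

lemma const_Z_simps [simp]:
  "chain const_Z r n = (if n = 0 then integer_group else singleton_group 0)" "bdry const_Z r n x = 0" "act const_Z r n g x = x"
  by (simp_all add: const_Z_def)

lemma const_Z_module: "gamma_module G const_Z"
proof (rule gamma_module.intro)
  show "comm_group (chain const_Z r n)" for r n by (simp add: abelian_integer_group)
  show "bdry const_Z r n \<in> hom (chain const_Z r n) (chain const_Z r (n - 1))" for r n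
    by (auto simp: hom_def integer_group_def singleton_group_def)
  show "act const_Z r n g \<in> hom (chain const_Z r n) (chain const_Z r n)" for r n g
    by (auto simp: hom_def)
qed (auto simp: singleton_group_def integer_group_def)

definition aug_map :: "nat \<Rightarrow> int \<Rightarrow> (nat list \<Rightarrow>\<^sub>0 int) \<Rightarrow> int" where
  "aug_map r n x = (if n = 0 then aug r x else 0)"

lemma aug_morphism: "S_morphism surj_operad const_Z aug_map"
proof (intro gamma_morphism.intro gamma_morphism_axioms.intro surj_sym_module const_Z_module)
  show "aug_map r n \<in> hom (chain surj_operad r n) (chain const_Z r n)" for r n
    by (auto simp: hom_def aug_map_def singleton_group_def integer_group_def)
  show "bdry const_Z r n (aug_map r n x) = aug_map r (n - 1) (bdry surj_operad r n x)"
    if "x \<in> carrier (chain surj_operad r n)" for r n x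
    using aug_bdry that by (simp add: aug_map_def)
  show "aug_map r n (act surj_operad r n g x) = act const_Z r n g (aug_map r n x)"
    if "g \<in> carrier (sym_group r)" "x \<in> carrier (chain surj_operad r n)" for g r n x
    using aug_act that by (simp add: aug_map_def sym_group_carrier)
qed

lemma surj_cycle_decomposition:
  assumes "x \<in> cycles surj_operad r n"
  shows "x = surj_bdry r (homotopy r x) + frag_cmul (aug r x) (frag_of [1..<Suc r])"
    "homotopy r x \<in> carrier (chain surj_operad r (n + 1))"
proof -
  have x: "supp x \<subseteq> basis r n" "surj_bdry r x = 0"
    using assms by (simp_all add: gamma_module.cycles_iff [OF surj_sym_module])
  show "x = surj_bdry r (homotopy r x) + frag_cmul (aug r x) (frag_of [1..<Suc r])"
    using homotopy [OF x(1)] x(2) by (simp del: upt_Suc)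
  show "homotopy r x \<in> carrier (chain surj_operad r (n + 1))"
    using keys_homotopy [OF x(1)] by simp
qed

lemma basis_negative: "n < 0 \<Longrightarrow> basis r n = {}"
proof -
  have "r \<le> length w" if "nondegenerate r w" for w
    using that card_length [of w] by (simp add: nondegenerate_def)
  then show "n < 0 \<Longrightarrow> basis r n = {}" by (fastforce simp: basis_def)
qed

lemma upt_cycle: "frag_cmul c (frag_of [1..<Suc r]) \<in> cycles surj_operad r 0"
proof -
  have k: "supp (frag_cmul c (frag_of [1..<Suc r])) \<subseteq> basis r 0"
    using upt_basis [of r] keys_cmul [of c "frag_of [1..<Suc r]"] by (simp del: upt_Suc) blast
  then have "supp (surj_bdry r (frag_cmul c (frag_of [1..<Suc r]))) \<subseteq> basis r (0 - 1)"
    by (rule keys_bdry)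
  then have "surj_bdry r (frag_cmul c (frag_of [1..<Suc r])) = 0" by (simp add: basis_negative)
  with k show ?thesis by (simp add: gamma_module.cycles_iff [OF surj_sym_module] del: upt_Suc)
qed

lemma aug_quasi_iso: "quasi_iso surj_operad const_Z aug_map"
proof (rule quasi_isoI [OF aug_morphism])
  fix r n x assume x: "x \<in> cycles surj_operad r n" and b: "aug_map r n x \<in> boundaries const_Z r n"
  have "aug_map r n x = 0" using b by (auto simp: boundaries_def)
  moreover have "supp x \<subseteq> basis r n" using x by (simp add: gamma_module.cycles_iff [OF surj_sym_module])
  ultimately have "aug r x = 0" using aug_nonzero_degree by (cases "n = 0") (auto simp: aug_map_def)
  then have "x = surj_bdry r (homotopy r x)" using surj_cycle_decomposition(1) [OF x] by (simp del: upt_Suc)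
  then show "x \<in> boundaries surj_operad r n"
    using surj_cycle_decomposition(2) [OF x] unfolding boundaries_def surj_operad_simps by blast
next
  fix r n y assume y: "y \<in> cycles const_Z r n"
  have zero: "0 \<in> boundaries const_Z r n"
    using subgroup.one_closed [OF gamma_module.subgroup_boundaries [OF const_Z_module, where r = r and n = n]]
    by (simp add: singleton_group_def split: if_split_asm)
  show "\<exists>x\<in>cycles surj_operad r n. \<exists>b\<in>boundaries const_Z r n. y = b \<otimes>\<^bsub>chain const_Z r n\<^esub> aug_map r n x"
  proof (cases "n = 0")
    case True
    have aug1: "aug r (frag_of [1..<Suc r]) = 1" by (rule aug_word [OF upt_basis])
    have "y = 0 \<otimes>\<^bsub>chain const_Z r n\<^esub> aug_map r n (frag_cmul y (frag_of [1..<Suc r]))"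
      unfolding aug_map_def aug_linear aug1 using True by simp
    then show ?thesis using upt_cycle zero True by blast
  next
    case False
    have "0 \<in> cycles surj_operad r n" by (simp add: gamma_module.cycles_iff [OF surj_sym_module])
    moreover have "y = 0 \<otimes>\<^bsub>chain const_Z r n\<^esub> aug_map r n 0"
      using y False by (simp add: gamma_module.cycles_iff [OF const_Z_module] singleton_group_def)
    ultimately show ?thesis using zero by blast
  qed
qed

lemma iso_cong:
  assumes "group G" and f: "f \<in> iso G H" and eq: "\<And>x. x \<in> carrier G \<Longrightarrow> g x = f x"
  shows "g \<in> iso G H"
proof -
  interpret group G by (rule assms(1))
  have hom: "f \<in> hom G H" and bij: "bij_betw f (carrier G) (carrier H)" using f by (simp_all add: iso_def)
  have "g \<in> hom G H"
    by (rule homI) (simp_all add: eq hom_in_carrier [OF hom] hom_mult [OF hom])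
  moreover have "bij_betw g (carrier G) (carrier H)"
    using bij by (rule bij_betw_cong [THEN iffD2, rotated]) (rule eq)
  ultimately show ?thesis by (simp add: iso_def)
qed

text \<open>
  A bijection of bases with signs is invertible by the inverse bijection with the same signs.
\<close>

lemma frag_extend_basis_iso:
  assumes \<beta>: "bij_betw \<beta> S T" and e: "\<And>p. p \<in> S \<Longrightarrow> e p * e p = 1"
  shows "frag_extend (\<lambda>p. frag_cmul (e p) (frag_of (\<beta> p))) \<in> iso (free_Abelian_group S) (free_Abelian_group T)"
    (is "?F \<in> _")
proof -
  let ?\<gamma> = "inv_into S \<beta>"
  let ?G = "frag_extend (\<lambda>t. frag_cmul (e (?\<gamma> t)) (frag_of (?\<gamma> t)))"
  have \<gamma>: "bij_betw ?\<gamma> T S" by (rule bij_betw_inv_into [OF \<beta>])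
  have F: "supp (?F c) \<subseteq> T" if "supp c \<subseteq> S" for c
  proof (rule order.trans [OF keys_frag_extend], rule UN_least)
    fix p assume "p \<in> supp c"
    then have "\<beta> p \<in> T" using that bij_betwE [OF \<beta>] by blast
    then show "supp (frag_cmul (e p) (frag_of (\<beta> p))) \<subseteq> T" by (intro order.trans [OF keys_cmul]) simp
  qed
  have G: "supp (?G c) \<subseteq> S" if "supp c \<subseteq> T" for c
  proof (rule order.trans [OF keys_frag_extend], rule UN_least)
    fix t assume "t \<in> supp c"
    then have "?\<gamma> t \<in> S" using that bij_betwE [OF \<gamma>] by blast
    then show "supp (frag_cmul (e (?\<gamma> t)) (frag_of (?\<gamma> t))) \<subseteq> S" by (intro order.trans [OF keys_cmul]) simp
  qed
  have GF: "?G (?F c) = c" if "supp c \<subseteq> S" for c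
    using that
  proof (induction c rule: frag_induction)
    case (one p)
    then show ?case using bij_betw_inv_into_left [OF \<beta> one] e by (simp add: frag_extend_cmul)
  qed (simp_all add: frag_extend_diff)
  have FG: "?F (?G c) = c" if "supp c \<subseteq> T" for c
    using that
  proof (induction c rule: frag_induction)
    case (one t)
    then have "?\<gamma> t \<in> S" using bij_betwE [OF \<gamma>] by blast
    then show ?case using bij_betw_inv_into_right [OF \<beta> one] e by (simp add: frag_extend_cmul)
  qed (simp_all add: frag_extend_diff)
  have "bij_betw ?F (carrier (free_Abelian_group S)) (carrier (free_Abelian_group T))"
    by (rule bij_betw_byWitness [where f' = ?G]) (auto simp: F G GF FG simp del: frag_extend_def)
  moreover have "?F \<in> hom (free_Abelian_group S) (free_Abelian_group T)"
    by (rule homI) (simp_all add: F frag_extend_add)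
  ultimately show ?thesis by (simp add: iso_def)
qed

lemma finprod_free_Abelian_group:
  assumes "finite K" "\<And>p. p \<in> K \<Longrightarrow> supp (F p) \<subseteq> S"
  shows "finprod (free_Abelian_group S) F K = sum F K"
proof -
  interpret comm_group "free_Abelian_group S" by (rule abelian_free_Abelian_group)
  show ?thesis
    using assms by (induction K rule: finite_induct) (auto simp: finprod_insert Pi_iff)
qed

lemma remdups_map_inj: "inj_on \<phi> (set w) \<Longrightarrow> remdups (map \<phi> w) = map \<phi> (remdups w)"
proof (induction w)
  case (Cons x w)
  then have "\<phi> x \<in> \<phi> ` set w \<longleftrightarrow> x \<in> set w" by (auto simp: inj_on_def)
  then show ?case using Cons by auto
qed simp

text \<open>
  The values of \<open>w\<close> in the order of their last occurrences, as a permutation. This is the order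
  in which \<open>remdups\<close> lists them, since it keeps the last one of equal elements.
\<close>

definition order_perm :: "nat \<Rightarrow> nat list \<Rightarrow> nat \<Rightarrow> nat" where
  "order_perm r w i = (if i \<in> {1..r} then remdups w ! (i - 1) else i)"

lemma order_perm:
  assumes w: "set w = {1..r}"
  shows "map (order_perm r w) [1..<Suc r] = remdups w" "order_perm r w permutes {1..r}"
proof -
  have "length (remdups w) = r" using w by (simp add: length_remdups_card_conv)
  then show m: "map (order_perm r w) [1..<Suc r] = remdups w"
    by (intro nth_equalityI) (simp_all add: order_perm_def del: upt_Suc)
  have "order_perm r w ` {1..r} = {1..r}"
    using arg_cong [OF m, of set] w by (simp add: atLeastLessThanSuc_atLeastAtMost del: upt_Suc)
  then have "bij_betw (order_perm r w) {1..r} {1..r}"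
    unfolding bij_betw_def using eq_card_imp_inj_on [of "{1..r}" "order_perm r w"] by simp
  moreover have "i \<notin> {1..r} \<Longrightarrow> order_perm r w i = i" for i unfolding order_perm_def by (rule if_not_P)
  ultimately show "order_perm r w permutes {1..r}" by (rule bij_imp_permutes)
qed

lemma map_basis:
  assumes "\<sigma> permutes {1..r}" "w \<in> basis r n" shows "map \<sigma> w \<in> basis r n"
  using assms nondegenerate_map [OF assms(1), of w] by (simp add: basis_def)

text \<open>
  Renaming the values commutes with \<open>remdups\<close>, so each orbit contains exactly one sequence in
  which the last occurrences of the values are in increasing order.
\<close>

lemma surj_free_basis:
  "bij_betw (\<lambda>(\<sigma>, b). map \<sigma> b) ({\<sigma>. \<sigma> permutes {1..r}} \<times> {w \<in> basis r n. remdups w = [1..<Suc r]}) (basis r n)"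
  (is "bij_betw ?f (?G \<times> ?B) _")
proof -
  have "inj_on ?f (?G \<times> ?B)"
  proof (rule inj_onI, clarify)
    fix \<sigma> b \<tau> c assume \<sigma>: "\<sigma> permutes {1..r}" and \<tau>: "\<tau> permutes {1..r}"
      and b: "b \<in> basis r n" "remdups b = [1..<Suc r]" and c: "c \<in> basis r n" "remdups c = [1..<Suc r]"
      and eq: "map \<sigma> b = map \<tau> c"
    have inj: "inj_on \<sigma> A" "inj_on \<tau> A" for A
      using permutes_inj [OF \<sigma>] permutes_inj [OF \<tau>] inj_on_subset by blast+
    have "map \<sigma> [1..<Suc r] = map \<tau> [1..<Suc r]"
      using arg_cong [OF eq, of remdups] by (simp only: remdups_map_inj inj b(2) c(2))
    then have "\<forall>i\<in>{1..r}. \<sigma> i = \<tau> i" by (simp add: atLeastLessThanSuc_atLeastAtMost del: upt_Suc)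
    moreover have "\<sigma> i = \<tau> i" if "i \<notin> {1..r}" for i using permutes_not_in [OF \<sigma> that] permutes_not_in [OF \<tau> that] by simp
    ultimately have \<sigma>\<tau>: "\<sigma> = \<tau>" by (intro ext) blast
    then have "b = c" using eq inj_map_eq_map [OF permutes_inj [OF \<tau>]] by simp
    with \<sigma>\<tau> show "\<sigma> = \<tau> \<and> b = c" ..
  qed
  moreover have "?f ` (?G \<times> ?B) = basis r n"
  proof
    show "?f ` (?G \<times> ?B) \<subseteq> basis r n" using map_basis by auto
    show "basis r n \<subseteq> ?f ` (?G \<times> ?B)"
    proof
      fix w assume w: "w \<in> basis r n"
      then have sw: "set w = {1..r}" by (simp add: basis_def nondegenerate_def)
      \<comment> \<open>The inverse of this permutation moves \<open>w\<close> to the representative of its orbit.\<close>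
      define \<sigma> where "\<sigma> = order_perm r w"
      have \<sigma>: "map \<sigma> [1..<Suc r] = remdups w" "\<sigma> permutes {1..r}" unfolding \<sigma>_def by (rule order_perm [OF sw])+
      let ?\<tau> = "Hilbert_Choice.inv \<sigma>"
      have \<tau>: "?\<tau> permutes {1..r}" by (rule permutes_inv [OF \<sigma>(2)])
      have \<tau>\<sigma>: "map ?\<tau> (map \<sigma> xs) = xs" "map \<sigma> (map ?\<tau> xs) = xs" for xs
        by (simp_all add: permutes_inverses [OF \<sigma>(2)] comp_def)
      have "remdups (map ?\<tau> w) = [1..<Suc r]"
        unfolding remdups_map_inj [OF inj_on_subset [OF permutes_inj [OF \<tau>] subset_UNIV]] \<sigma>(1) [symmetric] by (rule \<tau>\<sigma>)
      then have "(\<sigma>, map ?\<tau> w) \<in> ?G \<times> ?B" using \<sigma>(2) map_basis [OF \<tau> w] by simp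
      moreover have "w = ?f (\<sigma>, map ?\<tau> w)" using \<tau>\<sigma>(2) [of w] by simp
      ultimately show "w \<in> ?f ` (?G \<times> ?B)" by (rule rev_image_eqI)
    qed
  qed
  ultimately show ?thesis by (simp add: bij_betw_def)
qed

text \<open>
  The group permutes the basis only up to the signs \<open>e p\<close>, which an isomorphism may absorb.
\<close>

lemma surj_free: "free_module (sym_group r) (chain surj_operad r n) (act surj_operad r n)"
proof -
  let ?Bw = "{w \<in> basis r n. remdups w = [1..<Suc r]}"
  let ?B = "(\<lambda>w. frag_of w) ` ?Bw" and ?G = "{\<sigma>. \<sigma> permutes {1..r}}" and ?A = "free_Abelian_group (basis r n)"
  \<comment> \<open>The candidates for the free generators are elements of the chain group, so the
      sequence has to be recovered from the generator it spans.\<close>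
  define word where "word = (\<lambda>x :: nat list \<Rightarrow>\<^sub>0 int. THE w. x = frag_of w)"
  have word [simp]: "word (frag_of w) = w" for w by (simp add: word_def frag_of_eq)
  define e where "e = (\<lambda>p :: (nat \<Rightarrow> nat) \<times> (nat list \<Rightarrow>\<^sub>0 int).
    (\<Prod>(i, j)\<in>{(i, j). 1 \<le> i \<and> i < j \<and> j \<le> r \<and> fst p i > fst p j}. (-1 :: int) ^ (mdeg (word (snd p)) i * mdeg (word (snd p)) j)))"
  define \<beta> where "\<beta> = (\<lambda>p :: (nat \<Rightarrow> nat) \<times> (nat list \<Rightarrow>\<^sub>0 int). map (fst p) (word (snd p)))"
  have act: "surj_act r (fst p) (snd p) = frag_cmul (e p) (frag_of (\<beta> p))" if "p \<in> ?G \<times> ?B" for p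
    using that by (auto simp: surj_act_def e_def \<beta>_def)
  have e: "e p * e p = 1" for p
    unfolding e_def prod.distrib [symmetric] by (rule prod.neutral) (auto simp flip: power_mult_distrib)
  have "bij_betw (\<lambda>p. (fst p, word (snd p))) (?G \<times> ?B) (?G \<times> ?Bw)"
    by (rule bij_betw_byWitness [where f' = "\<lambda>p. (fst p, frag_of (snd p))"]) auto
  from bij_betw_trans [OF this surj_free_basis] have \<beta>: "bij_betw \<beta> (?G \<times> ?B) (basis r n)"
    by (simp add: \<beta>_def comp_def case_prod_unfold del: upt_Suc)
  have iso: "frag_extend (\<lambda>p. frag_cmul (e p) (frag_of (\<beta> p))) \<in> iso (free_Abelian_group (?G \<times> ?B)) ?A"
    by (rule frag_extend_basis_iso [OF \<beta> e])
  have eq: "finprod ?A (\<lambda>p. surj_act r (fst p) (snd p) [^]\<^bsub>?A\<^esub> Poly_Mapping.lookup c p) (supp c) =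
     frag_extend (\<lambda>p. frag_cmul (e p) (frag_of (\<beta> p))) c" if c: "c \<in> carrier (free_Abelian_group (?G \<times> ?B))" for c
  proof -
    have k: "supp (surj_act r (fst p) (snd p)) \<subseteq> basis r n" if "p \<in> supp c" for p
    proof -
      have p: "p \<in> ?G \<times> ?B" using c that by auto
      then show ?thesis unfolding act [OF p] using bij_betwE [OF \<beta>] by auto
    qed
    have "finprod ?A (\<lambda>p. surj_act r (fst p) (snd p) [^]\<^bsub>?A\<^esub> Poly_Mapping.lookup c p) (supp c) =
      (\<Sum>p\<in>supp c. surj_act r (fst p) (snd p) [^]\<^bsub>?A\<^esub> Poly_Mapping.lookup c p)"
      by (rule finprod_free_Abelian_group) (use k in \<open>auto simp del: surj_act_def\<close>)
    also have "\<dots> = (\<Sum>p\<in>supp c. frag_cmul (Poly_Mapping.lookup c p) (frag_cmul (e p) (frag_of (\<beta> p))))"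
    proof (rule sum.cong [OF refl])
      fix p assume p: "p \<in> supp c"
      then have "p \<in> ?G \<times> ?B" using c by auto
      from act [OF this] show "surj_act r (fst p) (snd p) [^]\<^bsub>?A\<^esub> Poly_Mapping.lookup c p = frag_cmul (Poly_Mapping.lookup c p) (frag_cmul (e p) (frag_of (\<beta> p)))"
        unfolding int_pow_free_Abelian_group [OF k [OF p]] by simp
    qed
    finally show ?thesis by (simp only: frag_extend_def)
  qed
  have "(\<lambda>c. finprod ?A (\<lambda>p. surj_act r (fst p) (snd p) [^]\<^bsub>?A\<^esub> Poly_Mapping.lookup c p) (supp c))
    \<in> iso (free_Abelian_group (?G \<times> ?B)) ?A"
    by (rule iso_cong [OF group_free_Abelian_group iso eq])
  moreover have "?B \<subseteq> carrier ?A" by auto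
  moreover have "carrier (sym_group r) = ?G" by (auto simp: sym_group_carrier)
  ultimately show ?thesis unfolding free_module_def surj_operad_simps by (intro exI [of _ ?B]) simp
qed

lemma E_infinity_surj: "E_infinity surj_operad"
  unfolding E_infinity_def
proof (intro conjI allI impI operad_surj surj_free)
  show "chain surj_operad 0 0 \<cong> integer_group"
    using group.iso_sym [OF group_integer_group isomorphic_group_integer_free_Abelian_group_singleton [of "[]"]]
    by (simp add: basis_0)
  show "trivial_group (chain surj_operad 0 n)" if "n \<noteq> 0" for n
    using that by (auto simp: trivial_group_def basis_0)
  show "\<exists>\<epsilon>. S_morphism surj_operad const_Z \<epsilon> \<and> quasi_iso surj_operad const_Z \<epsilon>"
    using aug_morphism aug_quasi_iso by blast
qed

section \<open>The cyclic group\<close>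

text \<open>
  For \<open>r = 0\<close> the group has order \<open>1\<close>, not \<open>0\<close>.
\<close>

definition cyc_order :: "nat \<Rightarrow> nat" where
  "cyc_order r = (if r = 0 then 1 else r)"

abbreviation Cyc :: "nat \<Rightarrow> (nat \<Rightarrow> nat) set" where
  "Cyc r \<equiv> carrier (cyc_group r)"

lemma rho_pow:
  "i \<in> {1..r} \<Longrightarrow> k \<le> r \<Longrightarrow> (rho r ^^ k) i = (if i + k \<le> r then i + k else i + k - r)"
proof (induction k)
  case (Suc k)
  then show ?case by (auto simp: rho_def)
qed simp

lemma rho_outside: "i \<notin> {1..r} \<Longrightarrow> (rho r ^^ k) i = i"
  by (induction k) (auto simp: rho_def)

lemma rho_order: "rho r ^^ cyc_order r = id"
proof
  fix i show "(rho r ^^ cyc_order r) i = id i"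
  proof (cases "i \<in> {1..r}")
    case True
    then show ?thesis using rho_pow [OF True, of r] by (simp add: cyc_order_def)
  next
    case False
    then show ?thesis by (simp only: rho_outside [OF False] id_apply)
  qed
qed

lemma cyc_order_pos: "0 < cyc_order r"
  by (simp add: cyc_order_def)

lemma rho_permutes: "rho r permutes {1..r}"
proof -
  have q: "cyc_order r = Suc (cyc_order r - 1)" using cyc_order_pos by simp
  have "rho r \<circ> rho r ^^ (cyc_order r - 1) = id" using rho_order [of r] by (subst (asm) q) simp
  moreover have "rho r ^^ (cyc_order r - 1) \<circ> rho r = id"
    using rho_order [of r] by (subst (asm) q) (simp only: funpow_Suc_right)
  ultimately have "bij (rho r)" by (rule o_bij [rotated])
  then show ?thesis
    unfolding permutes_def bij_iff using rho_outside [of _ r 1] by simp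
qed

lemma rho_pow_mod: "rho r ^^ (k mod cyc_order r) = rho r ^^ k"
  by (rule ext, rule funpow_mod_eq) (simp add: rho_order)

lemma rho_pow_permutes: "rho r ^^ k permutes {1..r}"
proof (induction k)
  case 0
  show ?case unfolding funpow_0 funpow.simps(1) by (rule permutes_id)
next
  case (Suc k)
  show ?case unfolding funpow.simps(2) by (rule permutes_compose [OF Suc rho_permutes])
qed

lemma Cyc_range: "Cyc r = range (\<lambda>k. rho r ^^ k)"
proof -
  interpret group "sym_group r" by (rule sym_group_is_group)
  have rho: "rho r \<in> carrier (sym_group r)" unfolding sym_group_carrier by (rule rho_permutes)
  have C: "Cyc r = generate (sym_group r) {rho r}"
    using rho by (simp add: cyc_group_def carrier_subgroup_generated)
  have pow: "rho r ^^ j \<circ> rho r ^^ k = rho r ^^ (j + k)" for j k by (simp only: funpow_add)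
  have "subgroup (range (\<lambda>k. rho r ^^ k)) (sym_group r)"
  proof (rule subgroupI)
    show "range (\<lambda>k. rho r ^^ k) \<subseteq> carrier (sym_group r)" using sym_group_carrier rho_pow_permutes by blast
    show "range (\<lambda>k. rho r ^^ k) \<noteq> {}" by simp
    show "a \<otimes>\<^bsub>sym_group r\<^esub> b \<in> range (\<lambda>k. rho r ^^ k)" if ab: "a \<in> range (\<lambda>k. rho r ^^ k)" "b \<in> range (\<lambda>k. rho r ^^ k)" for a b
    proof -
      from ab obtain j k where "a = rho r ^^ j" "b = rho r ^^ k" by blast
      then have "a \<otimes>\<^bsub>sym_group r\<^esub> b = rho r ^^ (j + k)" by (simp only: sym_group_mult pow)
      then show ?thesis by blast
    qed
    show "inv\<^bsub>sym_group r\<^esub> a \<in> range (\<lambda>k. rho r ^^ k)" if a: "a \<in> range (\<lambda>k. rho r ^^ k)" for a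
    proof -
      from a obtain k where k: "a = rho r ^^ k" by blast
      \<comment> \<open>The inverse as a power with an exponent that is a natural number.\<close>
      let ?b = "rho r ^^ ((cyc_order r - 1) * k)"
      have "(cyc_order r - 1) * k + k = cyc_order r * k" using cyc_order_pos [of r] by (cases "cyc_order r") auto
      then have "?b \<circ> a = rho r ^^ (cyc_order r * k)" unfolding k pow by (simp only:)
      also have "\<dots> = id" using rho_pow_mod [where r = r and k = "cyc_order r * k"] by simp
      finally have "?b \<circ> a = id" .
      then have "inv\<^bsub>sym_group r\<^esub> a = ?b"
        unfolding k by (intro inv_equality) (simp_all only: sym_group_mult sym_group_one sym_group_carrier rho_pow_permutes)
      then show ?thesis by blast
    qed
  qed
  then have "generate (sym_group r) {rho r} \<subseteq> range (\<lambda>k. rho r ^^ k)"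
    by (rule generate_subgroup_incl [rotated]) (use rangeI [of "\<lambda>k. rho r ^^ k" 1] in simp)
  moreover have "rho r ^^ k \<in> generate (sym_group r) {rho r}" for k
  proof (induction k)
    case 0
    then show ?case using generate.one [of "sym_group r" "{rho r}"] by (simp add: sym_group_one id_def)
  next
    case (Suc k)
    have "rho r \<in> generate (sym_group r) {rho r}" by (rule generate.incl) simp
    from generate.eng [OF this Suc] show ?case by (simp only: sym_group_mult funpow.simps(2))
  qed
  ultimately show ?thesis unfolding C by blast
qed

lemma Cyc_image: "Cyc r = (\<lambda>k. rho r ^^ k) ` {..<cyc_order r}"
proof -
  have "rho r ^^ k \<in> (\<lambda>k. rho r ^^ k) ` {..<cyc_order r}" for k
    using rho_pow_mod [where r = r and k = k, symmetric] mod_less_divisor [OF cyc_order_pos [of r], of k] by (intro image_eqI) auto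
  then show ?thesis unfolding Cyc_range by auto
qed

lemma rho_pow_inj: "inj_on (\<lambda>k. rho r ^^ k) {..<cyc_order r}"
proof (cases "r = 0")
  case True
  then show ?thesis by (simp add: cyc_order_def inj_on_def)
next
  case False
  show ?thesis
  proof (rule inj_onI)
    fix j k assume jk: "j \<in> {..<cyc_order r}" "k \<in> {..<cyc_order r}" and eq: "rho r ^^ j = rho r ^^ k"
    have "(rho r ^^ j) 1 = 1 + j" "(rho r ^^ k) 1 = 1 + k"
      using rho_pow [of 1 r j] rho_pow [of 1 r k] jk False by (auto simp: cyc_order_def)
    then show "j = k" using eq by simp
  qed
qed

lemma Cyc_permutes: "g \<in> Cyc r \<Longrightarrow> g permutes {1..r}"
  unfolding Cyc_range using rho_pow_permutes by blast

lemma Cyc_comp: "g \<in> Cyc r \<Longrightarrow> k \<in> Cyc r \<Longrightarrow> g \<circ> k \<in> Cyc r"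
proof -
  assume "g \<in> Cyc r" "k \<in> Cyc r"
  then obtain i j where "g = rho r ^^ i" "k = rho r ^^ j" unfolding Cyc_range by blast
  then have "g \<circ> k = rho r ^^ (i + j)" by (simp only: funpow_add)
  then show "g \<circ> k \<in> Cyc r" unfolding Cyc_range by blast
qed

lemma Cyc_id: "id \<in> Cyc r"
  unfolding Cyc_range using rangeI [of "\<lambda>k. rho r ^^ k" 0] by (simp add: id_def)

lemma Cyc_rho: "rho r \<in> Cyc r"
  unfolding Cyc_range using rangeI [of "\<lambda>k. rho r ^^ k" 1] by simp

lemma Cyc_finite: "finite (Cyc r)"
  unfolding Cyc_image by simp

lemma Cyc_one: "\<one>\<^bsub>cyc_group r\<^esub> = id"
  by (simp add: cyc_group_def sym_group_one)

lemma Cyc_mult: "mult (cyc_group r) = (\<circ>)"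
  by (simp add: cyc_group_def sym_group_mult)

lemma sum_Cyc_left:
  assumes "g \<in> Cyc r" shows "(\<Sum>k\<in>Cyc r. F (g \<circ> k)) = (\<Sum>k\<in>Cyc r. F k)"
proof -
  have "inj_on (\<lambda>k. g \<circ> k) (Cyc r)"
    by (rule inj_on_inverseI [where g = "\<lambda>k. inv_into UNIV g \<circ> k"])
      (simp only: o_assoc permutes_inv_o(2) [OF Cyc_permutes [OF assms]] id_o)
  moreover have "(\<lambda>k. g \<circ> k) ` Cyc r \<subseteq> Cyc r" using Cyc_comp [OF assms] by blast
  ultimately have "bij_betw (\<lambda>k. g \<circ> k) (Cyc r) (Cyc r)"
    unfolding bij_betw_def using endo_inj_surj [OF Cyc_finite] by blast
  then show ?thesis by (rule sum.reindex_bij_betw)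
qed

lemma sum_Cyc_right:
  assumes "g \<in> Cyc r" shows "(\<Sum>k\<in>Cyc r. F (k \<circ> g)) = (\<Sum>k\<in>Cyc r. F k)"
proof -
  have "inj_on (\<lambda>k. k \<circ> g) (Cyc r)"
    by (rule inj_on_inverseI [where g = "\<lambda>k. k \<circ> inv_into UNIV g"])
      (simp only: o_assoc [symmetric] permutes_inv_o(1) [OF Cyc_permutes [OF assms]] o_id)
  moreover have "(\<lambda>k. k \<circ> g) ` Cyc r \<subseteq> Cyc r" using Cyc_comp [OF _ assms] by blast
  ultimately have "bij_betw (\<lambda>k. k \<circ> g) (Cyc r) (Cyc r)"
    unfolding bij_betw_def using endo_inj_surj [OF Cyc_finite] by blast
  then show ?thesis by (rule sum.reindex_bij_betw)
qed

lemma sum_Cyc: "(\<Sum>k\<in>Cyc r. F k) = (\<Sum>j<cyc_order r. F (rho r ^^ j))"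
  unfolding Cyc_image by (simp add: sum.reindex [OF rho_pow_inj])

section \<open>The minimal complex\<close>

definition minimal_basis :: "nat \<Rightarrow> int \<Rightarrow> ((nat \<Rightarrow> nat) \<times> nat) set" where
  "minimal_basis r n = {(g, d). g \<in> Cyc r \<and> int d = n}"

definition minimal_bdry :: "nat \<Rightarrow> minimal_elem \<Rightarrow> minimal_elem" where
  "minimal_bdry r = frag_extend (\<lambda>(g, d). minimal_act g (minimal_bdry_gen r d))"

lemma minimal_simps [simp]:
  "chain minimal r n = free_Abelian_group (minimal_basis r n)" "bdry minimal r n = minimal_bdry r" "act minimal r n = minimal_act"
  by (simp_all add: minimal_def minimal_basis_def minimal_bdry_def)

lemma minimal_linear [simp]:
  "minimal_act g 0 = 0" "minimal_act g (x - y) = minimal_act g x - minimal_act g y" "minimal_act g (x + y) = minimal_act g x + minimal_act g y"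
  "minimal_act g (sum F A) = (\<Sum>k\<in>A. minimal_act g (F k))"
  "minimal_bdry r 0 = 0" "minimal_bdry r (x - y) = minimal_bdry r x - minimal_bdry r y" "minimal_bdry r (x + y) = minimal_bdry r x + minimal_bdry r y"
  "minimal_bdry r (sum F A) = (\<Sum>k\<in>A. minimal_bdry r (F k))"
  by (simp_all add: minimal_act_def minimal_bdry_def frag_linear frag_extend_sum')

lemma minimal_act_of [simp]: "minimal_act g (frag_of (k, d)) = frag_of (g \<circ> k, d)"
  by (simp add: minimal_act_def)

lemma minimal_bdry_0 [simp]: "minimal_bdry r (frag_of (g, 0)) = 0"
  by (simp add: minimal_bdry_def)

text \<open>
  The boundary of \<open>g e\<^sub>d\<close> is \<open>g\<close> times that of \<open>e\<^sub>d\<close>, so \<open>g\<close> stands to the left of \<open>T\<close> and \<open>N\<close>.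
\<close>

lemma minimal_bdry_Suc:
  "minimal_bdry r (frag_of (g, Suc d)) =
     (if even d then frag_of (g \<circ> rho r, d) - frag_of (g, d) else (\<Sum>k\<in>Cyc r. frag_of (g \<circ> k, d)))"
  by (simp add: minimal_bdry_def ring_act_def T_elem_def N_elem_def frag_extend_diff frag_extend_sum')

lemma minimal_induct [consumes 1, case_names zero diff one]:
  assumes x: "supp x \<subseteq> minimal_basis r n"
    and "P 0" and "\<And>a b. P a \<Longrightarrow> P b \<Longrightarrow> P (a - b)"
    and "\<And>g d. g \<in> Cyc r \<Longrightarrow> int d = n \<Longrightarrow> P (frag_of (g, d))"
  shows "P x"
  using x by (induction x rule: frag_induction) (use assms in \<open>auto simp: minimal_basis_def\<close>)

lemma keys_sum_subset: "(\<And>k. k \<in> A \<Longrightarrow> supp (F k) \<subseteq> B) \<Longrightarrow> supp (sum F A) \<subseteq> B"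
  by (rule order.trans [OF keys_sum]) blast

lemma keys_minimal_bdry:
  "supp x \<subseteq> minimal_basis r n \<Longrightarrow> supp (minimal_bdry r x) \<subseteq> minimal_basis r (n - 1)"
proof (induction x rule: minimal_induct)
  case (one g d)
  show ?case
  proof (cases d)
    case (Suc e)
    have "supp (frag_of (g \<circ> rho r, e) - frag_of (g, e)) \<subseteq> minimal_basis r (n - 1)"
      by (rule keys_diff_subset) (use one Suc Cyc_comp [OF one(1) Cyc_rho] in \<open>auto simp: minimal_basis_def\<close>)
    moreover have "supp (\<Sum>k\<in>Cyc r. frag_of (g \<circ> k, e)) \<subseteq> minimal_basis r (n - 1)"
      by (rule keys_sum_subset) (use one Suc Cyc_comp [OF one(1)] in \<open>auto simp: minimal_basis_def\<close>)
    ultimately show ?thesis unfolding Suc minimal_bdry_Suc by (cases "even e") (simp_all only: if_True if_False not_False_eq_True)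
  qed simp
qed (simp_all add: keys_diff_subset)

lemma keys_minimal_act:
  assumes g: "g \<in> Cyc r"
  shows "supp x \<subseteq> minimal_basis r n \<Longrightarrow> supp (minimal_act g x) \<subseteq> minimal_basis r n"
proof (induction x rule: minimal_induct)
  case (one k d)
  then show ?case using Cyc_comp [OF g] by (simp add: minimal_basis_def)
qed (simp_all add: keys_diff_subset)

lemma minimal_bdry_bdry: "supp x \<subseteq> minimal_basis r n \<Longrightarrow> minimal_bdry r (minimal_bdry r x) = 0"
proof (induction x rule: minimal_induct)
  case (one g d)
  show ?case
  proof (cases d)
    case (Suc e)
    show ?thesis
    proof (cases e)
      case 0
      then show ?thesis unfolding Suc minimal_bdry_Suc by simp
    next
      case (Suc c)
      have l: "(\<Sum>k\<in>Cyc r. frag_of (h \<circ> k, c)) = (\<Sum>k\<in>Cyc r. frag_of (k, c))" if "h \<in> Cyc r" for h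
        by (rule sum_Cyc_left [OF that, where F = "\<lambda>k. frag_of (k, c)"])
      have rr: "(\<Sum>k\<in>Cyc r. frag_of (g \<circ> k \<circ> rho r, c)) = (\<Sum>k\<in>Cyc r. frag_of (g \<circ> k, c))"
        using sum_Cyc_right [OF Cyc_rho [of r], where F = "\<lambda>k. frag_of (g \<circ> k, c)"] by (simp only: comp_assoc)
      show ?thesis
        unfolding \<open>d = Suc e\<close> Suc minimal_bdry_Suc
        by (cases "even c")
           (simp_all add: minimal_bdry_Suc l [OF one(1)] l [OF Cyc_comp [OF one(1) Cyc_rho]] rr sum_subtractf del: comp_apply)
    qed
  qed simp
qed simp_all

lemma minimal_act_comp: "minimal_act (g \<circ> k) x = minimal_act g (minimal_act k x)"
  by (rule frag_induction [where S = UNIV and c = x]) (auto simp: comp_def)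

lemma minimal_act_id: "minimal_act id x = x"
  by (rule frag_induction [where S = UNIV and c = x]) (auto simp: comp_def)

lemma minimal_bdry_act: "minimal_bdry r (minimal_act g x) = minimal_act g (minimal_bdry r x)"
proof (rule frag_induction [where S = UNIV and c = x])
  fix p :: "(nat \<Rightarrow> nat) \<times> nat"
  obtain k d where p: "p = (k, d)" by (cases p)
  show "minimal_bdry r (minimal_act g (frag_of p)) = minimal_act g (minimal_bdry r (frag_of p))"
    unfolding p by (cases d) (simp_all add: minimal_bdry_Suc comp_def)
qed auto

lemma minimal_module: "gamma_module cyc_group minimal"
proof (rule gamma_module.intro)
  show "comm_group (chain minimal r n)" for r n by (simp add: abelian_free_Abelian_group)
  show "bdry minimal r n \<in> hom (chain minimal r n) (chain minimal r (n - 1))" for r n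
    by (rule homI) (simp_all add: keys_minimal_bdry)
  show "act minimal r n g \<in> hom (chain minimal r n) (chain minimal r n)" if "g \<in> Cyc r" for g r n
    by (rule homI) (simp_all add: keys_minimal_act [OF that])
qed (simp_all only: Cyc_one Cyc_mult minimal_simps carrier_free_Abelian_group_iff one_free_Abelian_group
       minimal_bdry_bdry minimal_act_id minimal_act_comp minimal_bdry_act)

section \<open>The map from the minimal complex\<close>

lemma surj_cyc_module: "gamma_module cyc_group surj_operad"
proof (rule surj_gamma_module [OF _ Cyc_one Cyc_mult])
  show "Cyc r \<subseteq> {p. p permutes {1..r}}" for r using Cyc_permutes by blast
qed

text \<open>
  The action of \<open>T\<close> for even \<open>d\<close>, and of \<open>N\<close> for odd \<open>d\<close>, as in the passage from \<open>e\<^sub>d\<close> to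
  \<open>e\<^sub>d\<^sub>+\<^sub>1\<close>.
\<close>

definition ring_step :: "nat \<Rightarrow> nat \<Rightarrow> (nat list \<Rightarrow>\<^sub>0 int) \<Rightarrow> (nat list \<Rightarrow>\<^sub>0 int)" where
  "ring_step r d x = (if even d then surj_act r (rho r) x - surj_act r id x else (\<Sum>g\<in>Cyc r. surj_act r g x))"

lemma psi_gen_Suc: "psi_gen r (Suc d) = homotopy r (ring_step r d (psi_gen r d))"
  by (simp add: ring_step_def ring_act_def T_elem_def N_elem_def frag_extend_diff frag_extend_sum')

declare psi_gen.simps(2) [simp del]

lemma surj_sum: "surj_act r g (sum F A) = (\<Sum>k\<in>A. surj_act r g (F k))" "surj_bdry r (sum F A) = (\<Sum>k\<in>A. surj_bdry r (F k))"
  by (simp_all add: surj_act_def surj_bdry_def frag_extend_sum')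

context
  fixes r :: nat and n :: int and x :: "nat list \<Rightarrow>\<^sub>0 int"
  assumes x: "supp x \<subseteq> basis r n"
begin

lemma keys_ring_step: "supp (ring_step r d x) \<subseteq> basis r n"
proof -
  note k = keys_act [OF Cyc_permutes x]
  have "supp (surj_act r (rho r) x - surj_act r id x) \<subseteq> basis r n"
    by (rule keys_diff_subset [OF k [OF Cyc_rho] k [OF Cyc_id]])
  moreover have "supp (\<Sum>g\<in>Cyc r. surj_act r g x) \<subseteq> basis r n"
    by (rule keys_sum_subset [OF k])
  ultimately show ?thesis by (simp add: ring_step_def)
qed

lemma bdry_ring_step: "surj_bdry r (ring_step r d x) = ring_step r d (surj_bdry r x)"
  using surj_bdry_act [OF Cyc_permutes x] Cyc_rho Cyc_id by (simp add: ring_step_def surj_sum)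

lemma act_ring_step:
  assumes g: "g \<in> Cyc r"
  shows "surj_act r g (ring_step r d x) =
    (if even d then surj_act r (g \<circ> rho r) x - surj_act r g x else (\<Sum>k\<in>Cyc r. surj_act r (g \<circ> k) x))"
proof -
  have c: "surj_act r (g \<circ> k) x = surj_act r g (surj_act r k x)" if "k \<in> Cyc r" for k
    by (rule surj_act_comp [OF Cyc_permutes [OF g] Cyc_permutes [OF that] x])
  have "(\<Sum>k\<in>Cyc r. surj_act r (g \<circ> k) x) = (\<Sum>k\<in>Cyc r. surj_act r g (surj_act r k x))"
    by (rule sum.cong [OF refl]) (rule c)
  then show ?thesis
    by (simp add: ring_step_def surj_sum c [OF Cyc_rho] surj_act_id [OF x] del: comp_apply)
qed

text \<open>
  This is \<open>N T = T N = 0\<close>: translation permutes the summands of \<open>N\<close>.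
\<close>

lemma ring_step_ring_step: "ring_step r (Suc d) (ring_step r d x) = 0"
proof (cases "even d")
  case True
  have "(\<Sum>g\<in>Cyc r. surj_act r g (ring_step r d x)) = (\<Sum>g\<in>Cyc r. surj_act r (g \<circ> rho r) x - surj_act r g x)"
    by (rule sum.cong [OF refl]) (simp only: act_ring_step True if_True)
  also have "\<dots> = 0"
    unfolding sum_subtractf sum_Cyc_right [OF Cyc_rho [of r], where F = "\<lambda>k. surj_act r k x"] by simp
  finally show ?thesis using True by (simp add: ring_step_def [of r "Suc d"])
next
  case False
  have "surj_act r g (ring_step r d x) = (\<Sum>k\<in>Cyc r. surj_act r k x)" if "g \<in> Cyc r" for g
    using sum_Cyc_left [OF that, where F = "\<lambda>k. surj_act r k x"] act_ring_step [OF that, of d] False by simp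
  then show ?thesis using False by (simp add: ring_step_def [of r "Suc d"] Cyc_rho Cyc_id)
qed

lemma aug_ring_step: "aug r (ring_step r 0 x) = 0"
  using aug_act [OF Cyc_permutes x] Cyc_rho Cyc_id by (simp add: ring_step_def)

end

lemma ring_step_0 [simp]: "ring_step r d 0 = 0"
  by (simp add: ring_step_def)

lemma keys_psi_gen: "supp (psi_gen r d) \<subseteq> basis r (int d)"
proof (induction d)
  case 0
  then show ?case using upt_basis [of r] by (simp del: upt_Suc)
next
  case (Suc d)
  from keys_homotopy [OF keys_ring_step [OF Suc], where d1 = d] show ?case
    unfolding psi_gen_Suc by (simp add: add.commute)
qed

lemma bdry_psi_gen_0: "surj_bdry r (psi_gen r 0) = 0"
proof -
  have "supp (surj_bdry r (psi_gen r 0)) \<subseteq> basis r (int 0 - 1)" by (rule keys_bdry [OF keys_psi_gen])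
  then show ?thesis by (simp add: basis_negative)
qed

text \<open>
  In \<open>\<partial> h y + h \<partial> y = y - aug y (1, \<dots>, r)\<close> with \<open>y = U \<psi> e\<^sub>d\<close> the boundary of \<open>y\<close> vanishes by
  induction and \<open>ring_step_ring_step\<close>. The augmentation of \<open>y\<close> vanishes for \<open>d = 0\<close> because the
  action of \<open>T\<close> changes no augmentation, and for \<open>d > 0\<close> for reasons of degree.
\<close>

lemma bdry_psi_gen_Suc: "surj_bdry r (psi_gen r (Suc d)) = ring_step r d (psi_gen r d)"
proof (induction d)
  case 0
  note k = keys_psi_gen [of r 0]
  have "surj_bdry r (ring_step r 0 (psi_gen r 0)) = 0"
    by (simp only: bdry_ring_step [OF k] bdry_psi_gen_0 ring_step_0)
  then show ?case
    using homotopy [OF keys_ring_step [OF k, of 0]] unfolding psi_gen_Suc aug_ring_step [OF k] by simp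
next
  case (Suc d)
  note k = keys_psi_gen [of r "Suc d"]
  have "surj_bdry r (ring_step r (Suc d) (psi_gen r (Suc d))) = 0"
    by (simp only: bdry_ring_step [OF k] Suc ring_step_ring_step [OF keys_psi_gen])
  moreover have "aug r (ring_step r (Suc d) (psi_gen r (Suc d))) = 0"
    by (rule aug_nonzero_degree [OF keys_ring_step [OF k]]) simp
  ultimately show ?case
    using homotopy [OF keys_ring_step [OF k, of "Suc d"]] unfolding psi_gen_Suc [of r "Suc d"] by simp
qed

lemma psi_linear [simp]:
  "psi_surj r n 0 = 0" "psi_surj r n (x - y) = psi_surj r n x - psi_surj r n y" "psi_surj r n (x + y) = psi_surj r n x + psi_surj r n y"
  "psi_surj r n (sum F A) = (\<Sum>k\<in>A. psi_surj r n (F k))" "psi_surj r n (frag_cmul c x) = frag_cmul c (psi_surj r n x)"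
  "psi_surj r n (frag_of (g, d)) = surj_act r g (psi_gen r d)"
  by (simp_all add: psi_surj_def frag_linear frag_extend_sum')

lemma keys_psi: "supp x \<subseteq> minimal_basis r n \<Longrightarrow> supp (psi_surj r n x) \<subseteq> basis r n"
proof (induction x rule: minimal_induct)
  case (one g d)
  then show ?case using keys_act [OF Cyc_permutes keys_psi_gen, of g r d] by simp
qed (simp_all add: keys_diff_subset)

lemma psi_bdry: "supp x \<subseteq> minimal_basis r n \<Longrightarrow> surj_bdry r (psi_surj r n x) = psi_surj r (n - 1) (minimal_bdry r x)"
proof (induction x rule: minimal_induct)
  case (one g d)
  have b: "surj_bdry r (psi_surj r n (frag_of (g, d))) = surj_act r g (surj_bdry r (psi_gen r d))"
    by (simp add: surj_bdry_act [OF Cyc_permutes [OF one(1)] keys_psi_gen])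
  show ?case
  proof (cases d)
    case 0
    then show ?thesis unfolding b by (simp only: bdry_psi_gen_0 surj_act_linear minimal_bdry_0 psi_linear)
  next
    case (Suc e)
    show ?thesis
      unfolding b unfolding Suc bdry_psi_gen_Suc act_ring_step [OF keys_psi_gen one(1)] minimal_bdry_Suc by simp
  qed
qed simp_all

lemma psi_act:
  assumes g: "g \<in> Cyc r"
  shows "supp x \<subseteq> minimal_basis r n \<Longrightarrow> psi_surj r n (minimal_act g x) = surj_act r g (psi_surj r n x)"
proof (induction x rule: minimal_induct)
  case (one k d)
  show ?case
    unfolding minimal_act_of psi_linear by (rule surj_act_comp [OF Cyc_permutes [OF g] Cyc_permutes [OF one(1)] keys_psi_gen])
qed simp_all

lemma psi_morphism: "C_morphism minimal surj_operad psi_surj"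
proof (intro gamma_morphism.intro gamma_morphism_axioms.intro minimal_module surj_cyc_module)
  show "psi_surj r n \<in> hom (chain minimal r n) (chain surj_operad r n)" for r n
    by (rule homI) (simp_all add: keys_psi)
  show "bdry surj_operad r n (psi_surj r n x) = psi_surj r (n - 1) (bdry minimal r n x)"
    if "x \<in> carrier (chain minimal r n)" for r n x
    using psi_bdry that by simp
  show "psi_surj r n (act minimal r n g x) = act surj_operad r n g (psi_surj r n x)"
    if "g \<in> Cyc r" "x \<in> carrier (chain minimal r n)" for g r n x
    using psi_act that by simp
qed

section \<open>Contraction of the minimal complex\<close>

definition rho_index :: "nat \<Rightarrow> (nat \<Rightarrow> nat) \<Rightarrow> nat" where
  "rho_index r = inv_into {..<cyc_order r} (\<lambda>k. rho r ^^ k)"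

lemma rho_index [simp]: "k < cyc_order r \<Longrightarrow> rho_index r (rho r ^^ k) = k"
  unfolding rho_index_def using inv_into_f_f [OF rho_pow_inj, of k r] by simp

text \<open>
  The contraction of the periodic resolution. In even degrees
  \<open>\<rho>\<^sup>k - 1 = (1 + \<rho> + \<dots> + \<rho>\<^sup>k\<^sup>-\<^sup>1) T\<close> provides a chain that bounds \<open>\<rho>\<^sup>k e\<^sub>d\<close> up to a multiple of
  \<open>e\<^sub>d\<close>. In odd degrees every cycle is a multiple of \<open>N e\<^sub>d\<close>, and this multiple is read off from
  the coefficient of the last power of \<open>\<rho>\<close>.
\<close>

definition minimal_homotopy :: "nat \<Rightarrow> minimal_elem \<Rightarrow> minimal_elem" where
  "minimal_homotopy r = frag_extend (\<lambda>(g, d).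
     if even d then (\<Sum>j<rho_index r g. frag_of (rho r ^^ j, Suc d))
     else if rho_index r g = cyc_order r - 1 then frag_of (id, Suc d) else 0)"

lemma minimal_homotopy_linear [simp]:
  "minimal_homotopy r 0 = 0" "minimal_homotopy r (x - y) = minimal_homotopy r x - minimal_homotopy r y"
  "minimal_homotopy r (sum F A) = (\<Sum>k\<in>A. minimal_homotopy r (F k))"
  by (simp_all add: minimal_homotopy_def frag_linear frag_extend_sum')

lemma minimal_homotopy_of:
  "k < cyc_order r \<Longrightarrow> minimal_homotopy r (frag_of (rho r ^^ k, d)) =
     (if even d then (\<Sum>j<k. frag_of (rho r ^^ j, Suc d)) else if k = cyc_order r - 1 then frag_of (id, Suc d) else 0)"
  by (simp add: minimal_homotopy_def)

lemma keys_minimal_homotopy: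
  "supp x \<subseteq> minimal_basis r n \<Longrightarrow> supp (minimal_homotopy r x) \<subseteq> minimal_basis r (n + 1)"
proof (induction x rule: minimal_induct)
  case (one g d)
  then obtain k where k: "k < cyc_order r" "g = rho r ^^ k" unfolding Cyc_image by blast
  have j: "rho r ^^ j \<in> Cyc r" for j unfolding Cyc_range by blast
  have "supp (\<Sum>j<k. frag_of (rho r ^^ j, Suc d)) \<subseteq> minimal_basis r (n + 1)"
    by (rule keys_sum_subset) (use one(2) j in \<open>simp add: minimal_basis_def\<close>)
  then show ?case unfolding k(2) minimal_homotopy_of [OF k(1)] using one(2) Cyc_id by (simp add: minimal_basis_def)
qed (simp_all add: keys_diff_subset)

lemma aug_psi_gen: "aug r (psi_gen r d) = (if d = 0 then 1 else 0)"
proof (cases d)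
  case 0
  have "aug r (frag_of [1..<Suc r]) = 1" by (rule aug_word [OF upt_basis])
  then show ?thesis unfolding 0 psi_gen.simps(1) by simp
next
  case (Suc e)
  have "aug r (psi_gen r (Suc e)) = 0" by (rule aug_nonzero_degree [OF keys_psi_gen]) simp
  then show ?thesis using Suc by simp
qed

text \<open>
  The multiple of \<open>e\<^sub>0\<close> is expressed through \<open>\<psi>\<close>, because this is the form that relates the
  homology of \<open>\<W>(r)\<close> to that of \<open>\<X>(r)\<close>.
\<close>

lemma minimal_homotopy:
  "supp x \<subseteq> minimal_basis r n \<Longrightarrow>
     minimal_bdry r (minimal_homotopy r x) + minimal_homotopy r (minimal_bdry r x) =
     x - frag_cmul (aug r (psi_surj r n x)) (frag_of (id, 0))"
proof (induction x rule: minimal_induct)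
  case (one g d)
  then obtain k where k: "k < cyc_order r" "g = rho r ^^ k" unfolding Cyc_image by blast
  let ?q = "cyc_order r"
  have id0: "rho r ^^ 0 = id" by (simp add: id_def)
  have aug: "aug r (psi_surj r n (frag_of (g, d))) = (if d = 0 then 1 else 0)"
    unfolding psi_linear aug_act [OF Cyc_permutes [OF one(1)] keys_psi_gen] by (rule aug_psi_gen)
  have tele: "minimal_bdry r (\<Sum>j<k. frag_of (rho r ^^ j, Suc d)) = frag_of (rho r ^^ k, d) - frag_of (id, d)" if "even d"
  proof -
    have "minimal_bdry r (\<Sum>j<k. frag_of (rho r ^^ j, Suc d)) = (\<Sum>j<k. frag_of (rho r ^^ Suc j, d) - frag_of (rho r ^^ j, d))"
      unfolding minimal_linear minimal_bdry_Suc funpow_Suc_right using that by simp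
    also have "\<dots> = frag_of (rho r ^^ k, d) - frag_of (rho r ^^ 0, d)" by (rule sum_lessThan_telescope)
    finally show ?thesis unfolding id0 .
  qed
  show ?case
  proof (cases d)
    case 0
    have "minimal_bdry r (minimal_homotopy r (frag_of (g, 0))) = frag_of (g, 0) - frag_of (id, 0)"
      using tele unfolding k(2) minimal_homotopy_of [OF k(1)] 0 by simp
    then show ?thesis using aug unfolding 0 by (simp del: psi_linear add: id_def)
  next
    case (Suc e)
    have aug0: "aug r (psi_surj r n (frag_of (g, d))) = 0" using aug Suc by simp
    show ?thesis
    proof (cases "even d")
      case True
      then have e: "odd e" using Suc by simp
      have "minimal_homotopy r (minimal_bdry r (frag_of (g, d))) = minimal_homotopy r (\<Sum>c\<in>Cyc r. frag_of (c, e))"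
        unfolding Suc minimal_bdry_Suc using e sum_Cyc_left [OF one(1), where F = "\<lambda>c. frag_of (c, e)"] by simp
      also have "\<dots> = (\<Sum>j<?q. minimal_homotopy r (frag_of (rho r ^^ j, e)))"
        unfolding minimal_homotopy_linear by (rule sum_Cyc)
      also have "\<dots> = (\<Sum>j<?q. if j = ?q - 1 then frag_of (id, d) else 0)"
        by (rule sum.cong [OF refl]) (use e Suc in \<open>simp add: minimal_homotopy_of\<close>)
      also have "\<dots> = frag_of (id, d)" using cyc_order_pos [of r] by simp
      finally have 1: "minimal_homotopy r (minimal_bdry r (frag_of (g, d))) = frag_of (id, d)" .
      have 2: "minimal_bdry r (minimal_homotopy r (frag_of (g, d))) = frag_of (g, d) - frag_of (id, d)"
        using tele [OF True] unfolding k(2) minimal_homotopy_of [OF k(1)] using True by simp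
      show ?thesis unfolding 1 2 aug0 by simp
    next
      case False
      then have e: "even e" using Suc by simp
      have 1: "minimal_homotopy r (minimal_bdry r (frag_of (g, d))) =
          minimal_homotopy r (frag_of (rho r ^^ Suc k, e)) - minimal_homotopy r (frag_of (rho r ^^ k, e))"
        unfolding Suc minimal_bdry_Suc k(2) funpow_Suc_right using e by simp
      show ?thesis
      proof (cases "Suc k < ?q")
        case True
        have "minimal_homotopy r (frag_of (g, d)) = 0"
          unfolding k(2) minimal_homotopy_of [OF k(1)] using False True by auto
        moreover have "minimal_homotopy r (minimal_bdry r (frag_of (g, d))) = frag_of (g, d)"
          unfolding 1 minimal_homotopy_of [OF True] minimal_homotopy_of [OF k(1)] using e Suc k(2) by simp
        ultimately show ?thesis unfolding aug0 by simp
      next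
        case q: False
        then have q: "?q = Suc k" using k(1) by simp
        have "minimal_bdry r (minimal_homotopy r (frag_of (g, d))) = (\<Sum>c\<in>Cyc r. frag_of (c, d))"
          unfolding k(2) minimal_homotopy_of [OF k(1)] using False q by (simp add: minimal_bdry_Suc)
        also have "\<dots> = (\<Sum>j<Suc k. frag_of (rho r ^^ j, d))" unfolding sum_Cyc q ..
        finally have 2: "minimal_bdry r (minimal_homotopy r (frag_of (g, d))) = (\<Sum>j<Suc k. frag_of (rho r ^^ j, d))" .
        have "rho r ^^ Suc k = rho r ^^ 0" using rho_order [of r] unfolding q id0 .
        then have "minimal_homotopy r (frag_of (rho r ^^ Suc k, e)) = 0"
          using minimal_homotopy_of [OF cyc_order_pos, of r e] e by simp
        then have "minimal_homotopy r (minimal_bdry r (frag_of (g, d))) = - (\<Sum>j<k. frag_of (rho r ^^ j, d))"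
          unfolding 1 minimal_homotopy_of [OF k(1)] using e Suc by simp
        then show ?thesis unfolding 2 aug0 using k(2) by simp
      qed
    qed
  qed
qed (simp_all add: algebra_simps frag_cmul_diff_distrib)

text \<open>
  A cycle of \<open>\<W>(r)\<close> whose image bounds has an image with augmentation zero, and then it bounds
  by \<open>minimal_homotopy\<close>. A cycle \<open>y\<close> of \<open>\<X>(r)\<close> is homologous to \<open>aug r y\<close> times \<open>\<psi> e\<^sub>0\<close>.
\<close>

lemma psi_quasi_iso: "quasi_iso minimal surj_operad psi_surj"
proof (rule quasi_isoI [OF psi_morphism])
  fix r n x assume "x \<in> cycles minimal r n" and b: "psi_surj r n x \<in> boundaries surj_operad r n"
  then have x: "supp x \<subseteq> minimal_basis r n" "minimal_bdry r x = 0"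
    by (simp_all add: gamma_module.cycles_iff [OF minimal_module])
  from b obtain y where "supp y \<subseteq> basis r (n + 1)" "psi_surj r n x = surj_bdry r y"
    by (auto simp: boundaries_def)
  then have "aug r (psi_surj r n x) = 0" using aug_bdry by simp
  then have "x = minimal_bdry r (minimal_homotopy r x)" using minimal_homotopy [OF x(1)] x(2) by simp
  moreover have "minimal_homotopy r x \<in> carrier (chain minimal r (n + 1))" using keys_minimal_homotopy [OF x(1)] by simp
  ultimately show "x \<in> boundaries minimal r n" unfolding boundaries_def minimal_simps(2) by (rule image_eqI)
next
  fix r n y assume y: "y \<in> cycles surj_operad r n"
  define x :: minimal_elem where "x = frag_cmul (aug r y) (frag_of (id, 0))"
  have ky: "supp y \<subseteq> basis r n" using y by (simp add: gamma_module.cycles_iff [OF surj_sym_module])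
  have "x \<in> carrier (chain minimal r n) \<and> minimal_bdry r x = 0"
  proof (cases "n = 0")
    case True
    have "minimal_bdry r x = 0" by (simp add: x_def minimal_bdry_def frag_extend_cmul)
    moreover have "supp x \<subseteq> minimal_basis r 0"
      unfolding x_def by (rule order.trans [OF keys_cmul]) (simp add: minimal_basis_def Cyc_id)
    ultimately show ?thesis using True by simp
  next
    case False
    then show ?thesis using aug_nonzero_degree [OF ky] by (simp add: x_def)
  qed
  then have xc: "x \<in> cycles minimal r n" by (simp add: gamma_module.cycles_iff [OF minimal_module])
  have "psi_surj r n x = frag_cmul (aug r y) (frag_of [1..<Suc r])"
    using surj_act_id [OF keys_psi_gen [of r 0]] unfolding x_def psi_linear psi_gen.simps(1) by (simp only:)
  then have "y = surj_bdry r (homotopy r y) \<otimes>\<^bsub>chain surj_operad r n\<^esub> psi_surj r n x"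
    using surj_cycle_decomposition(1) [OF y] by (simp del: upt_Suc)
  moreover have "surj_bdry r (homotopy r y) \<in> boundaries surj_operad r n"
    unfolding boundaries_def surj_operad_simps(2) using surj_cycle_decomposition(2) [OF y] by blast
  ultimately show "\<exists>x\<in>cycles minimal r n. \<exists>b\<in>boundaries surj_operad r n. y = b \<otimes>\<^bsub>chain surj_operad r n\<^esub> psi_surj r n x"
    using xc by blast
qed

lemma operad_morphism_id: "operad_morphism surj_operad surj_operad (\<lambda>r n x. x)"
proof (intro operad_morphism.intro operad_morphism_axioms.intro operad_surj gamma_morphism.intro gamma_morphism_axioms.intro surj_sym_module)
  show "(\<lambda>x. x) \<in> hom (chain surj_operad r n) (chain surj_operad r n)" for r n
    by (auto simp: hom_def)
qed simp_all

theorem theorem19: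
  shows "C_morphism minimal surj_operad psi_surj
    \<and> May_Steenrod TYPE(nat list \<Rightarrow>\<^sub>0 int) surj_operad psi_surj"
proof -
  have "\<exists>(R :: (nat list \<Rightarrow>\<^sub>0 int) operad) \<iota> \<phi>.
      E_infinity R \<and> C_morphism minimal R \<iota> \<and> quasi_iso minimal R \<iota> \<and> operad_morphism R surj_operad \<phi> \<and>
      (\<forall>r n. \<forall>x\<in>carrier (chain minimal r n). psi_surj r n x = \<phi> r n (\<iota> r n x))"
    using E_infinity_surj psi_morphism psi_quasi_iso operad_morphism_id
    by (intro exI [of _ surj_operad] exI [of _ psi_surj] exI [of _ "\<lambda>r n x. x"] conjI) auto
  then show ?thesis
    unfolding May_Steenrod_def using operad_surj psi_morphism by blast
qed

end
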